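(* Let $X=L^1(\Delta,\mathbb P)/R$, where $R$ is the closed linear span of the Rademacher (coordinate) functions. For every bounded linear operator $T:X\to X$, $$\|T^{\mathrm{co}}\|\le \|T\|_w\le 2\|T^{\mathrm{co}}\|.$$ Thus the map $[T]\mapsto T^{\mathrm{co}}$ from the weak Calkin algebra $\mathfrak Q_w(X)$ to $\mathscr B(X^{\mathrm{co}})$ is an injective homomorphism with closed range, and its inverse on its image has norm at most $2$.
   Context: All Banach spaces are real and operators are bounded and linear. Let $\Delta=\{-1,1\}^{\mathbb N}$ with the product probability measure $\mathbb P=\bigotimes_{j\ge1}\frac12(\delta_{-1}+\delta_1)$, $r_j(x)=x_j$, and let $R$ be the closed linear span of $\{r_j:j\ge1\}$ in $L^1(\Delta,\mathbb P)$ (constants not included). For Banach spaces $Y,Z$, $\mathscr B(Y,Z)$ and $\mathscr W(Y,Z)$ are the bounded and the weakly compact operators ($\mathscr B(Y)=\mathscr B(Y,Y)$, etc.). For $A\in\mathscr B(Y,Z)$ put $\|A\|_w=\inf_{W\in\mathscr W(Y,Z)}\|A-W\|$. Let $J_Y:Y\to Y^{**}$ be the canonical embedding, $Y^{\mathrm{co}}=Y^{**}/J_YY$ with the quotient norm, and let $A^{\mathrm{co}}:Y^{\mathrm{co}}\to Z^{\mathrm{co}}$ be the residuum operator $A^{\mathrm{co}}(y^{**}+J_YY)=A^{**}y^{**}+J_ZZ$. The weak Calkin algebra is $\mathfrak Q_w(Y)=\mathscr B(Y)/\mathscr W(Y)$ with norm $\|[T]\|=\|T\|_w$. *)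

theory Defs
  imports "HOL-Probability.Probability"
begin

section \<open>Generalities on normed spaces\<close>

lemma convergent_if_abs_summable:
  fixes X :: "nat \<Rightarrow> 'a::real_normed_vector"
  assumes abs: "\<And>f::nat \<Rightarrow> 'a. summable (\<lambda>n. norm (f n)) \<Longrightarrow> summable f"
    and X: "Cauchy X"
  shows "convergent X"
proof -
  have "\<exists>N. \<forall>m\<ge>N. \<forall>n\<ge>N. norm (X m - X n) < (1/2) ^ k" for k
    by (rule CauchyD[OF X]) simp
  then obtain N where N: "\<And>k m n. m \<ge> N k \<Longrightarrow> n \<ge> N k \<Longrightarrow> norm (X m - X n) < (1/2) ^ k"
    by metis
  define r where "r k = (\<Sum>i\<le>k. N i) + k" for k
  have rN: "N k \<le> r k" for k
    unfolding r_def by (simp add: member_le_sum trans_le_add1)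
  have r: "strict_mono r"
    by (rule strict_mono_Suc_iff[THEN iffD2]) (simp add: r_def)
  have le: "norm (norm (X (r (Suc k)) - X (r k))) \<le> (1/2) ^ k" for k
    using N[of k "r (Suc k)" "r k"] rN[of k] strict_mono_less_eq[OF r, of k "Suc k"]
    by (simp add: less_imp_le)
  have "summable (\<lambda>k. norm (X (r (Suc k)) - X (r k)))"
    by (rule summable_comparison_test[OF exI, of 0 _ "\<lambda>k. (1/2)^k"])
      (use le in \<open>auto intro: summable_geometric\<close>)
  then have "summable (\<lambda>k. X (r (Suc k)) - X (r k))"
    by (rule abs)
  then obtain s where "(\<lambda>n. \<Sum>k<n. X (r (Suc k)) - X (r k)) \<longlonglongrightarrow> s"
    by (auto simp: summable_def sums_def)
  then have "(\<lambda>n. X (r n) - X (r 0)) \<longlonglongrightarrow> s"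
    using sum_lessThan_telescope[of "\<lambda>k. X (r k)"] by simp
  then have "(\<lambda>n. (X (r n) - X (r 0)) + X (r 0)) \<longlonglongrightarrow> s + X (r 0)"
    by (intro tendsto_intros)
  then have lim: "(X \<circ> r) \<longlonglongrightarrow> s + X (r 0)"
    by (simp add: comp_def)
  show ?thesis
    unfolding convergent_def
  proof (rule exI, rule LIMSEQ_I)
    fix e :: real assume "e > 0"
    then obtain M1 where M1: "\<And>m n. m \<ge> M1 \<Longrightarrow> n \<ge> M1 \<Longrightarrow> norm (X m - X n) < e/2"
      using CauchyD[OF X, of "e/2"] by auto
    from \<open>e > 0\<close> obtain M2 where M2: "\<And>n. n \<ge> M2 \<Longrightarrow> norm (X (r n) - (s + X (r 0))) < e/2"
      using LIMSEQ_D[OF lim, of "e/2"] by auto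
    show "\<exists>no. \<forall>n\<ge>no. norm (X n - (s + X (r 0))) < e"
    proof (intro exI[of _ "max M1 M2"] allI impI)
      fix n assume n: "n \<ge> max M1 M2"
      have "norm (X n - X (r n)) < e/2"
        using M1[of n "r n"] n seq_suble[OF r, of n] by simp
      moreover have "norm (X (r n) - (s + X (r 0))) < e/2"
        using M2[of n] n by simp
      ultimately show "norm (X n - (s + X (r 0))) < e"
        using norm_diff_triangle_less[of "X n" "X (r n)" "e/2" "s + X (r 0)" "e/2"] by simp
    qed
  qed
qed

lemma equivp_subspace: "subspace S \<Longrightarrow> equivp (\<lambda>x y. x - y \<in> S)"
proof (rule equivpI)
  assume S: "subspace S"
  show "reflp (\<lambda>x y. x - y \<in> S)"
    using subspace_0[OF S] by (simp add: reflp_def)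
  show "symp (\<lambda>x y. x - y \<in> S)"
    using subspace_neg[OF S] by (force simp: symp_def)
  show "transp (\<lambda>x y. x - y \<in> S)"
    using subspace_add[OF S] by (force simp: transp_def)
qed

lemma coset_add:
  "subspace S \<Longrightarrow> x - x' \<in> S \<Longrightarrow> y - y' \<in> S \<Longrightarrow> (x + y) - (x' + y') \<in> S"
  using subspace_add[of S "x - x'" "y - y'"] by (simp only: add_diff_add)

lemma coset_uminus: "subspace S \<Longrightarrow> x - x' \<in> S \<Longrightarrow> - x - - x' \<in> S"
  using subspace_neg[of S "x - x'"] by (simp only: minus_diff_minus)

lemma coset_diff:
  "subspace S \<Longrightarrow> x - x' \<in> S \<Longrightarrow> y - y' \<in> S \<Longrightarrow> (x - y) - (x' - y') \<in> S"
  using coset_add[of S x x' "- y" "- y'"] coset_uminus[of S y y'] by simp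

lemma coset_scaleR: "subspace S \<Longrightarrow> x - x' \<in> S \<Longrightarrow> c *\<^sub>R x - c *\<^sub>R x' \<in> S"
  using subspace_scale[of S "x - x'" c] by (simp only: scaleR_diff_right)

lemma subspace_closure:
  fixes S :: "'a::real_normed_vector set"
  assumes S: "subspace S"
  shows "subspace (closure S)"
proof (rule subspaceI)
  show "0 \<in> closure S"
    using subspace_0[OF S] closure_subset by blast
next
  fix x y assume "x \<in> closure S" "y \<in> closure S"
  then obtain f g where "\<And>n. f n \<in> S" "f \<longlonglongrightarrow> x" "\<And>n. g n \<in> S" "g \<longlonglongrightarrow> y"
    unfolding closure_sequential by metis
  then have "\<And>n. f n + g n \<in> S" "(\<lambda>n. f n + g n) \<longlonglongrightarrow> x + y"
    using subspace_add[OF S] by (auto intro: tendsto_add)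
  then show "x + y \<in> closure S"
    unfolding closure_sequential by (intro exI[of _ "\<lambda>n. f n + g n"]) simp
next
  fix c :: real and x assume "x \<in> closure S"
  then obtain f where "\<And>n. f n \<in> S" "f \<longlonglongrightarrow> x"
    unfolding closure_sequential by metis
  then have "\<And>n. c *\<^sub>R f n \<in> S" "(\<lambda>n. c *\<^sub>R f n) \<longlonglongrightarrow> c *\<^sub>R x"
    using subspace_scale[OF S] by (auto intro: tendsto_scaleR)
  then show "c *\<^sub>R x \<in> closure S"
    unfolding closure_sequential by (intro exI[of _ "\<lambda>n. c *\<^sub>R f n"]) simp
qed

text \<open>The seminorm \<open>infdist x S = (INF s\<in>S. norm (x - s))\<close> for a linear subspace \<open>S\<close> is the
  quotient norm of the coset \<open>x + S\<close>.\<close>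

lemma infdist_less_witness:
  assumes "infdist x S < e" "S \<noteq> {}"
  obtains s where "s \<in> S" "dist x s < e"
proof -
  have "(INF a\<in>S. dist x a) < e"
    using assms by (simp add: infdist_notempty)
  moreover have "bdd_below (dist x ` S)"
    by (rule bdd_belowI[of _ 0]) auto
  ultimately show ?thesis
    using assms(2) that by (auto simp: cINF_less_iff)
qed

lemma infdist_coset_le:
  fixes x y :: "'a::real_normed_vector"
  assumes S: "subspace S" and xy: "x - y \<in> S"
  shows "infdist x S \<le> infdist y S"
proof (rule field_le_epsilon)
  fix e :: real assume "e > 0"
  then obtain s where s: "s \<in> S" "dist y s < infdist y S + e"
    using infdist_less_witness[of y S "infdist y S + e"] subspace_0[OF S] by auto
  have "infdist x S \<le> dist x (s + (x - y))"
    by (rule infdist_le) (use S s xy in \<open>auto intro: subspace_add\<close>)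
  also have "\<dots> = dist y s"
    by (simp add: dist_norm algebra_simps)
  finally show "infdist x S \<le> infdist y S + e"
    using s by simp
qed

lemma infdist_coset_eq:
  fixes x y :: "'a::real_normed_vector"
  assumes S: "subspace S" and xy: "x - y \<in> S"
  shows "infdist x S = infdist y S"
proof -
  have "y - x \<in> S"
    using subspace_neg[OF S xy] by simp
  then show ?thesis
    using infdist_coset_le[OF S xy] infdist_coset_le[OF S, of y x] by simp
qed

lemma infdist_subspace_le_norm:
  fixes x :: "'a::real_normed_vector"
  assumes "subspace S"
  shows "infdist x S \<le> norm x"
  using infdist_le[OF subspace_0[OF assms], of x] by simp

lemma infdist_subspace_eq_0:
  "subspace S \<Longrightarrow> closed S \<Longrightarrow> infdist x S = 0 \<longleftrightarrow> x \<in> S"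
  using in_closed_iff_infdist_zero[of S x] subspace_0[of S] by auto

lemma infdist_subspace_add:
  fixes x y :: "'a::real_normed_vector"
  assumes S: "subspace S"
  shows "infdist (x + y) S \<le> infdist x S + infdist y S"
proof (rule field_le_epsilon)
  fix e :: real assume e: "e > 0"
  then obtain s where s: "s \<in> S" "dist x s < infdist x S + e/2"
    using infdist_less_witness[of x S "infdist x S + e/2"] subspace_0[OF S] by auto
  from e obtain t where t: "t \<in> S" "dist y t < infdist y S + e/2"
    using infdist_less_witness[of y S "infdist y S + e/2"] subspace_0[OF S] by auto
  have "infdist (x + y) S \<le> dist (x + y) (s + t)"
    by (rule infdist_le) (use S s t in \<open>auto intro: subspace_add\<close>)
  also have "\<dots> \<le> dist x s + dist y t"
    by (rule dist_triangle_add)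
  finally show "infdist (x + y) S \<le> infdist x S + infdist y S + e"
    using s t by simp
qed

lemma infdist_subspace_scaleR:
  fixes x :: "'a::real_normed_vector"
  assumes S: "subspace S"
  shows "infdist (c *\<^sub>R x) S = \<bar>c\<bar> * infdist x S"
proof -
  have le: "infdist (c *\<^sub>R x) S \<le> \<bar>c\<bar> * infdist x S" if "c \<noteq> 0" for c :: real and x
  proof (rule field_le_epsilon)
    fix e :: real assume e: "e > 0"
    then have "infdist x S < infdist x S + e / \<bar>c\<bar>"
      using that by simp
    then obtain s where s: "s \<in> S" "dist x s < infdist x S + e / \<bar>c\<bar>"
      using subspace_0[OF S] by (blast elim: infdist_less_witness)
    have "infdist (c *\<^sub>R x) S \<le> dist (c *\<^sub>R x) (c *\<^sub>R s)"
      by (rule infdist_le) (use S s in \<open>auto intro: subspace_scale\<close>)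
    also have "\<dots> = \<bar>c\<bar> * dist x s"
      by (simp add: dist_norm flip: scaleR_diff_right)
    also have "\<dots> \<le> \<bar>c\<bar> * (infdist x S + e / \<bar>c\<bar>)"
      using s by (intro mult_left_mono) auto
    also have "\<dots> = \<bar>c\<bar> * infdist x S + e"
      using that by (simp add: field_simps)
    finally show "infdist (c *\<^sub>R x) S \<le> \<bar>c\<bar> * infdist x S + e" .
  qed
  show ?thesis
  proof (cases "c = 0")
    case True
    then show ?thesis using subspace_0[OF S] by simp
  next
    case False
    have "\<bar>c\<bar> * infdist x S = \<bar>c\<bar> * infdist (inverse c *\<^sub>R c *\<^sub>R x) S"
      using False by simp
    also have "\<dots> \<le> \<bar>c\<bar> * (\<bar>inverse c\<bar> * infdist (c *\<^sub>R x) S)"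
      by (intro mult_left_mono le) (use False in auto)
    also have "\<dots> = infdist (c *\<^sub>R x) S"
      using False by (simp add: field_simps)
    finally show ?thesis
      using le[OF False, of x] by simp
  qed
qed

text \<open>The Hahn--Banach theorem, in the form that every vector has a norming functional; minimal
  sublinear functionals are linear.\<close>

definition sublinear :: "('a::real_vector \<Rightarrow> real) \<Rightarrow> bool" where
  "sublinear p \<longleftrightarrow> (\<forall>x y. p (x + y) \<le> p x + p y) \<and> (\<forall>c x. 0 \<le> c \<longrightarrow> p (c *\<^sub>R x) = c * p x)"

definition sub_along :: "('a::real_vector \<Rightarrow> real) \<Rightarrow> 'a \<Rightarrow> 'a \<Rightarrow> real" where
  "sub_along p a y = (INF t\<in>{0..}. p (y + t *\<^sub>R a) - t * p a)"

lemma sublinear_0: "sublinear p \<Longrightarrow> p 0 = 0"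
  unfolding sublinear_def by (metis mult_zero_left order_refl scaleR_zero_left)

lemma sublinear_neg_le: "sublinear p \<Longrightarrow> - p (- x) \<le> p x"
  using sublinear_0[of p] unfolding sublinear_def
  by (metis add.right_inverse add.commute minus_le_iff le_minus_iff neg_le_iff_le
      add_le_same_cancel1 diff_0 diff_le_eq)

lemma sub_along_bound:
  assumes p: "sublinear p" and t: "0 \<le> t"
  shows "- p (- y) \<le> p (y + t *\<^sub>R a) - t * p a"
proof -
  have "t * p a = p ((y + t *\<^sub>R a) + - y)"
    using p t by (simp add: sublinear_def)
  also have "\<dots> \<le> p (y + t *\<^sub>R a) + p (- y)"
    using p unfolding sublinear_def by blast
  finally show ?thesis by simp
qed

lemma sub_along_bdd:
  "sublinear p \<Longrightarrow> bdd_below ((\<lambda>t. p (y + t *\<^sub>R a) - t * p a) ` {0..})"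
  using sub_along_bound by (intro bdd_belowI[of _ "- p (- y)"]) auto

lemma sub_along_le:
  assumes "sublinear p" "0 \<le> t"
  shows "sub_along p a y \<le> p (y + t *\<^sub>R a) - t * p a"
  unfolding sub_along_def by (rule cINF_lower[OF sub_along_bdd]) (use assms in auto)

lemma sub_along_witness:
  assumes p: "sublinear p" and e: "e > 0"
  obtains t where "0 \<le> t" "p (y + t *\<^sub>R a) - t * p a < sub_along p a y + e"
proof -
  have "(INF t\<in>{0..}. p (y + t *\<^sub>R a) - t * p a) < sub_along p a y + e"
    using e by (simp add: sub_along_def)
  then obtain t where "t \<in> {0..}" "p (y + t *\<^sub>R a) - t * p a < sub_along p a y + e"
    using cINF_less_iff[OF _ sub_along_bdd[OF p, of y a]] by auto
  then show ?thesis
    using that by simp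
qed

lemma sublinear_sub_along:
  fixes p :: "'a::real_vector \<Rightarrow> real"
  assumes p: "sublinear p"
  shows "sublinear (sub_along p a)"
proof -
  have add: "p (x + y) \<le> p x + p y" for x y
    using p by (simp add: sublinear_def)
  have scale: "0 \<le> c \<Longrightarrow> p (c *\<^sub>R x) = c * p x" for c x
    using p by (simp add: sublinear_def)
  have 1: "sub_along p a (x + y) \<le> sub_along p a x + sub_along p a y" for x y
  proof (rule field_le_epsilon)
    fix e :: real assume e: "e > 0"
    then have e2: "e/2 > 0" by simp
    obtain s where s: "0 \<le> s" "p (x + s *\<^sub>R a) - s * p a < sub_along p a x + e/2"
      using sub_along_witness[OF p e2] by blast
    obtain t where t: "0 \<le> t" "p (y + t *\<^sub>R a) - t * p a < sub_along p a y + e/2"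
      using sub_along_witness[OF p e2] by blast
    have "sub_along p a (x + y) \<le> p (x + y + (s + t) *\<^sub>R a) - (s + t) * p a"
      using sub_along_le[OF p, of "s + t" a "x + y"] s t by simp
    moreover have "p (x + y + (s + t) *\<^sub>R a) \<le> p (x + s *\<^sub>R a) + p (y + t *\<^sub>R a)"
      using add[of "x + s *\<^sub>R a" "y + t *\<^sub>R a"] by (simp add: algebra_simps)
    ultimately show "sub_along p a (x + y) \<le> sub_along p a x + sub_along p a y + e"
      using s t by (simp add: algebra_simps)
  qed
  have 2: "sub_along p a (c *\<^sub>R y) \<le> c * sub_along p a y" if c: "c > 0" for c y
  proof (rule field_le_epsilon)
    fix e :: real assume e: "e > 0"
    then have e2: "e/c > 0" using c by simp
    obtain t where t: "0 \<le> t" "p (y + t *\<^sub>R a) - t * p a < sub_along p a y + e/c"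
      using sub_along_witness[OF p e2] by blast
    have "sub_along p a (c *\<^sub>R y) \<le> p (c *\<^sub>R y + (c * t) *\<^sub>R a) - (c * t) * p a"
      by (rule sub_along_le[OF p]) (use c t in auto)
    also have "p (c *\<^sub>R y + (c * t) *\<^sub>R a) = c * p (y + t *\<^sub>R a)"
      using scale[of c "y + t *\<^sub>R a"] c by (simp add: algebra_simps)
    also have "c * p (y + t *\<^sub>R a) - (c * t) * p a = c * (p (y + t *\<^sub>R a) - t * p a)"
      by (simp add: algebra_simps)
    also have "\<dots> \<le> c * (sub_along p a y + e/c)"
      using t c by (intro mult_left_mono) auto
    also have "\<dots> = c * sub_along p a y + e"
      using c by (simp add: field_simps)
    finally show "sub_along p a (c *\<^sub>R y) \<le> c * sub_along p a y + e" .
  qed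
  have 3: "sub_along p a (c *\<^sub>R y) = c * sub_along p a y" if c: "c > 0" for c y
  proof -
    have "sub_along p a (inverse c *\<^sub>R (c *\<^sub>R y)) \<le> inverse c * sub_along p a (c *\<^sub>R y)"
      by (rule 2) (use c in simp)
    then have "c * sub_along p a y \<le> sub_along p a (c *\<^sub>R y)"
      using c by (simp add: field_simps)
    then show ?thesis using 2[OF c, of y] by simp
  qed
  have 4: "sub_along p a 0 = 0"
  proof -
    have "sub_along p a 0 = (INF t\<in>{0::real..}. 0)"
      unfolding sub_along_def by (rule INF_cong) (auto simp: scale)
    then show ?thesis by simp
  qed
  show ?thesis
    unfolding sublinear_def
  proof (intro conjI allI impI)
    fix c :: real and x :: 'a assume "0 \<le> c"
    then show "sub_along p a (c *\<^sub>R x) = c * sub_along p a x"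
      using 3[of c x] 4 by (cases "c = 0") auto
  qed (rule 1)
qed

lemma sub_along_le_self: "sublinear p \<Longrightarrow> sub_along p a y \<le> p y"
  using sub_along_le[of p 0 a y] by simp

lemma exists_linear_below_sublinear:
  fixes p0 :: "'a::real_vector \<Rightarrow> real"
  assumes p0: "sublinear p0"
  obtains f where "linear f" "\<And>x. f x \<le> p0 x"
proof -
  define A where "A = {p. sublinear p \<and> p \<le> p0}"
  define P where "P p q \<longleftrightarrow> q \<le> p" for p q :: "'a \<Rightarrow> real"
  have po: "partial_order_on A (relation_of P A)"
    by (rule partial_order_on_relation_ofI) (auto simp: P_def)
  have "\<exists>m\<in>A. \<forall>a\<in>A. P m a \<longrightarrow> a = m"
  proof (rule predicate_Zorn[OF po])
    fix C assume C: "C \<in> Chains (relation_of P A)"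
    then have CA: "C \<subseteq> A"
      by (auto simp: Chains_def relation_of_def)
    have tot: "p \<le> q \<or> q \<le> p" if "p \<in> C" "q \<in> C" for p q
      using C that by (auto simp: Chains_def relation_of_def P_def)
    show "\<exists>u\<in>A. \<forall>a\<in>C. P a u"
    proof (cases "C = {}")
      case True
      then show ?thesis using p0 by (auto simp: A_def)
    next
      case False
      define u where "u x = (INF p\<in>C. p x)" for x
      have bdd: "bdd_below ((\<lambda>p. p x) ` C)" for x
      proof (rule bdd_belowI2)
        fix p assume "p \<in> C"
        then have "sublinear p" "p \<le> p0" using CA by (auto simp: A_def)
        then show "- p0 (- x) \<le> p x"
          using sublinear_neg_le[of p x] by (smt (verit) le_fun_def)
      qed
      have lower: "p \<in> C \<Longrightarrow> u x \<le> p x" for p x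
        unfolding u_def by (rule cINF_lower[OF bdd])
      have wit: "\<exists>p\<in>C. p x < u x + e" if "e > 0" for x e
        using cINF_less_iff[OF False bdd, of x "u x + e"] that by (simp add: u_def)
      have add: "u (x + y) \<le> u x + u y" for x y
      proof (rule field_le_epsilon)
        fix e :: real assume "e > 0"
        then obtain p q where p: "p \<in> C" "p x < u x + e/2" and q: "q \<in> C" "q y < u y + e/2"
          using wit[of "e/2"] by (meson half_gt_zero)
        obtain g where g: "g \<in> C" "g \<le> p" "g \<le> q"
          using tot[OF p(1) q(1)] p q by blast
        have "u (x + y) \<le> g (x + y)" by (rule lower[OF g(1)])
        also have "\<dots> \<le> g x + g y"
          using g CA by (auto simp: A_def sublinear_def)
        also have "\<dots> \<le> p x + q y"
          using g by (simp add: le_fun_def add_mono)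
        finally show "u (x + y) \<le> u x + u y + e"
          using p q by simp
      qed
      have scale_le: "u (c *\<^sub>R x) \<le> c * u x" if "c > 0" for c x
      proof (rule field_le_epsilon)
        fix e :: real assume "e > 0"
        then obtain p where p: "p \<in> C" "p x < u x + e/c"
          using wit[of "e/c"] \<open>c > 0\<close> by (meson divide_pos_pos)
        have "u (c *\<^sub>R x) \<le> p (c *\<^sub>R x)" by (rule lower[OF p(1)])
        also have "\<dots> = c * p x"
          using p CA that by (auto simp: A_def sublinear_def)
        also have "\<dots> \<le> c * (u x + e/c)"
          using p that by (intro mult_left_mono) auto
        also have "\<dots> = c * u x + e" using that by (simp add: field_simps)
        finally show "u (c *\<^sub>R x) \<le> c * u x + e" .
      qed
      have scale: "u (c *\<^sub>R x) = c * u x" if "c > 0" for c x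
      proof -
        have "u (inverse c *\<^sub>R (c *\<^sub>R x)) \<le> inverse c * u (c *\<^sub>R x)"
          by (rule scale_le) (use that in simp)
        then have "c * u x \<le> u (c *\<^sub>R x)"
          using that by (simp add: field_simps)
        then show ?thesis using scale_le[OF that, of x] by simp
      qed
      have zero: "u 0 = 0"
      proof -
        have "u 0 = (INF p\<in>C. 0)"
          unfolding u_def by (rule INF_cong) (use CA in \<open>auto simp: A_def sublinear_0\<close>)
        then show ?thesis using False by simp
      qed
      have "sublinear u"
        unfolding sublinear_def
      proof (intro conjI allI impI)
        fix c :: real and x :: 'a assume "0 \<le> c"
        then show "u (c *\<^sub>R x) = c * u x"
          using scale[of c x] zero by (cases "c = 0") auto
      qed (rule add)
      moreover have "u \<le> p0"
      proof -
        from False obtain p where "p \<in> C" by blast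
        then have "u \<le> p" "p \<le> p0" using lower CA by (auto simp: le_fun_def A_def)
        then show ?thesis by simp
      qed
      ultimately show ?thesis
        using lower by (intro bexI[of _ u]) (auto simp: A_def P_def le_fun_def)
    qed
  qed
  then obtain f where f: "sublinear f" "f \<le> p0"
    and min: "\<And>g. sublinear g \<Longrightarrow> g \<le> f \<Longrightarrow> g = f"
    unfolding A_def P_def by (auto dest: order_trans)
  have super: "f y + f a \<le> f (y + a)" for y a
  proof -
    have "sub_along f a = f"
      using sublinear_sub_along[OF f(1)] sub_along_le_self[OF f(1)]
      by (intro min) (auto simp: le_fun_def)
    then show ?thesis
      using sub_along_le[OF f(1), of 1 a y] by simp
  qed
  have add: "f (x + y) = f x + f y" for x y
    using super[of x y] f(1) by (intro antisym) (auto simp: sublinear_def)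
  have neg: "f (- x) = - f x" for x
    using add[of x "- x"] sublinear_0[OF f(1)] by simp
  have "linear f"
  proof (rule linearI)
    fix c :: real and x
    show "f (c *\<^sub>R x) = c *\<^sub>R f x"
    proof (cases "0 \<le> c")
      case True
      then show ?thesis using f(1) by (simp add: sublinear_def)
    next
      case False
      then have "f ((- c) *\<^sub>R x) = (- c) * f x"
        using f(1) unfolding sublinear_def by (metis le_minus_iff minus_zero nle_le)
      then show ?thesis using neg[of "c *\<^sub>R x"] by simp
    qed
  qed (rule add)
  with f(2) show ?thesis by (intro that) (auto simp: le_fun_def)
qed

type_synonym 'a dual = "'a \<Rightarrow>\<^sub>L real"
type_synonym 'a bidual = "'a dual \<Rightarrow>\<^sub>L real"

lemma norming_functional:
  fixes x :: "'a::real_normed_vector"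
  obtains \<phi> :: "'a dual" where "norm \<phi> \<le> 1" "blinfun_apply \<phi> x = norm x"
proof -
  have n: "sublinear (norm :: 'a \<Rightarrow> real)"
    by (simp add: sublinear_def norm_triangle_ineq)
  obtain f where f: "linear f" "\<And>y. f y \<le> sub_along norm x y"
    using exists_linear_below_sublinear[OF sublinear_sub_along[OF n, of x]] by blast
  have le: "f y \<le> norm y" for y
    using f(2)[of y] sub_along_le_self[OF n, of x y] by simp
  have abs: "\<bar>f y\<bar> \<le> norm y" for y
    using le[of y] le[of "- y"] linear_neg[OF f(1), of y] by simp
  have bl: "bounded_linear f"
    using f(1) abs by (intro bounded_linear_intro[of _ 1]) (auto simp: linear_add linear_scale)
  have "f (- x) \<le> - norm x"
    using f(2)[of "- x"] sub_along_le[OF n, of 1 x "- x"] by simp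
  then have "f x = norm x"
    using le[of x] linear_neg[OF f(1), of x] by simp
  moreover have "norm (Blinfun f) \<le> 1"
    by (rule norm_blinfun_bound) (use abs bl in \<open>auto simp: bounded_linear_Blinfun_apply\<close>)
  ultimately show ?thesis
    using bl by (intro that[of "Blinfun f"]) (auto simp: bounded_linear_Blinfun_apply)
qed

section \<open>Weakly compact operators\<close>

text \<open>Function spaces carry the product topology, so \<open>weak_topology\<close> is the coarsest topology
  making all bounded linear functionals continuous.\<close>

definition evaluation :: "'a::real_normed_vector \<Rightarrow> 'a dual \<Rightarrow> real" where
  "evaluation x = (\<lambda>\<phi>. blinfun_apply \<phi> x)"

definition weak_topology :: "'a::real_normed_vector topology" where
  "weak_topology = pullback_topology UNIV evaluation euclidean"

definition weakly_compact_op :: "('a::real_normed_vector \<Rightarrow>\<^sub>L 'b::real_normed_vector) \<Rightarrow> bool" where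
  "weakly_compact_op A \<longleftrightarrow>
    compactin weak_topology (weak_topology closure_of (blinfun_apply A ` cball 0 1))"

lemma topspace_weak_topology [simp]: "topspace weak_topology = UNIV"
  by (simp add: weak_topology_def topspace_pullback_topology)

lemma openin_weak_topology: "openin weak_topology S \<longleftrightarrow> (\<exists>U. open U \<and> S = evaluation -` U)"
  by (simp add: weak_topology_def openin_pullback_topology)

lemma compactin_weak_topology: "compactin weak_topology K \<longleftrightarrow> compact (evaluation ` K)"
proof
  assume K: "compactin weak_topology K"
  have "continuous_map weak_topology euclidean (id \<circ> evaluation)"
    unfolding weak_topology_def by (rule continuous_map_pullback) simp
  then show "compact (evaluation ` K)"
    using image_compactin[OF K, of euclidean evaluation] by simp
next
  assume K: "compact (evaluation ` K)"
  show "compactin weak_topology K"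
    unfolding compactin_def
  proof (intro conjI allI impI)
    fix \<U> assume U: "Ball \<U> (openin weak_topology) \<and> K \<subseteq> \<Union> \<U>"
    then have "\<forall>V\<in>\<U>. \<exists>W. open W \<and> V = evaluation -` W"
      by (simp add: openin_weak_topology)
    then obtain W where W: "\<And>V. V \<in> \<U> \<Longrightarrow> open (W V)" "\<And>V. V \<in> \<U> \<Longrightarrow> V = evaluation -` W V"
      by metis
    have "evaluation ` K \<subseteq> (\<Union>V\<in>\<U>. W V)"
    proof
      fix f assume "f \<in> evaluation ` K"
      then obtain x where x: "x \<in> K" "f = evaluation x" by blast
      then obtain V where V: "V \<in> \<U>" "x \<in> V" using U by blast
      then have "x \<in> evaluation -` W V" using W(2)[OF V(1)] by blast
      then show "f \<in> (\<Union>V\<in>\<U>. W V)" using V(1) x by blast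
    qed
    from compactE_image[OF K W(1) this]
    obtain \<F> where F: "\<F> \<subseteq> \<U>" "finite \<F>" "evaluation ` K \<subseteq> (\<Union>V\<in>\<F>. W V)"
      by blast
    have "K \<subseteq> \<Union> \<F>"
    proof
      fix x assume "x \<in> K"
      then obtain V where V: "V \<in> \<F>" "evaluation x \<in> W V" using F(3) by blast
      then have "x \<in> V" using W(2)[of V] F(1) by blast
      then show "x \<in> \<Union> \<F>" using V(1) by blast
    qed
    with F show "\<exists>\<F>. finite \<F> \<and> \<F> \<subseteq> \<U> \<and> K \<subseteq> \<Union> \<F>" by blast
  qed simp
qed

lemma continuous_on_fun_apply: "continuous_on S (\<lambda>f :: 'a \<Rightarrow> real. f x)"
  by (rule continuous_on_subset[OF continuous_on_product_coordinates]) simp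

lemma compact_fun_imp_closed:
  fixes K :: "('a \<Rightarrow> real) set"
  assumes "compact K"
  shows "closed K"
proof -
  have "Hausdorff_space (product_topology (\<lambda>_::'a. euclidean :: real topology) UNIV)"
    by (simp add: Hausdorff_space_product_topology)
  then have "Hausdorff_space (euclidean :: ('a \<Rightarrow> real) topology)"
    by (simp add: euclidean_product_topology)
  then show ?thesis
    using compactin_imp_closedin[of euclidean K] assms by simp
qed

lemma compact_fun_bounded:
  fixes c :: "'a \<Rightarrow> real"
  shows "compact {f. \<forall>x. \<bar>f x\<bar> \<le> c x}"
proof -
  have "compactin (product_topology (\<lambda>_. euclidean) UNIV) (PiE UNIV (\<lambda>x. cball (0::real) (c x)))"
    by (simp add: compactin_PiE)
  moreover have "PiE UNIV (\<lambda>x. cball (0::real) (c x)) = {f. \<forall>x. \<bar>f x\<bar> \<le> c x}"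
    by (auto simp: PiE_iff)
  ultimately show ?thesis
    by (simp add: euclidean_product_topology)
qed

lemma compact_fun_sums:
  fixes K L :: "('a \<Rightarrow> real) set"
  assumes "compact K" "compact L"
  shows "compact ((\<lambda>(f, g) x. f x + g x) ` (K \<times> L))"
proof (rule compact_continuous_image[OF _ compact_Times[OF assms]])
  have 1: "continuous_on (K \<times> L) (\<lambda>p. fst p x)" for x
    by (rule continuous_on_product_then_coordinatewise[OF continuous_on_fst[OF continuous_on_id]])
  have 2: "continuous_on (K \<times> L) (\<lambda>p. snd p x)" for x
    by (rule continuous_on_product_then_coordinatewise[OF continuous_on_snd[OF continuous_on_id]])
  show "continuous_on (K \<times> L) (\<lambda>(f, g) x. f x + g x)"
    unfolding case_prod_beta
    by (intro continuous_on_coordinatewise_then_product continuous_on_add 1 2)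
qed

lemma Hausdorff_space_weak_topology: "Hausdorff_space (weak_topology :: 'a::real_normed_vector topology)"
  unfolding Hausdorff_space_def
proof (intro allI impI)
  fix x y :: 'a assume xy: "x \<in> topspace weak_topology \<and> y \<in> topspace weak_topology \<and> x \<noteq> y"
  obtain \<phi> :: "'a dual" where "blinfun_apply \<phi> (x - y) = norm (x - y)"
    using norming_functional[of "x - y"] by blast
  then have "blinfun_apply \<phi> x \<noteq> blinfun_apply \<phi> y"
    using xy by (auto simp: blinfun.diff_right)
  then obtain U V where UV: "open U" "open V" "blinfun_apply \<phi> x \<in> U" "blinfun_apply \<phi> y \<in> V"
    "U \<inter> V = {}"
    using hausdorff[of "blinfun_apply \<phi> x" "blinfun_apply \<phi> y"] by blast
  have op: "openin weak_topology (blinfun_apply \<phi> -` T)" if "open T" for T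
    unfolding openin_weak_topology
  proof (intro exI conjI)
    show "open ((\<lambda>f. f \<phi>) -` T)"
      by (rule open_vimage[OF that continuous_on_fun_apply])
    show "blinfun_apply \<phi> -` T = evaluation -` (\<lambda>f. f \<phi>) -` T"
      by (auto simp: evaluation_def)
  qed
  show "\<exists>U V. openin weak_topology U \<and> openin weak_topology V \<and> x \<in> U \<and> y \<in> V \<and> disjnt U V"
    using UV op by (intro exI[of _ "blinfun_apply \<phi> -` U"] exI[of _ "blinfun_apply \<phi> -` V"])
      (auto simp: disjnt_def)
qed

lemma weakly_compact_op_iff:
  "weakly_compact_op A \<longleftrightarrow> (\<exists>K. blinfun_apply A ` cball 0 1 \<subseteq> K \<and> compact (evaluation ` K))"
proof
  assume "weakly_compact_op A"
  moreover have "blinfun_apply A ` cball 0 1 \<subseteq> weak_topology closure_of (blinfun_apply A ` cball 0 1)"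
    by (rule closure_of_subset) simp
  ultimately show "\<exists>K. blinfun_apply A ` cball 0 1 \<subseteq> K \<and> compact (evaluation ` K)"
    unfolding weakly_compact_op_def compactin_weak_topology by blast
next
  assume "\<exists>K. blinfun_apply A ` cball 0 1 \<subseteq> K \<and> compact (evaluation ` K)"
  then obtain K where K: "blinfun_apply A ` cball 0 1 \<subseteq> K" "compactin weak_topology K"
    by (auto simp: compactin_weak_topology)
  then have sub: "weak_topology closure_of (blinfun_apply A ` cball 0 1) \<subseteq> K"
    by (intro closure_of_minimal compactin_imp_closedin Hausdorff_space_weak_topology)
  show "weakly_compact_op A"
    unfolding weakly_compact_op_def by (rule closed_compactin[OF K(2) sub closedin_closure_of])
qed

lemma weakly_compact_op_0: "weakly_compact_op 0"
  unfolding weakly_compact_op_iff by (rule exI[of _ "{0}"]) auto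

lemma weakly_compact_op_add:
  assumes "weakly_compact_op A" "weakly_compact_op B"
  shows "weakly_compact_op (A + B)"
proof -
  from assms obtain K L where K: "blinfun_apply A ` cball 0 1 \<subseteq> K" "compact (evaluation ` K)"
    and L: "blinfun_apply B ` cball 0 1 \<subseteq> L" "compact (evaluation ` L)"
    unfolding weakly_compact_op_iff by blast
  have "evaluation ` (\<lambda>(x, y). x + y) ` (K \<times> L)
      = (\<lambda>(f, g) \<phi>. f \<phi> + g \<phi>) ` (evaluation ` K \<times> evaluation ` L)"
    by (force simp: evaluation_def blinfun.add_right image_iff)
  then have "compact (evaluation ` (\<lambda>(x, y). x + y) ` (K \<times> L))"
    using compact_fun_sums[OF K(2) L(2)] by simp
  moreover have "blinfun_apply (A + B) ` cball 0 1 \<subseteq> (\<lambda>(x, y). x + y) ` (K \<times> L)"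
  proof
    fix y assume "y \<in> blinfun_apply (A + B) ` cball 0 1"
    then obtain x where x: "x \<in> cball 0 1" "y = A x + B x" by (auto simp: blinfun.add_left)
    then have "A x \<in> K" "B x \<in> L" using K(1) L(1) by blast+
    with x(2) show "y \<in> (\<lambda>(x, y). x + y) ` (K \<times> L)" by force
  qed
  ultimately show ?thesis
    unfolding weakly_compact_op_iff by blast
qed

lemma weakly_compact_op_scaleR:
  assumes "weakly_compact_op A"
  shows "weakly_compact_op (c *\<^sub>R A)"
proof -
  from assms obtain K where K: "blinfun_apply A ` cball 0 1 \<subseteq> K" "compact (evaluation ` K)"
    unfolding weakly_compact_op_iff by blast
  have "compact ((\<lambda>f \<phi>. c * f \<phi>) ` evaluation ` K)"
    by (intro compact_continuous_image K(2) continuous_on_coordinatewise_then_product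
        continuous_on_mult continuous_on_const continuous_on_fun_apply)
  moreover have "(\<lambda>f \<phi>. c * f \<phi>) ` evaluation ` K = evaluation ` (\<lambda>x. c *\<^sub>R x) ` K"
    by (simp add: image_image evaluation_def blinfun.scaleR_right)
  moreover have "blinfun_apply (c *\<^sub>R A) ` cball 0 1 \<subseteq> (\<lambda>x. c *\<^sub>R x) ` K"
    using K(1) by (auto simp: blinfun.scaleR_left)
  ultimately show ?thesis
    unfolding weakly_compact_op_iff by metis
qed

lemma weakly_compact_op_comp_left:
  assumes "weakly_compact_op A"
  shows "weakly_compact_op (S o\<^sub>L A)"
proof -
  from assms obtain K where K: "blinfun_apply A ` cball 0 1 \<subseteq> K" "compact (evaluation ` K)"
    unfolding weakly_compact_op_iff by blast
  have "compact ((\<lambda>f \<phi>. f (\<phi> o\<^sub>L S)) ` evaluation ` K)"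
    by (intro compact_continuous_image K(2) continuous_on_coordinatewise_then_product
        continuous_on_fun_apply)
  moreover have "(\<lambda>f \<phi>. f (\<phi> o\<^sub>L S)) ` evaluation ` K = evaluation ` blinfun_apply S ` K"
    by (simp add: image_image evaluation_def)
  moreover have "blinfun_apply (S o\<^sub>L A) ` cball 0 1 \<subseteq> blinfun_apply S ` K"
    using K(1) by auto
  ultimately show ?thesis
    unfolding weakly_compact_op_iff by metis
qed

lemma weakly_compact_op_comp_right:
  assumes "weakly_compact_op A"
  shows "weakly_compact_op (A o\<^sub>L S)"
proof -
  define c where "c = norm S + 1"
  have c: "c > 0" unfolding c_def using norm_ge_zero[of S] by linarith
  obtain K where K: "blinfun_apply (c *\<^sub>R A) ` cball 0 1 \<subseteq> K" "compact (evaluation ` K)"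
    using weakly_compact_op_scaleR[OF assms, of c] unfolding weakly_compact_op_iff by blast
  have "blinfun_apply (A o\<^sub>L S) ` cball 0 1 \<subseteq> K"
  proof
    fix y assume "y \<in> blinfun_apply (A o\<^sub>L S) ` cball 0 1"
    then obtain x where x: "norm x \<le> 1" "y = A (S x)" by auto
    have "norm (S x) \<le> norm S * norm x" by (rule norm_blinfun)
    also have "\<dots> \<le> norm S * 1" using x(1) by (intro mult_left_mono) auto
    also have "\<dots> \<le> c" by (simp add: c_def)
    finally have "inverse c *\<^sub>R S x \<in> cball 0 1"
      using c by (simp add: field_simps)
    moreover have "y = (c *\<^sub>R A) (inverse c *\<^sub>R S x)"
      using c x(2) by (simp add: blinfun.scaleR_left blinfun.scaleR_right)
    ultimately show "y \<in> K" using K(1) by blast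
  qed
  with K(2) show ?thesis
    unfolding weakly_compact_op_iff by blast
qed

lemma subspace_weakly_compact_op: "subspace {A. weakly_compact_op A}"
  by (rule subspaceI)
    (simp_all add: weakly_compact_op_0 weakly_compact_op_add weakly_compact_op_scaleR)

lemma closed_weakly_compact_op:
  "closed {A :: 'a::real_normed_vector \<Rightarrow>\<^sub>L 'b::banach. weakly_compact_op A}"
  unfolding closed_sequential_limits
proof (intro allI impI)
  fix W :: "nat \<Rightarrow> 'a \<Rightarrow>\<^sub>L 'b" and T :: "'a \<Rightarrow>\<^sub>L 'b"
  assume W: "(\<forall>n. W n \<in> {A. weakly_compact_op A}) \<and> W \<longlonglongrightarrow> T"
  then have "\<forall>n. \<exists>K. blinfun_apply (W n) ` cball 0 1 \<subseteq> K \<and> compact (evaluation ` K)"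
    by (simp add: weakly_compact_op_iff)
  then obtain K where K: "\<And>n. blinfun_apply (W n) ` cball 0 1 \<subseteq> K n"
    "\<And>n. compact (evaluation ` K n)"
    by metis
  define e where "e n = norm (T - W n)" for n
  have "(\<lambda>n. norm (W n - T)) \<longlonglongrightarrow> 0"
    using W by (intro tendsto_norm_zero LIM_zero) simp
  then have e0: "e \<longlonglongrightarrow> 0"
    unfolding e_def by (simp add: norm_minus_commute)
  define C where "C = closure (evaluation ` blinfun_apply T ` cball 0 1)"
  define Q where "Q n = {q :: 'b dual \<Rightarrow> real. \<forall>\<phi>. \<bar>q \<phi>\<bar> \<le> e n * norm \<phi>}" for n
  have bnd: "\<bar>blinfun_apply \<phi> (blinfun_apply A x)\<bar> \<le> norm A * norm \<phi>" if "norm x \<le> 1"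
    for \<phi> :: "'b dual" and A :: "'a \<Rightarrow>\<^sub>L 'b" and x
  proof -
    have "norm (blinfun_apply A x) \<le> norm A * norm x" by (rule norm_blinfun)
    also have "\<dots> \<le> norm A * 1" using that by (intro mult_left_mono) auto
    finally have "norm \<phi> * norm (blinfun_apply A x) \<le> norm \<phi> * norm A"
      by (intro mult_left_mono) auto
    then show ?thesis
      using norm_blinfun[of \<phi> "blinfun_apply A x"] by (simp add: mult.commute)
  qed
  have "compact C"
  proof -
    have P: "compact {f. \<forall>\<phi> :: 'b dual. \<bar>f \<phi>\<bar> \<le> norm T * norm \<phi>}"
      by (rule compact_fun_bounded)
    have "C \<subseteq> {f. \<forall>\<phi> :: 'b dual. \<bar>f \<phi>\<bar> \<le> norm T * norm \<phi>}"
      unfolding C_def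
      by (rule closure_minimal[OF _ compact_fun_imp_closed[OF P]])
        (auto simp: evaluation_def bnd)
    then have "C = {f. \<forall>\<phi> :: 'b dual. \<bar>f \<phi>\<bar> \<le> norm T * norm \<phi>} \<inter> C" by blast
    then show ?thesis
      using compact_Int_closed[OF P, of C] by (simp add: C_def)
  qed
  have sub: "C \<subseteq> (\<lambda>(f, g) \<phi>. f \<phi> + g \<phi>) ` (evaluation ` K n \<times> Q n)" for n
    unfolding C_def
  proof (rule closure_minimal)
    show "closed ((\<lambda>(f, g) \<phi>. f \<phi> + g \<phi>) ` (evaluation ` K n \<times> Q n))"
      unfolding Q_def
      by (intro compact_fun_imp_closed compact_fun_sums K(2) compact_fun_bounded)
    show "evaluation ` blinfun_apply T ` cball 0 1
        \<subseteq> (\<lambda>(f, g) \<phi>. f \<phi> + g \<phi>) ` (evaluation ` K n \<times> Q n)"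
    proof (clarify)
      fix x :: 'a assume x: "x \<in> cball 0 1"
      have "evaluation (W n x) \<in> evaluation ` K n" using K(1) x by blast
      moreover have "(\<lambda>\<phi> :: 'b dual. blinfun_apply \<phi> ((T - W n) x)) \<in> Q n"
        using x bnd[of x _ "T - W n"] by (simp add: Q_def e_def)
      moreover have "evaluation (T x) = (\<lambda>\<phi>. evaluation (W n x) \<phi> + blinfun_apply \<phi> ((T - W n) x))"
        by (simp add: evaluation_def blinfun.diff_left blinfun.diff_right)
      ultimately show "evaluation (T x) \<in> (\<lambda>(f, g) \<phi>. f \<phi> + g \<phi>) ` (evaluation ` K n \<times> Q n)"
        by (intro image_eqI[of _ _ "(evaluation (W n x), \<lambda>\<phi> :: 'b dual. blinfun_apply \<phi> ((T - W n) x))"]) auto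
    qed
  qed
  have ran: "f \<in> range evaluation" if f: "f \<in> C" for f
  proof -
    have "\<exists>k. \<forall>\<phi>. \<bar>f \<phi> - blinfun_apply \<phi> k\<bar> \<le> e n * norm \<phi>" for n
    proof -
      from sub[of n] f obtain k q where "f = (\<lambda>\<phi>. evaluation k \<phi> + q \<phi>)" "q \<in> Q n"
        by (auto simp: subset_eq image_iff)
      then show ?thesis by (intro exI[of _ k]) (simp add: evaluation_def Q_def)
    qed
    then obtain k where k: "\<And>n \<phi>. \<bar>f \<phi> - blinfun_apply \<phi> (k n)\<bar> \<le> e n * norm \<phi>"
      by metis
    have e_ge: "0 \<le> e n" for n by (simp add: e_def)
    have kk: "norm (k m - k n) \<le> e m + e n" for m n
    proof -
      obtain \<phi> :: "'b dual" where \<phi>: "norm \<phi> \<le> 1" "\<phi> (k m - k n) = norm (k m - k n)"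
        using norming_functional[of "k m - k n"] by blast
      have "norm (k m - k n) \<le> \<bar>f \<phi> - \<phi> (k m)\<bar> + \<bar>f \<phi> - \<phi> (k n)\<bar>"
        using \<phi>(2) by (simp add: blinfun.diff_right)
      also have "\<dots> \<le> e m * norm \<phi> + e n * norm \<phi>"
        by (intro add_mono k)
      also have "\<dots> \<le> e m * 1 + e n * 1"
        using \<phi>(1) e_ge by (intro add_mono mult_left_mono) auto
      finally show ?thesis by simp
    qed
    have "Cauchy k"
    proof (rule CauchyI)
      fix r :: real assume "0 < r"
      then obtain N where N: "\<And>n. n \<ge> N \<Longrightarrow> norm (e n - 0) < r / 2"
        using LIMSEQ_D[OF e0, of "r/2"] by auto
      show "\<exists>M. \<forall>m\<ge>M. \<forall>n\<ge>M. norm (k m - k n) < r"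
      proof (intro exI[of _ N] allI impI)
        fix m n assume "N \<le> m" "N \<le> n"
        then have "e m < r/2" "e n < r/2" using N[of m] N[of n] by auto
        with kk[of m n] show "norm (k m - k n) < r" by simp
      qed
    qed
    then obtain l where l: "k \<longlonglongrightarrow> l"
      using Cauchy_convergent_iff convergent_def by blast
    have "f \<phi> = blinfun_apply \<phi> l" for \<phi>
    proof -
      have "(\<lambda>n. e n * norm \<phi>) \<longlonglongrightarrow> 0"
        using tendsto_mult_left_zero[OF e0] .
      then have "(\<lambda>n. f \<phi> - \<phi> (k n)) \<longlonglongrightarrow> 0"
        by (rule Lim_null_comparison[rotated]) (use k in simp)
      moreover have "(\<lambda>n. f \<phi> - \<phi> (k n)) \<longlonglongrightarrow> f \<phi> - \<phi> l"
        by (intro tendsto_intros l)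
      ultimately have "f \<phi> - \<phi> l = 0"
        using LIMSEQ_unique by blast
      then show ?thesis by simp
    qed
    then show ?thesis
      by (intro range_eqI[of _ _ l]) (auto simp: evaluation_def)
  qed
  have "evaluation ` evaluation -` C = C"
    using ran by blast
  with \<open>compact C\<close> have "compact (evaluation ` evaluation -` C)" by simp
  moreover have "blinfun_apply T ` cball 0 1 \<subseteq> evaluation -` C"
    unfolding C_def image_subset_iff_subset_vimage[symmetric] by (rule closure_subset)
  ultimately show "T \<in> {A. weakly_compact_op A}"
    unfolding weakly_compact_op_iff mem_Collect_eq by (intro exI conjI)
qed

definition weak_norm :: "('a::real_normed_vector \<Rightarrow>\<^sub>L 'b::real_normed_vector) \<Rightarrow> real" where
  "weak_norm A = (INF W\<in>{W. weakly_compact_op W}. norm (A - W))"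

lemma weak_norm_eq_infdist: "weak_norm A = infdist A {W. weakly_compact_op W}"
  unfolding weak_norm_def using weakly_compact_op_0
  by (subst infdist_notempty) (auto simp: dist_norm)

section \<open>The weak Calkin algebra\<close>

quotient_type (overloaded) 'a weak_calkin = "'a::banach \<Rightarrow>\<^sub>L 'a" / "\<lambda>S T. S - T \<in> {W. weakly_compact_op W}"
  by (rule equivp_subspace[OF subspace_weakly_compact_op])

instantiation weak_calkin :: (banach) real_normed_algebra
begin

lift_definition zero_weak_calkin :: "'a weak_calkin" is 0 .

lift_definition plus_weak_calkin :: "'a weak_calkin \<Rightarrow> 'a weak_calkin \<Rightarrow> 'a weak_calkin" is "(+)"
  by (rule coset_add[OF subspace_weakly_compact_op])

lift_definition minus_weak_calkin :: "'a weak_calkin \<Rightarrow> 'a weak_calkin \<Rightarrow> 'a weak_calkin" is "(-)"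
  by (rule coset_diff[OF subspace_weakly_compact_op])

lift_definition uminus_weak_calkin :: "'a weak_calkin \<Rightarrow> 'a weak_calkin" is uminus
  by (rule coset_uminus[OF subspace_weakly_compact_op])

lift_definition scaleR_weak_calkin :: "real \<Rightarrow> 'a weak_calkin \<Rightarrow> 'a weak_calkin" is scaleR
  by (rule coset_scaleR[OF subspace_weakly_compact_op])

lift_definition times_weak_calkin :: "'a weak_calkin \<Rightarrow> 'a weak_calkin \<Rightarrow> 'a weak_calkin" is "(o\<^sub>L)"
proof -
  fix S S' T T' :: "'a \<Rightarrow>\<^sub>L 'a"
  assume "S - S' \<in> {W. weakly_compact_op W}" "T - T' \<in> {W. weakly_compact_op W}"
  then have "weakly_compact_op (((S - S') o\<^sub>L T) + (S' o\<^sub>L (T - T')))"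
    by (intro weakly_compact_op_add weakly_compact_op_comp_left weakly_compact_op_comp_right) auto
  moreover have "((S - S') o\<^sub>L T) + (S' o\<^sub>L (T - T')) = (S o\<^sub>L T) - (S' o\<^sub>L T')"
    by (rule blinfun_eqI) (simp add: blinfun.bilinear_simps)
  ultimately show "(S o\<^sub>L T) - (S' o\<^sub>L T') \<in> {W. weakly_compact_op W}" by simp
qed

lift_definition norm_weak_calkin :: "'a weak_calkin \<Rightarrow> real" is weak_norm
  unfolding weak_norm_eq_infdist by (rule infdist_coset_eq[OF subspace_weakly_compact_op])

definition "dist x y = norm (x - y)" for x y :: "'a weak_calkin"
definition "sgn x = inverse (norm x) *\<^sub>R x" for x :: "'a weak_calkin"
definition "uniformity = (INF e\<in>{0<..}. principal {(x, y :: 'a weak_calkin). dist x y < e})"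
definition "open U = (\<forall>x\<in>U. \<forall>\<^sub>F (x', y) in uniformity. x' = x \<longrightarrow> y \<in> U)"
  for U :: "'a weak_calkin set"

instance
proof
  fix x y z :: "'a weak_calkin" and a b :: real
  show "x + y + z = x + (y + z)" "x + y = y + x" "0 + x = x" "- x + x = 0" "x - y = x + - y"
    "a *\<^sub>R (x + y) = a *\<^sub>R x + a *\<^sub>R y" "(a + b) *\<^sub>R x = a *\<^sub>R x + b *\<^sub>R x"
    "a *\<^sub>R b *\<^sub>R x = (a * b) *\<^sub>R x" "1 *\<^sub>R x = x"
    by (transfer; simp add: algebra_simps weakly_compact_op_0)+
  have 0: "S - T \<in> {W. weakly_compact_op W}" if "S = T" for S T :: "'a \<Rightarrow>\<^sub>L 'a"
    using that by (simp add: weakly_compact_op_0)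
  show "x * y * z = x * (y * z)" "(x + y) * z = x * z + y * z" "x * (y + z) = x * y + x * z"
    "a *\<^sub>R x * y = a *\<^sub>R (x * y)" "x * a *\<^sub>R y = a *\<^sub>R (x * y)"
    by (transfer; rule 0; rule blinfun_eqI; simp add: blinfun.bilinear_simps)+
  show "norm x = 0 \<longleftrightarrow> x = 0"
    by transfer (simp add: weak_norm_eq_infdist infdist_subspace_eq_0 subspace_weakly_compact_op
        closed_weakly_compact_op)
  show "norm (x + y) \<le> norm x + norm y"
    unfolding weak_norm_eq_infdist
    by transfer (simp add: weak_norm_eq_infdist infdist_subspace_add[OF subspace_weakly_compact_op])
  show "norm (a *\<^sub>R x) = \<bar>a\<bar> * norm x"
    by transfer (simp add: weak_norm_eq_infdist infdist_subspace_scaleR[OF subspace_weakly_compact_op])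
  show "norm (x * y) \<le> norm x * norm y"
    unfolding weak_norm_eq_infdist
  proof transfer
    fix S T :: "'a \<Rightarrow>\<^sub>L 'a"
    let ?I = "{W :: 'a \<Rightarrow>\<^sub>L 'a. weakly_compact_op W}"
    have ne: "?I \<noteq> {}" using weakly_compact_op_0 by blast
    have le: "infdist (S o\<^sub>L T) ?I \<le> (infdist S ?I + e) * (infdist T ?I + e)" if e: "e > 0" for e
    proof -
      have "infdist S ?I < infdist S ?I + e" "infdist T ?I < infdist T ?I + e" using e by auto
      then obtain V W where V: "weakly_compact_op V" "dist S V < infdist S ?I + e"
        and W: "weakly_compact_op W" "dist T W < infdist T ?I + e"
        using ne by (blast elim: infdist_less_witness)
      have "weakly_compact_op ((V o\<^sub>L T) + ((S - V) o\<^sub>L W))"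
        by (intro weakly_compact_op_add weakly_compact_op_comp_left weakly_compact_op_comp_right V W)
      then have "infdist (S o\<^sub>L T) ?I \<le> dist (S o\<^sub>L T) ((V o\<^sub>L T) + ((S - V) o\<^sub>L W))"
        by (intro infdist_le) simp
      also have "(S o\<^sub>L T) - ((V o\<^sub>L T) + ((S - V) o\<^sub>L W)) = (S - V) o\<^sub>L (T - W)"
        by (rule blinfun_eqI) (simp add: blinfun.bilinear_simps)
      then have "dist (S o\<^sub>L T) ((V o\<^sub>L T) + ((S - V) o\<^sub>L W)) = norm ((S - V) o\<^sub>L (T - W))"
        by (simp add: dist_norm)
      also have "\<dots> \<le> norm (S - V) * norm (T - W)"
        by (rule norm_blinfun_compose)
      also have "\<dots> \<le> (infdist S ?I + e) * (infdist T ?I + e)"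
        using V W e infdist_nonneg[of S ?I] by (intro mult_mono) (auto simp: dist_norm)
      finally show ?thesis .
    qed
    have "((\<lambda>e. (infdist S ?I + e) * (infdist T ?I + e))
        \<longlongrightarrow> (infdist S ?I + 0) * (infdist T ?I + 0)) (at_right 0)"
      by (intro tendsto_intros)
    then have "infdist (S o\<^sub>L T) ?I \<le> (infdist S ?I + 0) * (infdist T ?I + 0)"
      by (rule tendsto_lowerbound) (use le in \<open>auto simp: eventually_at_right_less eventually_at_filter\<close>)
    then show "weak_norm (S o\<^sub>L T) \<le> weak_norm S * weak_norm T"
      by (simp add: weak_norm_eq_infdist)
  qed
  show "dist x y = norm (x - y)" by (rule dist_weak_calkin_def)
  show "sgn x = inverse (norm x) *\<^sub>R x" by (rule sgn_weak_calkin_def)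
  show "uniformity = (INF e\<in>{0<..}. principal {(x, y :: 'a weak_calkin). dist x y < e})"
    by (rule uniformity_weak_calkin_def)
  show "open U = (\<forall>x\<in>U. \<forall>\<^sub>F (x', y) in uniformity. x' = x \<longrightarrow> y \<in> U)" for U :: "'a weak_calkin set"
    by (rule open_weak_calkin_def)
qed

end

instantiation weak_calkin :: (banach) monoid_mult
begin

lift_definition one_weak_calkin :: "'a weak_calkin" is id_blinfun .

instance
proof
  fix x :: "'a weak_calkin"
  have 0: "S - T \<in> {W. weakly_compact_op W}" if "S = T" for S T :: "'a \<Rightarrow>\<^sub>L 'a"
    using that by (simp add: weakly_compact_op_0)
  show "1 * x = x" "x * 1 = x"
    by (transfer; rule 0; rule blinfun_eqI; simp)+
qed

end

section \<open>The residuum operator\<close>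

lift_definition canonical_embedding :: "'a::real_normed_vector \<Rightarrow> 'a bidual" is
  "\<lambda>x \<phi>. blinfun_apply \<phi> x"
  by (rule blinfun.bounded_linear_left)

lemma bounded_linear_canonical_embedding: "bounded_linear canonical_embedding"
proof (rule bounded_linear_intro[of _ 1])
  fix x y :: 'a and c :: real
  show "canonical_embedding (x + y) = canonical_embedding x + canonical_embedding y"
    by (rule blinfun_eqI) (simp add: canonical_embedding.rep_eq blinfun.bilinear_simps)
  show "canonical_embedding (c *\<^sub>R x) = c *\<^sub>R canonical_embedding x"
    by (rule blinfun_eqI) (simp add: canonical_embedding.rep_eq blinfun.bilinear_simps)
  show "norm (canonical_embedding x) \<le> norm x * 1"
  proof (rule norm_blinfun_bound)
    fix \<phi> :: "'a dual"
    show "norm (canonical_embedding x \<phi>) \<le> norm x * 1 * norm \<phi>"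
      using norm_blinfun[of \<phi> x] by (simp add: canonical_embedding.rep_eq mult.commute)
  qed simp
qed

lemma norm_canonical_embedding_ge: "norm x \<le> norm (canonical_embedding x)"
proof -
  obtain \<phi> :: "'a dual" where \<phi>: "norm \<phi> \<le> 1" "blinfun_apply \<phi> x = norm x"
    using norming_functional[of x] by blast
  have "norm x \<le> norm (canonical_embedding x) * norm \<phi>"
    using norm_blinfun[of "canonical_embedding x" \<phi>] \<phi>(2)
    by (simp add: canonical_embedding.rep_eq)
  also have "\<dots> \<le> norm (canonical_embedding x) * 1"
    using \<phi>(1) by (intro mult_left_mono) auto
  finally show ?thesis by simp
qed

lemma subspace_range_canonical_embedding: "subspace (range canonical_embedding)"
  using bounded_linear.linear[OF bounded_linear_canonical_embedding]
  by (rule linear_subspace_image) simp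

lemma closed_range_canonical_embedding:
  "closed (range (canonical_embedding :: 'a::banach \<Rightarrow> 'a bidual))"
proof (rule complete_imp_closed, rule complete_isometric_image[of 1])
  show "\<forall>x\<in>UNIV. 1 * norm x \<le> norm (canonical_embedding x)"
    by (simp add: norm_canonical_embedding_ge)
qed (simp_all add: bounded_linear_canonical_embedding complete_UNIV)

quotient_type (overloaded) 'a co = "'a::banach bidual" / "\<lambda>u v. u - v \<in> range canonical_embedding"
  by (rule equivp_subspace[OF subspace_range_canonical_embedding])

instantiation co :: (banach) real_normed_vector
begin

lift_definition zero_co :: "'a co" is 0 .

lift_definition plus_co :: "'a co \<Rightarrow> 'a co \<Rightarrow> 'a co" is "(+)"
  by (rule coset_add[OF subspace_range_canonical_embedding])

lift_definition minus_co :: "'a co \<Rightarrow> 'a co \<Rightarrow> 'a co" is "(-)"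
  by (rule coset_diff[OF subspace_range_canonical_embedding])

lift_definition uminus_co :: "'a co \<Rightarrow> 'a co" is uminus
  by (rule coset_uminus[OF subspace_range_canonical_embedding])

lift_definition scaleR_co :: "real \<Rightarrow> 'a co \<Rightarrow> 'a co" is scaleR
  by (rule coset_scaleR[OF subspace_range_canonical_embedding])

lift_definition norm_co :: "'a co \<Rightarrow> real" is "\<lambda>u. infdist u (range canonical_embedding)"
  by (rule infdist_coset_eq[OF subspace_range_canonical_embedding])

definition "dist x y = norm (x - y)" for x y :: "'a co"
definition "sgn x = inverse (norm x) *\<^sub>R x" for x :: "'a co"
definition "uniformity = (INF e\<in>{0<..}. principal {(x, y :: 'a co). dist x y < e})"
definition "open U = (\<forall>x\<in>U. \<forall>\<^sub>F (x', y) in uniformity. x' = x \<longrightarrow> y \<in> U)" for U :: "'a co set"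

instance
proof
  fix x y z :: "'a co" and a b :: real
  have 0: "u - v \<in> range canonical_embedding" if "u = v" for u v :: "'a bidual"
    using that subspace_0[OF subspace_range_canonical_embedding] by simp
  show "x + y + z = x + (y + z)" "x + y = y + x" "0 + x = x" "- x + x = 0" "x - y = x + - y"
    "a *\<^sub>R (x + y) = a *\<^sub>R x + a *\<^sub>R y" "(a + b) *\<^sub>R x = a *\<^sub>R x + b *\<^sub>R x"
    "a *\<^sub>R b *\<^sub>R x = (a * b) *\<^sub>R x" "1 *\<^sub>R x = x"
    by (transfer; rule 0; simp add: algebra_simps)+
  show "norm x = 0 \<longleftrightarrow> x = 0"
    by transfer (simp add: infdist_subspace_eq_0 subspace_range_canonical_embedding
        closed_range_canonical_embedding)
  show "norm (x + y) \<le> norm x + norm y"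
    by transfer (rule infdist_subspace_add[OF subspace_range_canonical_embedding])
  show "norm (a *\<^sub>R x) = \<bar>a\<bar> * norm x"
    by transfer (rule infdist_subspace_scaleR[OF subspace_range_canonical_embedding])
  show "dist x y = norm (x - y)" by (rule dist_co_def)
  show "sgn x = inverse (norm x) *\<^sub>R x" by (rule sgn_co_def)
  show "uniformity = (INF e\<in>{0<..}. principal {(x, y :: 'a co). dist x y < e})"
    by (rule uniformity_co_def)
  show "open U = (\<forall>x\<in>U. \<forall>\<^sub>F (x', y) in uniformity. x' = x \<longrightarrow> y \<in> U)" for U :: "'a co set"
    by (rule open_co_def)
qed

end

lift_definition adjoint_op ::
  "('a::real_normed_vector \<Rightarrow>\<^sub>L 'b::real_normed_vector) \<Rightarrow> 'b dual \<Rightarrow>\<^sub>L 'a dual" is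
  "\<lambda>A \<phi>. \<phi> o\<^sub>L A"
  by (rule bounded_bilinear.bounded_linear_left[OF bounded_bilinear_blinfun_compose])

lemma adjoint_adjoint_canonical_embedding:
  "adjoint_op (adjoint_op A) (canonical_embedding x) = canonical_embedding (A x)"
  by (rule blinfun_eqI) (simp add: adjoint_op.rep_eq canonical_embedding.rep_eq)

lift_definition residuum_fun :: "('a::banach \<Rightarrow>\<^sub>L 'b::banach) \<Rightarrow> 'a co \<Rightarrow> 'b co" is
  "\<lambda>A u. adjoint_op (adjoint_op A) u"
  by (auto simp: adjoint_adjoint_canonical_embedding simp flip: blinfun.diff_right)

lemma bounded_linear_residuum_fun: "bounded_linear (residuum_fun A)"
proof (rule bounded_linear_intro)
  fix x y :: "'a co" and c :: real
  have 0: "u - v \<in> range canonical_embedding" if "u = v" for u v :: "'b bidual"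
    using that subspace_0[OF subspace_range_canonical_embedding] by simp
  show "residuum_fun A (x + y) = residuum_fun A x + residuum_fun A y"
    by transfer (rule 0, rule blinfun.add_right)
  show "residuum_fun A (c *\<^sub>R x) = c *\<^sub>R residuum_fun A x"
    by transfer (rule 0, rule blinfun.scaleR_right)
  show "norm (residuum_fun A x) \<le> norm x * norm (adjoint_op (adjoint_op A))"
  proof -
    obtain u where u: "x = abs_co u"
      by (induct x rule: co.abs_induct) blast
    let ?B = "adjoint_op (adjoint_op A)"
    have le: "infdist (?B u) (range canonical_embedding) \<le> norm ?B * norm (u - canonical_embedding y)" for y
    proof -
      have "infdist (?B u) (range canonical_embedding) \<le> dist (?B u) (canonical_embedding (A y))"
        by (rule infdist_le) simp
      also have "\<dots> = norm (?B (u - canonical_embedding y))"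
        by (simp add: dist_norm blinfun.diff_right adjoint_adjoint_canonical_embedding)
      also have "\<dots> \<le> norm ?B * norm (u - canonical_embedding y)"
        by (rule norm_blinfun)
      finally show ?thesis .
    qed
    have "infdist (?B u) (range canonical_embedding) \<le> infdist u (range canonical_embedding) * norm ?B"
    proof (cases "norm ?B = 0")
      case True
      with le[of 0] show ?thesis by simp
    next
      case False
      then have pos: "norm ?B > 0" by simp
      have "infdist (?B u) (range canonical_embedding) / norm ?B \<le> infdist u (range canonical_embedding)"
      proof (rule field_le_epsilon)
        fix e :: real assume "e > 0"
        then obtain y where "dist u (canonical_embedding y) < infdist u (range canonical_embedding) + e"
          using infdist_less_witness[of u "range canonical_embedding"
              "infdist u (range canonical_embedding) + e"] by auto
        moreover have "infdist (?B u) (range canonical_embedding) / norm ?B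
            \<le> dist u (canonical_embedding y)"
          using le[of y] pos by (simp add: field_simps dist_norm)
        ultimately show "infdist (?B u) (range canonical_embedding) / norm ?B
            \<le> infdist u (range canonical_embedding) + e" by simp
      qed
      with pos show ?thesis by (simp add: field_simps)
    qed
    then show ?thesis
      by (simp add: u residuum_fun.abs_eq norm_co.abs_eq)
  qed
qed

definition residuum :: "('a::banach \<Rightarrow>\<^sub>L 'b::banach) \<Rightarrow> 'a co \<Rightarrow>\<^sub>L 'b co" where
  "residuum A = Blinfun (residuum_fun A)"

lemma residuum_abs_co: "residuum A (abs_co u) = abs_co (adjoint_op (adjoint_op A) u)"
  by (simp add: residuum_def bounded_linear_Blinfun_apply[OF bounded_linear_residuum_fun]
      residuum_fun.abs_eq)

section \<open>The space \<open>X = L\<^sup>1(\<Delta>, \<P>) / R\<close>\<close>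

text \<open>Coordinates are indexed from \<open>0\<close>. The measure \<open>uniform_count_measure {-1, 1}\<close> is
  \<open>(\<delta>\<^bsub>-1\<^esub> + \<delta>\<^bsub>1\<^esub>) / 2\<close>, so \<open>Delta_prob\<close> is the product measure \<open>\<P>\<close> on \<open>{-1, 1}\<^bsup>\<nat>\<^esup>\<close>.\<close>

definition Delta_prob :: "(nat \<Rightarrow> real) measure" where
  "Delta_prob = PiM UNIV (\<lambda>_. uniform_count_measure {-1, 1})"

definition rademacher :: "nat \<Rightarrow> (nat \<Rightarrow> real) \<Rightarrow> real" where
  "rademacher j x = x j"

lemma prob_space_Delta_prob: "prob_space Delta_prob"
  unfolding Delta_prob_def by (intro prob_space_PiM prob_space_uniform_count_measure) auto

lemma measurable_rademacher [measurable]: "rademacher j \<in> borel_measurable Delta_prob"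
proof -
  have "(\<lambda>x. x j) \<in> measurable Delta_prob (uniform_count_measure {-1, 1::real})"
    unfolding Delta_prob_def by (rule measurable_component_singleton) simp
  moreover have "(\<lambda>y. y) \<in> borel_measurable (uniform_count_measure {-1, 1::real})"
    by (rule measurableI) (auto simp: sets_uniform_count_measure space_uniform_count_measure)
  ultimately have "(\<lambda>x. x j) \<in> borel_measurable Delta_prob"
    by (rule measurable_compose)
  moreover have "rademacher j = (\<lambda>x. x j)" by (auto simp: rademacher_def)
  ultimately show ?thesis by simp
qed

lemma integrable_rademacher: "integrable Delta_prob (rademacher j)"
proof -
  interpret prob_space Delta_prob by (rule prob_space_Delta_prob)
  have "\<bar>rademacher j x\<bar> \<le> 1" if "x \<in> space Delta_prob" for x
  proof -
    have "x j \<in> {-1, 1::real}"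
      using that by (auto simp: Delta_prob_def space_PiM space_uniform_count_measure PiE_iff)
    then show ?thesis by (auto simp: rademacher_def)
  qed
  then show ?thesis
    by (intro integrable_const_bound[of _ 1]) auto
qed

definition L1_rel :: "((nat \<Rightarrow> real) \<Rightarrow> real) \<Rightarrow> ((nat \<Rightarrow> real) \<Rightarrow> real) \<Rightarrow> bool" where
  "L1_rel f g \<longleftrightarrow>
    integrable Delta_prob f \<and> integrable Delta_prob g \<and> (AE x in Delta_prob. f x = g x)"

quotient_type L1_Delta = "(nat \<Rightarrow> real) \<Rightarrow> real" / partial: L1_rel
proof (rule part_equivpI)
  show "\<exists>f. L1_rel f f"
    by (rule exI[of _ "\<lambda>_. 0"]) (simp add: L1_rel_def)
  show "symp L1_rel"
    by (auto simp: symp_def L1_rel_def eq_commute)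
  show "transp L1_rel"
    by (auto simp: transp_def L1_rel_def)
qed

instantiation L1_Delta :: real_normed_vector
begin

lift_definition zero_L1_Delta :: L1_Delta is "\<lambda>_. 0"
  by (simp add: L1_rel_def)

lift_definition plus_L1_Delta :: "L1_Delta \<Rightarrow> L1_Delta \<Rightarrow> L1_Delta" is "\<lambda>f g x. f x + g x"
  by (auto simp: L1_rel_def elim: eventually_elim2)

lift_definition minus_L1_Delta :: "L1_Delta \<Rightarrow> L1_Delta \<Rightarrow> L1_Delta" is "\<lambda>f g x. f x - g x"
  by (auto simp: L1_rel_def elim: eventually_elim2)

lift_definition uminus_L1_Delta :: "L1_Delta \<Rightarrow> L1_Delta" is "\<lambda>f x. - f x"
  by (auto simp: L1_rel_def elim: eventually_mono)

lift_definition scaleR_L1_Delta :: "real \<Rightarrow> L1_Delta \<Rightarrow> L1_Delta" is "\<lambda>c f x. c * f x"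
  by (auto simp: L1_rel_def elim: eventually_mono)

lift_definition norm_L1_Delta :: "L1_Delta \<Rightarrow> real" is "\<lambda>f. \<integral>x. \<bar>f x\<bar> \<partial>Delta_prob"
  unfolding L1_rel_def by (intro integral_cong_AE) (auto elim: eventually_mono)

definition "dist f g = norm (f - g)" for f g :: L1_Delta
definition "sgn f = inverse (norm f) *\<^sub>R f" for f :: L1_Delta
definition "uniformity = (INF e\<in>{0<..}. principal {(f, g :: L1_Delta). dist f g < e})"
definition "open U = (\<forall>f\<in>U. \<forall>\<^sub>F (f', g) in uniformity. f' = f \<longrightarrow> g \<in> U)" for U :: "L1_Delta set"

instance
proof
  fix f g h :: L1_Delta and a b :: real
  show "f + g + h = f + (g + h)" "f + g = g + f" "0 + f = f" "- f + f = 0" "f - g = f + - g"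
    "a *\<^sub>R (f + g) = a *\<^sub>R f + a *\<^sub>R g" "(a + b) *\<^sub>R f = a *\<^sub>R f + b *\<^sub>R f"
    "a *\<^sub>R b *\<^sub>R f = (a * b) *\<^sub>R f" "1 *\<^sub>R f = f"
    by (transfer; simp add: L1_rel_def algebra_simps)+
  show "norm f = 0 \<longleftrightarrow> f = 0"
  proof transfer
    fix f assume "L1_rel f f"
    then have f: "integrable Delta_prob f" by (simp add: L1_rel_def)
    have "(\<integral>x. \<bar>f x\<bar> \<partial>Delta_prob) = 0 \<longleftrightarrow> (AE x in Delta_prob. \<bar>f x\<bar> = 0)"
      using f by (intro integral_nonneg_eq_0_iff_AE) auto
    then show "(\<integral>x. \<bar>f x\<bar> \<partial>Delta_prob) = 0 \<longleftrightarrow> L1_rel f (\<lambda>_. 0)"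
      using f by (simp add: L1_rel_def)
  qed
  show "norm (f + g) \<le> norm f + norm g"
  proof transfer
    fix f g assume "L1_rel f f" "L1_rel g g"
    then have f: "integrable Delta_prob f" "integrable Delta_prob g" by (simp_all add: L1_rel_def)
    have "(\<integral>x. \<bar>f x + g x\<bar> \<partial>Delta_prob) \<le> (\<integral>x. \<bar>f x\<bar> + \<bar>g x\<bar> \<partial>Delta_prob)"
      using f by (intro integral_mono) auto
    also have "\<dots> = (\<integral>x. \<bar>f x\<bar> \<partial>Delta_prob) + (\<integral>x. \<bar>g x\<bar> \<partial>Delta_prob)"
      using f by (intro Bochner_Integration.integral_add) auto
    finally show "(\<integral>x. \<bar>f x + g x\<bar> \<partial>Delta_prob) \<le>
      (\<integral>x. \<bar>f x\<bar> \<partial>Delta_prob) + (\<integral>x. \<bar>g x\<bar> \<partial>Delta_prob)" .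
  qed
  show "norm (a *\<^sub>R f) = \<bar>a\<bar> * norm f"
  proof transfer
    fix a :: real and f :: "(nat \<Rightarrow> real) \<Rightarrow> real"
    have "(\<integral>x. \<bar>a * f x\<bar> \<partial>Delta_prob) = (\<integral>x. \<bar>a\<bar> * \<bar>f x\<bar> \<partial>Delta_prob)"
      by (simp only: abs_mult)
    also have "\<dots> = \<bar>a\<bar> * (\<integral>x. \<bar>f x\<bar> \<partial>Delta_prob)"
      by (rule integral_mult_right_zero)
    finally show "(\<integral>x. \<bar>a * f x\<bar> \<partial>Delta_prob) = \<bar>a\<bar> * (\<integral>x. \<bar>f x\<bar> \<partial>Delta_prob)" .
  qed
  show "dist f g = norm (f - g)" by (rule dist_L1_Delta_def)
  show "sgn f = inverse (norm f) *\<^sub>R f" by (rule sgn_L1_Delta_def)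
  show "uniformity = (INF e\<in>{0<..}. principal {(f, g :: L1_Delta). dist f g < e})"
    by (rule uniformity_L1_Delta_def)
  show "open U = (\<forall>f\<in>U. \<forall>\<^sub>F (f', g) in uniformity. f' = f \<longrightarrow> g \<in> U)" for U :: "L1_Delta set"
    by (rule open_L1_Delta_def)
qed

end

definition rademacher_L1 :: "nat \<Rightarrow> L1_Delta" where
  "rademacher_L1 j = abs_L1_Delta (rademacher j)"

lemma L1_Delta_repr:
  obtains g where "integrable Delta_prob g" "f = abs_L1_Delta g"
proof -
  have "L1_rel (rep_L1_Delta f) (rep_L1_Delta f)" "abs_L1_Delta (rep_L1_Delta f) = f"
    by (rule Quotient3_rep_reflp[OF Quotient3_L1_Delta], rule Quotient3_abs_rep[OF Quotient3_L1_Delta])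
  then show ?thesis by (intro that[of "rep_L1_Delta f"]) (auto simp: L1_rel_def)
qed

lemma norm_abs_L1_Delta:
  "integrable Delta_prob f \<Longrightarrow> norm (abs_L1_Delta f) = (\<integral>x. \<bar>f x\<bar> \<partial>Delta_prob)"
  by (rule norm_L1_Delta.abs_eq) (simp add: L1_rel_def)

lemma diff_abs_L1_Delta:
  "integrable Delta_prob f \<Longrightarrow> integrable Delta_prob g \<Longrightarrow>
    abs_L1_Delta f - abs_L1_Delta g = abs_L1_Delta (\<lambda>x. f x - g x)"
  by (rule minus_L1_Delta.abs_eq) (simp_all add: L1_rel_def)

lemma sum_abs_L1_Delta:
  assumes "\<And>i. integrable Delta_prob (f i)"
  shows "(\<Sum>i<n::nat. abs_L1_Delta (f i)) = abs_L1_Delta (\<lambda>x. \<Sum>i<n. f i x)"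
proof (induction n)
  case 0
  show ?case by (simp add: zero_L1_Delta_def)
next
  case (Suc n)
  have "abs_L1_Delta (\<lambda>x. \<Sum>i<n. f i x) + abs_L1_Delta (f n)
      = abs_L1_Delta (\<lambda>x. (\<Sum>i<n. f i x) + f n x)"
    by (rule plus_L1_Delta.abs_eq) (use assms in \<open>simp_all add: L1_rel_def\<close>)
  with Suc show ?case by simp
qed

instance L1_Delta :: banach
proof
  fix X :: "nat \<Rightarrow> L1_Delta" assume X: "Cauchy X"
  show "convergent X"
  proof (rule convergent_if_abs_summable[OF _ X])
    fix F :: "nat \<Rightarrow> L1_Delta" assume sF: "summable (\<lambda>n. norm (F n))"
    have "\<exists>g. integrable Delta_prob g \<and> F n = abs_L1_Delta g" for n
      using L1_Delta_repr[of "F n"] by metis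
    then obtain f where int: "\<And>n. integrable Delta_prob (f n)" and F: "\<And>n. F n = abs_L1_Delta (f n)"
      by metis
    have [measurable]: "f n \<in> borel_measurable Delta_prob" for n
      using int by auto
    have sf: "summable (\<lambda>n. \<integral>x. \<bar>f n x\<bar> \<partial>Delta_prob)"
      using sF by (simp add: F norm_abs_L1_Delta int)
    have "(\<integral>\<^sup>+x. (\<Sum>n. ennreal \<bar>f n x\<bar>) \<partial>Delta_prob)
        = (\<Sum>n. \<integral>\<^sup>+x. ennreal \<bar>f n x\<bar> \<partial>Delta_prob)"
      by (intro nn_integral_suminf) auto
    also have "\<dots> = (\<Sum>n. ennreal (\<integral>x. \<bar>f n x\<bar> \<partial>Delta_prob))"
      using int by (intro arg_cong[of _ _ suminf] ext nn_integral_eq_integral) auto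
    also have "\<dots> \<noteq> \<infinity>"
      unfolding infinity_ennreal_def by (rule ennreal_suminf_neq_top[OF sf]) simp
    finally have "AE x in Delta_prob. (\<Sum>n. ennreal \<bar>f n x\<bar>) \<noteq> \<infinity>"
      by (intro nn_integral_PInf_AE) auto
    then have AE: "AE x in Delta_prob. summable (\<lambda>n. \<bar>f n x\<bar>)"
      unfolding infinity_ennreal_def
      by eventually_elim (rule summable_suminf_not_top; simp)
    define S where "S x = (\<Sum>n. f n x)" for x
    define w where "w x = (\<Sum>n. \<bar>f n x\<bar>)" for x
    have intS: "integrable Delta_prob S"
      unfolding S_def by (rule integrable_suminf) (use int AE sf in auto)
    have intw: "integrable Delta_prob w"
      unfolding w_def by (rule integrable_suminf) (use int AE sf in auto)
    have [measurable]: "S \<in> borel_measurable Delta_prob" using intS by auto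
    have "(\<lambda>n. \<integral>x. \<bar>(\<Sum>i<n. f i x) - S x\<bar> \<partial>Delta_prob) \<longlonglongrightarrow> (\<integral>x. 0 \<partial>Delta_prob)"
    proof (rule integral_dominated_convergence)
      show "integrable Delta_prob (\<lambda>x. 2 * w x)" using intw by simp
      show "AE x in Delta_prob. (\<lambda>n. \<bar>(\<Sum>i<n. f i x) - S x\<bar>) \<longlonglongrightarrow> 0"
        using AE
      proof eventually_elim
        fix x assume "summable (\<lambda>n. \<bar>f n x\<bar>)"
        then have "(\<lambda>n. \<Sum>i<n. f i x) \<longlonglongrightarrow> S x"
          unfolding S_def by (rule summable_LIMSEQ[OF summable_rabs_cancel])
        then show "(\<lambda>n. \<bar>(\<Sum>i<n. f i x) - S x\<bar>) \<longlonglongrightarrow> 0"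
          by (rule tendsto_rabs_zero[OF LIM_zero])
      qed
      fix n
      show "AE x in Delta_prob. norm \<bar>(\<Sum>i<n. f i x) - S x\<bar> \<le> 2 * w x"
        using AE
      proof eventually_elim
        fix x assume x: "summable (\<lambda>n. \<bar>f n x\<bar>)"
        have "\<bar>\<Sum>i<n. f i x\<bar> \<le> (\<Sum>i<n. \<bar>f i x\<bar>)" by (rule sum_abs)
        also have "\<dots> \<le> w x"
          unfolding w_def by (rule sum_le_suminf[OF x]) auto
        finally have "\<bar>\<Sum>i<n. f i x\<bar> \<le> w x" .
        moreover have "\<bar>S x\<bar> \<le> w x"
          unfolding S_def w_def by (rule summable_rabs[OF x])
        ultimately show "norm \<bar>(\<Sum>i<n. f i x) - S x\<bar> \<le> 2 * w x" by simp
      qed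
    qed measurable
    moreover have "norm ((\<Sum>i<n. F i) - abs_L1_Delta S)
        = (\<integral>x. \<bar>(\<Sum>i<n. f i x) - S x\<bar> \<partial>Delta_prob)" for n
      using int intS by (simp add: F sum_abs_L1_Delta diff_abs_L1_Delta norm_abs_L1_Delta)
    ultimately have "(\<lambda>n. norm ((\<Sum>i<n. F i) - abs_L1_Delta S)) \<longlonglongrightarrow> 0"
      by simp
    then have "(\<lambda>n. \<Sum>i<n. F i) \<longlonglongrightarrow> abs_L1_Delta S"
      by (rule LIM_zero_cancel[OF tendsto_norm_zero_cancel])
    then show "summable F"
      by (auto simp: summable_def sums_def)
  qed
qed

definition Rademacher_span :: "L1_Delta set" where
  "Rademacher_span = closure (span (range rademacher_L1))"

lemma subspace_Rademacher_span: "subspace Rademacher_span"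
  unfolding Rademacher_span_def by (rule subspace_closure[OF subspace_span])

lemma closed_Rademacher_span: "closed Rademacher_span"
  unfolding Rademacher_span_def by simp

quotient_type L1_mod_R = L1_Delta / "\<lambda>f g. f - g \<in> Rademacher_span"
  by (intro equivp_subspace subspace_Rademacher_span)

instantiation L1_mod_R :: real_normed_vector
begin

lift_definition zero_L1_mod_R :: L1_mod_R is 0 .

lift_definition plus_L1_mod_R :: "L1_mod_R \<Rightarrow> L1_mod_R \<Rightarrow> L1_mod_R" is "(+)"
  by (rule coset_add[OF subspace_Rademacher_span])

lift_definition minus_L1_mod_R :: "L1_mod_R \<Rightarrow> L1_mod_R \<Rightarrow> L1_mod_R" is "(-)"
  by (rule coset_diff[OF subspace_Rademacher_span])

lift_definition uminus_L1_mod_R :: "L1_mod_R \<Rightarrow> L1_mod_R" is uminus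
  by (rule coset_uminus[OF subspace_Rademacher_span])

lift_definition scaleR_L1_mod_R :: "real \<Rightarrow> L1_mod_R \<Rightarrow> L1_mod_R" is scaleR
  by (rule coset_scaleR[OF subspace_Rademacher_span])

lift_definition norm_L1_mod_R :: "L1_mod_R \<Rightarrow> real" is "\<lambda>f. infdist f Rademacher_span"
  by (rule infdist_coset_eq[OF subspace_Rademacher_span])

definition "dist x y = norm (x - y)" for x y :: L1_mod_R
definition "sgn x = inverse (norm x) *\<^sub>R x" for x :: L1_mod_R
definition "uniformity = (INF e\<in>{0<..}. principal {(x, y :: L1_mod_R). dist x y < e})"
definition "open U = (\<forall>x\<in>U. \<forall>\<^sub>F (x', y) in uniformity. x' = x \<longrightarrow> y \<in> U)" for U :: "L1_mod_R set"

instance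
proof
  fix x y z :: L1_mod_R and a b :: real
  show "x + y + z = x + (y + z)" "x + y = y + x" "0 + x = x" "- x + x = 0" "x - y = x + - y"
    "a *\<^sub>R (x + y) = a *\<^sub>R x + a *\<^sub>R y" "(a + b) *\<^sub>R x = a *\<^sub>R x + b *\<^sub>R x"
    "a *\<^sub>R b *\<^sub>R x = (a * b) *\<^sub>R x" "1 *\<^sub>R x = x"
    by (transfer; simp add: algebra_simps subspace_0[OF subspace_Rademacher_span])+
  show "norm x = 0 \<longleftrightarrow> x = 0"
    by transfer (simp add: infdist_subspace_eq_0 subspace_Rademacher_span closed_Rademacher_span)
  show "norm (x + y) \<le> norm x + norm y"
    by transfer (rule infdist_subspace_add[OF subspace_Rademacher_span])
  show "norm (a *\<^sub>R x) = \<bar>a\<bar> * norm x"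
    by transfer (rule infdist_subspace_scaleR[OF subspace_Rademacher_span])
  show "dist x y = norm (x - y)" by (rule dist_L1_mod_R_def)
  show "sgn x = inverse (norm x) *\<^sub>R x" by (rule sgn_L1_mod_R_def)
  show "uniformity = (INF e\<in>{0<..}. principal {(x, y :: L1_mod_R). dist x y < e})"
    by (rule uniformity_L1_mod_R_def)
  show "open U = (\<forall>x\<in>U. \<forall>\<^sub>F (x', y) in uniformity. x' = x \<longrightarrow> y \<in> U)" for U :: "L1_mod_R set"
    by (rule open_L1_mod_R_def)
qed

end

lemma abs_L1_mod_R_repr:
  assumes "e > 0"
  obtains f where "abs_L1_mod_R f = x" "norm f < norm x + e"
proof -
  obtain g where g: "x = abs_L1_mod_R g"
    by (induct x rule: L1_mod_R.abs_induct) blast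
  have n: "norm x = infdist g Rademacher_span"
    by (simp add: g norm_L1_mod_R.abs_eq)
  obtain s where s: "s \<in> Rademacher_span" "dist g s < norm x + e"
    using infdist_less_witness[of g Rademacher_span "norm x + e"] assms n
      subspace_0[OF subspace_Rademacher_span] by auto
  have "abs_L1_mod_R (g - s) = x"
    unfolding g L1_mod_R.abs_eq_iff using subspace_neg[OF subspace_Rademacher_span s(1)] by simp
  with s show ?thesis by (intro that[of "g - s"]) (auto simp: dist_norm)
qed

lemma sum_abs_L1_mod_R: "(\<Sum>i<n::nat. abs_L1_mod_R (f i)) = abs_L1_mod_R (\<Sum>i<n. f i)"
  by (induction n) (simp_all add: zero_L1_mod_R.abs_eq plus_L1_mod_R.abs_eq)

instance L1_mod_R :: banach
proof
  fix x :: "nat \<Rightarrow> L1_mod_R" assume x: "Cauchy x"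
  show "convergent x"
  proof (rule convergent_if_abs_summable[OF _ x])
    fix q :: "nat \<Rightarrow> L1_mod_R" assume q: "summable (\<lambda>n. norm (q n))"
    have "\<exists>f. abs_L1_mod_R f = q n \<and> norm f < norm (q n) + (1/2)^n" for n
      by (rule abs_L1_mod_R_repr[of "(1/2)^n" "q n"]) auto
    then obtain f where f: "\<And>n. abs_L1_mod_R (f n) = q n" "\<And>n. norm (f n) < norm (q n) + (1/2)^n"
      by metis
    have "summable (\<lambda>n. norm (q n) + (1/2)^n)"
      by (intro summable_add q summable_geometric) simp
    then have "summable (\<lambda>n. norm (f n))"
      by (rule summable_comparison_test[OF exI, of 0, rotated]) (use f(2) in \<open>auto intro: less_imp_le\<close>)
    then have "(\<lambda>n. \<Sum>i<n. f i) \<longlonglongrightarrow> suminf f"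
      by (rule summable_LIMSEQ[OF summable_norm_cancel])
    then have lim: "(\<lambda>n. norm ((\<Sum>i<n. f i) - suminf f)) \<longlonglongrightarrow> 0"
      by (rule tendsto_norm_zero[OF LIM_zero])
    have le: "norm ((\<Sum>i<n. q i) - abs_L1_mod_R (suminf f)) \<le> norm ((\<Sum>i<n. f i) - suminf f)" for n
      unfolding f(1)[symmetric] sum_abs_L1_mod_R minus_L1_mod_R.abs_eq norm_L1_mod_R.abs_eq
      by (rule infdist_subspace_le_norm[OF subspace_Rademacher_span])
    have "(\<lambda>n. (\<Sum>i<n. q i) - abs_L1_mod_R (suminf f)) \<longlonglongrightarrow> 0"
      by (rule Lim_null_comparison[OF _ lim]) (use le in simp)
    then have "(\<lambda>n. \<Sum>i<n. q i) \<longlonglongrightarrow> abs_L1_mod_R (suminf f)"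
      by (rule LIM_zero_cancel)
    then show "summable q"
      by (auto simp: summable_def sums_def)
  qed
qed

end

theory Submission
  imports Defs
begin

text \<open>Let \<open>q\<close> be the quotient map from \<open>L\<^sup>1(\<Delta>)\<close> onto \<open>X = L\<^sup>1(\<Delta>) / R\<close>, let \<open>T\<close> be an operator on
\<open>X\<close> and let \<open>c\<close> be the norm of its residuum operator.

The lower estimate holds on every Banach space. By Goldstine's theorem the second adjoint of a
weakly compact \<open>W\<close> takes its values in the canonical copy of the target space
(\<open>weakly_compact_op_bidual_range\<close>), so the residuum operator of \<open>W\<close> vanishes; and passing to the
residuum operator does not increase norms. Once the upper estimate is known, the induced map on the
weak Calkin algebra is bounded below; hence it is injective, and its range is closed because the
algebra is complete (\<open>residuum_calkin_embedding\<close>).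

For the upper estimate a weakly compact operator on \<open>X\<close> at distance at most \<open>2 c + 3 \<epsilon>\<close>
from \<open>T\<close> is constructed. The number \<open>c\<close> enters only through the lemma
\<open>lifts_asymptotically_equiintegrable\<close>: if \<open>h\<close> is a lift to \<open>L\<^sup>1(\<Delta>)\<close>, of bounded norm, of a point of
the image under \<open>T\<close> of the unit ball, then the mass of \<open>h\<close> on a set of small measure is at most
\<open>c + \<epsilon>\<close>. Hence such lifts become bounded functions after a perturbation of norm at most
\<open>c + \<epsilon>\<close>. Doing this for the images of the normalised indicator functions of cylinder sets of
length \<open>n\<close>, and passing to a weak limit in \<open>n\<close>, yields an operator \<open>V\<close> from \<open>L\<^sup>1(\<Delta>)\<close> into
\<open>L\<^sup>\<infinity>(\<Delta>)\<close> such that \<open>T q - q V\<close> has norm at most \<open>c + \<epsilon>\<close> (\<open>Linf_valued_approximation\<close>). As an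
operator into \<open>L\<^sup>1(\<Delta>)\<close>, \<open>V\<close> is weakly compact, because bounded sets of \<open>L\<^sup>\<infinity>(\<Delta>)\<close> are relatively
weakly compact in \<open>L\<^sup>1(\<Delta>)\<close>.

The operator \<open>q V\<close> need not vanish on \<open>R\<close>, so it does not act on \<open>X\<close>. Let \<open>E\<close> be the conditional
expectation onto the first \<open>n\<close> coordinates, which fixes the first \<open>n\<close> Rademacher functions and
annihilates the others. Since \<open>T q\<close> vanishes on \<open>R\<close>, the operator \<open>q V + (T q - q V) E\<close> vanishes at
the first \<open>n\<close> Rademacher functions and agrees with \<open>q V\<close> at the others. It differs from \<open>T q\<close> by
\<open>(T q - q V) (1 - E)\<close>, and this is where the factor \<open>2\<close> comes from, since \<open>1 - E\<close> has norm at most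
\<open>2\<close>. What remains on the other Rademacher functions is removed by a weakly compact
operator of norm at most \<open>\<epsilon>\<close> (\<open>rademacher_extension_small\<close>): by Bessel's inequality \<open>V\<close> is
Hilbert--Schmidt from the Hilbert space spanned by the Rademacher functions to \<open>L\<^sup>2(\<Delta>)\<close>, and
Riesz products extend its small tail to an operator on \<open>L\<^sup>1(\<Delta>)\<close> of small norm.\<close>


section \<open>Residuum operators of weakly compact operators\<close>

text \<open>The functionals in \<open>F\<close> map the unit ball to a convex subset of a finite-dimensional Euclidean space.
If \<open>k\<close> nearly minimises the distance to the point given by \<open>u\<close>, the functional \<open>\<psi>\<close> in the direction
from \<open>k\<close> to that point is nearly maximal at \<open>k\<close> on the unit ball. Then \<open>u \<psi>\<close>, which is at most
the norm of \<open>\<psi>\<close>, cannot exceed \<open>\<psi> k\<close> by much; but \<open>u \<psi> - \<psi> k\<close> is the squared distance.\<close>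

lemma goldstine:
  fixes u :: "'a::real_normed_vector bidual" and F :: "'a dual set"
  assumes u: "norm u \<le> 1" and F: "finite F" and e: "e > 0"
  obtains x where "norm x \<le> 1" "\<And>\<phi>. \<phi> \<in> F \<Longrightarrow> \<bar>blinfun_apply \<phi> x - u \<phi>\<bar> < e"
proof -
  define Q where "Q x = (\<Sum>\<phi>\<in>F. (blinfun_apply \<phi> x - u \<phi>)\<^sup>2)" for x :: 'a
  define d where "d = (INF x\<in>cball 0 1. Q x)"
  have Q0: "0 \<le> Q x" for x unfolding Q_def by (intro sum_nonneg) auto
  have bdd: "bdd_below (Q ` cball 0 1)" by (rule bdd_belowI[of _ 0]) (auto simp: Q0)
  have d_le: "d \<le> Q x" if "norm x \<le> 1" for x
    unfolding d_def by (rule cINF_lower[OF bdd]) (use that in simp)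
  \<comment> \<open>\<open>B\<close> bounds the second-order term when \<open>Q\<close> is expanded at a point of the ball.\<close>
  define B where "B = (\<Sum>\<phi>\<in>F. (norm \<phi> * 2)\<^sup>2)"
  have B0: "0 \<le> B" unfolding B_def by (intro sum_nonneg) auto
  define t where "t = min 1 (e\<^sup>2 / (1 + B))"
  have t: "0 < t" "t \<le> 1" "t * (1 + B) \<le> e\<^sup>2"
  proof -
    have "t \<le> e\<^sup>2 / (1 + B)" by (simp add: t_def)
    then show "t * (1 + B) \<le> e\<^sup>2" using B0 by (simp add: le_divide_eq)
  qed (use e B0 in \<open>auto simp: t_def\<close>)
  have "(INF x\<in>cball 0 1. Q x) < d + t\<^sup>2"
    using t by (simp add: d_def)
  then obtain k where k: "norm k \<le> 1" "Q k < d + t\<^sup>2"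
    using cINF_less_iff[OF _ bdd, of "d + t\<^sup>2"] by auto
  define \<psi> where "\<psi> = (\<Sum>\<phi>\<in>F. (u \<phi> - blinfun_apply \<phi> k) *\<^sub>R \<phi>)"
  have \<psi>: "blinfun_apply \<psi> x = (\<Sum>\<phi>\<in>F. (u \<phi> - blinfun_apply \<phi> k) * blinfun_apply \<phi> x)" for x
    unfolding \<psi>_def by (simp add: blinfun.sum_left blinfun.scaleR_left)
  have opt: "\<psi> x \<le> \<psi> k + t * (1 + B) / 2" if x: "norm x \<le> 1" for x
  proof -
    have "norm ((1 - t) *\<^sub>R k + t *\<^sub>R x) \<le> (1 - t) * norm k + t * norm x"
      using norm_triangle_ineq[of "(1 - t) *\<^sub>R k" "t *\<^sub>R x"] t by simp
    also have "\<dots> \<le> (1 - t) * 1 + t * 1"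
      using t k x by (intro add_mono mult_left_mono) auto
    finally have n: "norm ((1 - t) *\<^sub>R k + t *\<^sub>R x) \<le> 1" by simp
    \<comment> \<open>Moving from \<open>k\<close> towards \<open>x\<close> by \<open>t\<close> cannot lower \<open>Q\<close> by more than \<open>t\<^sup>2\<close>, which bounds
      the first-order term \<open>2 t \<psi> (x - k)\<close>.\<close>
    have "Q ((1 - t) *\<^sub>R k + t *\<^sub>R x)
        = (\<Sum>\<phi>\<in>F. (blinfun_apply \<phi> k - u \<phi>)\<^sup>2 + t\<^sup>2 * (blinfun_apply \<phi> (x - k))\<^sup>2 - 2 * t * ((u \<phi> - blinfun_apply \<phi> k) * blinfun_apply \<phi> (x - k)))"
      unfolding Q_def
      by (intro sum.cong refl)
        (simp add: blinfun.add_right blinfun.scaleR_right blinfun.diff_right power2_eq_square algebra_simps)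
    also have "\<dots> = Q k + t\<^sup>2 * (\<Sum>\<phi>\<in>F. (blinfun_apply \<phi> (x - k))\<^sup>2) - 2 * t * \<psi> (x - k)"
      unfolding Q_def \<psi> sum.distrib sum_subtractf sum_distrib_left ..
    finally have eq: "Q ((1 - t) *\<^sub>R k + t *\<^sub>R x)
        = Q k + t\<^sup>2 * (\<Sum>\<phi>\<in>F. (blinfun_apply \<phi> (x - k))\<^sup>2) - 2 * t * \<psi> (x - k)" .
    have "(\<phi> (x - k))\<^sup>2 \<le> (norm \<phi> * 2)\<^sup>2" for \<phi> :: "'a dual"
    proof (rule power2_le_iff_abs_le[THEN iffD2])
      have "norm (x - k) \<le> 2" using norm_triangle_ineq4[of x k] x k by simp
      then show "\<bar>\<phi> (x - k)\<bar> \<le> norm \<phi> * 2"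
        using norm_blinfun[of \<phi> "x - k"] mult_left_mono[of "norm (x - k)" 2 "norm \<phi>"] by simp
    qed simp
    then have "(\<Sum>\<phi>\<in>F. (blinfun_apply \<phi> (x - k))\<^sup>2) \<le> B" unfolding B_def by (intro sum_mono)
    then have "t\<^sup>2 * (\<Sum>\<phi>\<in>F. (blinfun_apply \<phi> (x - k))\<^sup>2) \<le> t\<^sup>2 * B" by (intro mult_left_mono) auto
    with d_le[OF n] k(2) eq have "2 * t * \<psi> (x - k) \<le> t\<^sup>2 * (1 + B)"
      by (simp add: algebra_simps)
    then have "t * (2 * \<psi> (x - k)) \<le> t * (t * (1 + B))" by (simp add: power2_eq_square algebra_simps)
    then have "2 * \<psi> (x - k) \<le> t * (1 + B)" using t by simp
    then show ?thesis by (simp add: blinfun.diff_right)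
  qed
  have s0: "0 \<le> \<psi> k + t * (1 + B) / 2" using opt[of 0] by simp
  have "norm \<psi> \<le> \<psi> k + t * (1 + B) / 2"
  proof (rule norm_blinfun_bound[OF s0])
    fix x
    show "norm (\<psi> x) \<le> (\<psi> k + t * (1 + B) / 2) * norm x"
    proof (cases "x = 0")
      case False
      have "\<psi> ((1 / norm x) *\<^sub>R x) \<le> \<psi> k + t * (1 + B) / 2"
        "\<psi> (- ((1 / norm x) *\<^sub>R x)) \<le> \<psi> k + t * (1 + B) / 2"
        using False by (intro opt; simp)+
      with False show ?thesis
        by (simp add: blinfun.scaleR_right blinfun.minus_right field_simps abs_le_iff)
    qed simp
  qed
  moreover have "u \<psi> \<le> norm \<psi>"
    using norm_blinfun[of u \<psi>] mult_right_mono[OF u norm_ge_zero[of \<psi>]] by simp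
  moreover have "Q k = u \<psi> - \<psi> k"
    unfolding \<psi> unfolding Q_def \<psi>_def blinfun.sum_right blinfun.scaleR_right sum_subtractf[symmetric]
    by (intro sum.cong refl) (simp add: power2_eq_square algebra_simps)
  ultimately have "Q k \<le> t * (1 + B) / 2" by simp
  also have "\<dots> < e\<^sup>2" using t e zero_less_power[OF e, of 2] by linarith
  finally have Qk: "Q k < e\<^sup>2" .
  show ?thesis
  proof (rule that[OF k(1)])
    fix \<phi> assume "\<phi> \<in> F"
    then have "(\<phi> k - u \<phi>)\<^sup>2 \<le> Q k" unfolding Q_def by (intro member_le_sum F) auto
    with Qk have "(\<phi> k - u \<phi>)\<^sup>2 < e\<^sup>2" by simp
    then show "\<bar>\<phi> k - u \<phi>\<bar> < e" using e by (metis abs_le_square_iff abs_of_pos linorder_not_le)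
  qed
qed

lemma open_fun_finite_box:
  fixes p :: "'a \<Rightarrow> real"
  assumes "open U" "p \<in> U"
  obtains F e where "finite F" "e > 0" "\<And>q. (\<And>i. i \<in> F \<Longrightarrow> \<bar>q i - p i\<bar> < e) \<Longrightarrow> q \<in> U"
proof -
  have "openin (product_topology (\<lambda>_. euclidean) UNIV) U"
    using assms(1) by (simp add: euclidean_product_topology)
  from product_topology_open_contains_basis[OF this assms(2)] obtain X where
    X: "p \<in> PiE UNIV X" "\<And>i. open (X i)" "finite {i. X i \<noteq> UNIV}" "PiE UNIV X \<subseteq> U"
    by auto
  have "\<exists>e>0. \<forall>y. \<bar>y - p i\<bar> < e \<longrightarrow> y \<in> X i" for i
  proof -
    have "p i \<in> X i" using X(1) by (auto simp: PiE_iff)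
    then obtain e where "e > 0" "ball (p i) e \<subseteq> X i"
      using X(2) open_contains_ball by blast
    then show ?thesis by (intro exI[of _ e]) (auto simp: dist_real_def subset_eq abs_minus_commute)
  qed
  then obtain e where e: "\<And>i. e i > 0" "\<And>i y. \<bar>y - p i\<bar> < e i \<Longrightarrow> y \<in> X i" by metis
  define F where "F = {i. X i \<noteq> UNIV}"
  have fin: "finite (insert 1 (e ` F))" using X(3) by (simp add: F_def)
  show ?thesis
  proof (rule that[of F "Min (insert 1 (e ` F))"])
    show "finite F" using X(3) by (simp add: F_def)
    show "Min (insert 1 (e ` F)) > 0" using fin e(1) by (subst Min_gr_iff) auto
    fix q assume q: "\<bar>q i - p i\<bar> < Min (insert 1 (e ` F))" if "i \<in> F" for i
    have "q i \<in> X i" for i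
    proof (cases "i \<in> F")
      case True
      then have "Min (insert 1 (e ` F)) \<le> e i" using fin by (intro Min_le) auto
      with q[OF True] show ?thesis by (intro e(2)) simp
    qed (simp add: F_def)
    then show "q \<in> U" using X(4) by (auto simp: PiE_iff)
  qed
qed

text \<open>If \<open>u\<close> lies in the unit ball, Goldstine's theorem puts the second adjoint of \<open>W\<close> at \<open>u\<close> into the
closure of the image of the unit ball under \<open>W\<close>, for the topology of pointwise convergence on the
dual. A weakly compact set is already closed in that topology.\<close>

lemma weakly_compact_op_bidual_range:
  fixes W :: "'a::real_normed_vector \<Rightarrow>\<^sub>L 'b::real_normed_vector"
  assumes W: "weakly_compact_op W"
  shows "adjoint_op (adjoint_op W) u \<in> range canonical_embedding"
proof -
  define c where "c = norm u + 1"
  have c: "c > 0" "norm u \<le> c" unfolding c_def using norm_ge_zero[of u] by linarith+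
  define v where "v = (1 / c) *\<^sub>R u"
  have v: "norm v \<le> 1" using c by (simp add: v_def)
  obtain K where K: "blinfun_apply W ` cball 0 1 \<subseteq> K" "compact (evaluation ` K)"
    using W unfolding weakly_compact_op_iff by blast
  define p where "p = blinfun_apply (adjoint_op (adjoint_op W) v)"
  have p: "p \<phi> = v (\<phi> o\<^sub>L W)" for \<phi> by (simp add: p_def adjoint_op.rep_eq)
  have "p \<in> evaluation ` K"
  proof (rule ccontr)
    assume "p \<notin> evaluation ` K"
    moreover have "open (- (evaluation ` K))"
      using compact_fun_imp_closed[OF K(2)] by (simp add: open_Compl)
    ultimately obtain F e where F: "finite F" "e > 0"
      "\<And>q. (\<And>i. i \<in> F \<Longrightarrow> \<bar>q i - p i\<bar> < e) \<Longrightarrow> q \<in> - (evaluation ` K)"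
      using open_fun_finite_box[of "- (evaluation ` K)" p] by (metis ComplI)
    obtain x where x: "norm x \<le> 1"
      "\<And>\<phi>. \<phi> \<in> (\<lambda>\<phi>. \<phi> o\<^sub>L W) ` F \<Longrightarrow> \<bar>\<phi> x - v \<phi>\<bar> < e"
      using goldstine[OF v finite_imageI[OF F(1)] F(2)] by blast
    have "evaluation (W x) \<in> - (evaluation ` K)"
      by (rule F(3)) (use x(2) in \<open>force simp: evaluation_def p\<close>)
    moreover have "W x \<in> K" using K(1) x(1) by auto
    ultimately show False by blast
  qed
  then obtain k where k: "p = evaluation k" by blast
  have "adjoint_op (adjoint_op W) u = canonical_embedding (c *\<^sub>R k)"
  proof (rule blinfun_eqI)
    fix \<phi>
    have "adjoint_op (adjoint_op W) u \<phi> = c * p \<phi>"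
      using c by (simp add: p_def v_def blinfun.scaleR_right blinfun.scaleR_left)
    then show "adjoint_op (adjoint_op W) u \<phi> = canonical_embedding (c *\<^sub>R k) \<phi>"
      by (simp add: k evaluation_def canonical_embedding.rep_eq blinfun.scaleR_right)
  qed
  then show ?thesis by blast
qed

lemma abs_co_cases:
  obtains u where "x = abs_co u"
  by (induct x rule: co.abs_induct) blast

lemma residuum_add: "residuum (A + B) = residuum A + residuum B"
proof (rule blinfun_eqI)
  fix x :: "'a co"
  obtain u where u: "x = abs_co u" by (rule abs_co_cases)
  have "adjoint_op (adjoint_op (A + B)) u
      = adjoint_op (adjoint_op A) u + adjoint_op (adjoint_op B) u"
    by (rule blinfun_eqI)
      (simp add: adjoint_op.rep_eq blinfun.add_left blinfun.add_right
        bounded_bilinear.add_right[OF bounded_bilinear_blinfun_compose])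
  then show "residuum (A + B) x = (residuum A + residuum B) x"
    by (simp add: u residuum_abs_co blinfun.add_left plus_co.abs_eq)
qed

lemma residuum_scaleR: "residuum (c *\<^sub>R A) = c *\<^sub>R residuum A"
proof (rule blinfun_eqI)
  fix x :: "'a co"
  obtain u where u: "x = abs_co u" by (rule abs_co_cases)
  have "adjoint_op (adjoint_op (c *\<^sub>R A)) u = c *\<^sub>R adjoint_op (adjoint_op A) u"
    by (rule blinfun_eqI)
      (simp add: adjoint_op.rep_eq blinfun.scaleR_left blinfun.scaleR_right
        bounded_bilinear.scaleR_right[OF bounded_bilinear_blinfun_compose])
  then show "residuum (c *\<^sub>R A) x = (c *\<^sub>R residuum A) x"
    by (simp add: u residuum_abs_co blinfun.scaleR_left scaleR_co.abs_eq)
qed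

lemma residuum_diff: "residuum (A - B) = residuum A - residuum B"
  using residuum_add[of A "- B"] residuum_scaleR[of "-1" B] by simp

lemma residuum_compose:
  fixes A :: "'b::banach \<Rightarrow>\<^sub>L 'c::banach" and B :: "'a::banach \<Rightarrow>\<^sub>L 'b"
  shows "residuum (A o\<^sub>L B) = residuum A o\<^sub>L residuum B"
proof (rule blinfun_eqI)
  fix x :: "'a co"
  obtain u where u: "x = abs_co u" by (rule abs_co_cases)
  have "adjoint_op (adjoint_op (A o\<^sub>L B)) u
      = adjoint_op (adjoint_op A) (adjoint_op (adjoint_op B) u)"
  proof (rule blinfun_eqI)
    fix \<phi> :: "'c dual"
    have "\<phi> o\<^sub>L (A o\<^sub>L B) = (\<phi> o\<^sub>L A) o\<^sub>L B" by (rule blinfun_eqI) simp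
    then show "adjoint_op (adjoint_op (A o\<^sub>L B)) u \<phi>
        = adjoint_op (adjoint_op A) (adjoint_op (adjoint_op B) u) \<phi>"
      by (simp add: adjoint_op.rep_eq)
  qed
  then show "residuum (A o\<^sub>L B) x = (residuum A o\<^sub>L residuum B) x"
    by (simp add: u residuum_abs_co)
qed

lemma residuum_id: "residuum id_blinfun = id_blinfun"
proof (rule blinfun_eqI)
  fix x :: "'a co"
  obtain u where u: "x = abs_co u" by (rule abs_co_cases)
  have "adjoint_op (adjoint_op id_blinfun) u = u"
  proof (rule blinfun_eqI)
    fix \<phi> :: "'a dual"
    have "\<phi> o\<^sub>L id_blinfun = \<phi>" by (rule blinfun_eqI) simp
    then show "adjoint_op (adjoint_op id_blinfun) u \<phi> = u \<phi>" by (simp add: adjoint_op.rep_eq)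
  qed
  then show "residuum id_blinfun x = id_blinfun x"
    by (simp add: u residuum_abs_co)
qed

lemma residuum_weakly_compact:
  assumes "weakly_compact_op W"
  shows "residuum W = 0"
proof (rule blinfun_eqI)
  fix x :: "'a co"
  obtain u where u: "x = abs_co u" by (rule abs_co_cases)
  show "residuum W x = blinfun_apply 0 x"
    using weakly_compact_op_bidual_range[OF assms, of u]
    by (simp add: u residuum_abs_co co.abs_eq_iff zero_co_def)
qed

lemma norm_adjoint_op_le: "norm (adjoint_op A) \<le> norm A"
  by (rule norm_blinfun_bound)
    (simp_all add: adjoint_op.rep_eq mult.commute[of "norm A"] norm_blinfun_compose)

lemma norm_abs_co_le: "norm (abs_co u) \<le> norm u"
  by (simp add: norm_co.abs_eq infdist_subspace_le_norm[OF subspace_range_canonical_embedding])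

lemma norm_co_less_witness:
  assumes "norm (abs_co u) < e"
  obtains y where "norm (u - canonical_embedding y) < e"
  using infdist_less_witness[of u "range canonical_embedding" e] assms
  by (auto simp: norm_co.abs_eq dist_norm)

lemma norm_residuum_le: "norm (residuum A) \<le> norm A"
proof (rule norm_blinfun_bound)
  fix x :: "'a co"
  obtain u where u: "x = abs_co u" by (rule abs_co_cases)
  show "norm (residuum A x) \<le> norm A * norm x"
  proof (rule field_le_mult_one_interval, rule ccontr)
    fix t :: real
    assume t: "0 < t" "t < 1" and not: "\<not> t * norm (residuum A x) \<le> norm A * norm x"
    have *: "norm (residuum A x) \<le> norm A * norm (u - canonical_embedding y)" for y
    proof -
      let ?B = "adjoint_op (adjoint_op A)"
      have "residuum A x = abs_co (?B (u - canonical_embedding y))"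
        unfolding u residuum_abs_co co.abs_eq_iff
        by (simp add: blinfun.diff_right adjoint_adjoint_canonical_embedding)
      also have "norm \<dots> \<le> norm (?B (u - canonical_embedding y))" by (rule norm_abs_co_le)
      also have "\<dots> \<le> norm ?B * norm (u - canonical_embedding y)" by (rule norm_blinfun)
      also have "norm ?B \<le> norm A"
        using norm_adjoint_op_le[of A] norm_adjoint_op_le[of "adjoint_op A"] by simp
      finally show ?thesis by (simp add: mult_right_mono)
    qed
    have pos: "norm (residuum A x) > 0"
      using not t by (smt (verit) mult_nonneg_nonneg norm_ge_zero mult_not_zero)
    have Apos: "norm A > 0" using *[of 0] pos by (smt (verit) mult_not_zero norm_ge_zero)
    have "norm x < norm (residuum A x) / norm A"
    proof -
      have "norm A * norm x < t * norm (residuum A x)" using not by simp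
      also have "\<dots> < norm (residuum A x)" using t pos by simp
      finally show ?thesis using Apos by (simp add: field_simps)
    qed
    then obtain y where "norm (u - canonical_embedding y) < norm (residuum A x) / norm A"
      unfolding u by (rule norm_co_less_witness)
    with *[of y] Apos show False by (simp add: field_simps)
  qed
qed simp

lemma norm_residuum_le_weak_norm: "norm (residuum A) \<le> weak_norm A"
  unfolding weak_norm_def
proof (rule cINF_greatest)
  show "{W :: 'a \<Rightarrow>\<^sub>L 'b. weakly_compact_op W} \<noteq> {}" using weakly_compact_op_0 by blast
  fix W :: "'a \<Rightarrow>\<^sub>L 'b" assume "W \<in> {W. weakly_compact_op W}"
  then show "norm (residuum A) \<le> norm (A - W)"
    using norm_residuum_le[of "A - W"] by (simp add: residuum_diff residuum_weakly_compact)
qed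

section \<open>Embedding the weak Calkin algebra\<close>

lemma norm_abs_weak_calkin: "norm (abs_weak_calkin T) = weak_norm T"
  by (rule norm_weak_calkin.abs_eq)

lemma abs_weak_calkin_repr:
  assumes "e > 0"
  obtains T where "abs_weak_calkin T = x" "norm T < norm x + e"
proof -
  obtain S where S: "x = abs_weak_calkin S" by (induct x rule: weak_calkin.abs_induct) blast
  have "infdist S {W. weakly_compact_op W} < norm x + e"
    using assms by (simp add: S norm_abs_weak_calkin weak_norm_eq_infdist)
  then obtain W where W: "weakly_compact_op W" "dist S W < norm x + e"
    using weakly_compact_op_0 by (blast elim: infdist_less_witness)
  have "weakly_compact_op (- W)" using weakly_compact_op_scaleR[OF W(1), of "-1"] by simp
  then have "abs_weak_calkin (S - W) = x"
    unfolding S weak_calkin.abs_eq_iff by simp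
  with W show ?thesis by (intro that[of "S - W"]) (auto simp: dist_norm)
qed

instance weak_calkin :: (banach) banach
proof
  fix X :: "nat \<Rightarrow> 'a weak_calkin" assume X: "Cauchy X"
  show "convergent X"
  proof (rule convergent_if_abs_summable[OF _ X])
    fix q :: "nat \<Rightarrow> 'a weak_calkin" assume q: "summable (\<lambda>n. norm (q n))"
    have "\<exists>T. abs_weak_calkin T = q n \<and> norm T < norm (q n) + (1/2)^n" for n
      by (rule abs_weak_calkin_repr[of "(1/2)^n" "q n"]) auto
    then obtain T where T: "\<And>n. abs_weak_calkin (T n) = q n" "\<And>n. norm (T n) < norm (q n) + (1/2)^n"
      by metis
    have "summable (\<lambda>n. norm (q n) + (1/2)^n)"
      by (intro summable_add q summable_geometric) simp
    then have "summable (\<lambda>n. norm (T n))"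
      by (rule summable_comparison_test[OF exI, of 0, rotated]) (use T(2) in \<open>auto intro: less_imp_le\<close>)
    then have "(\<lambda>n. \<Sum>i<n. T i) \<longlonglongrightarrow> suminf T"
      by (rule summable_LIMSEQ[OF summable_norm_cancel])
    then have lim: "(\<lambda>n. norm ((\<Sum>i<n. T i) - suminf T)) \<longlonglongrightarrow> 0"
      by (rule tendsto_norm_zero[OF LIM_zero])
    have sum: "(\<Sum>i<n. q i) = abs_weak_calkin (\<Sum>i<n. T i)" for n
      by (induction n)
        (simp_all add: zero_weak_calkin.abs_eq plus_weak_calkin.abs_eq flip: T(1))
    have le: "norm ((\<Sum>i<n. q i) - abs_weak_calkin (suminf T)) \<le> norm ((\<Sum>i<n. T i) - suminf T)" for n
      unfolding sum minus_weak_calkin.abs_eq norm_abs_weak_calkin weak_norm_eq_infdist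
      by (rule infdist_subspace_le_norm[OF subspace_weakly_compact_op])
    have "(\<lambda>n. (\<Sum>i<n. q i) - abs_weak_calkin (suminf T)) \<longlonglongrightarrow> 0"
      by (rule Lim_null_comparison[OF _ lim]) (use le in simp)
    then have "(\<lambda>n. \<Sum>i<n. q i) \<longlonglongrightarrow> abs_weak_calkin (suminf T)"
      by (rule LIM_zero_cancel)
    then show "summable q" by (auto simp: summable_def sums_def)
  qed
qed

lift_definition residuum_calkin :: "'a::banach weak_calkin \<Rightarrow> 'a co \<Rightarrow>\<^sub>L 'a co" is residuum
proof -
  fix S T :: "'a \<Rightarrow>\<^sub>L 'a" assume "S - T \<in> {W. weakly_compact_op W}"
  then show "residuum S = residuum T"
    using residuum_diff[of S T] by (simp add: residuum_weakly_compact)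
qed

lemma bounded_linear_residuum_calkin: "bounded_linear residuum_calkin"
proof (rule bounded_linear_intro[of _ 1])
  show "residuum_calkin (x + y) = residuum_calkin x + residuum_calkin y" for x y :: "'a weak_calkin"
    by (induct x rule: weak_calkin.abs_induct, induct y rule: weak_calkin.abs_induct)
      (simp add: plus_weak_calkin.abs_eq residuum_calkin.abs_eq residuum_add)
  show "residuum_calkin (c *\<^sub>R x) = c *\<^sub>R residuum_calkin x" for c and x :: "'a weak_calkin"
    by (induct x rule: weak_calkin.abs_induct)
      (simp add: scaleR_weak_calkin.abs_eq residuum_calkin.abs_eq residuum_scaleR)
  show "norm (residuum_calkin x) \<le> norm x * 1" for x :: "'a weak_calkin"
    by (induct x rule: weak_calkin.abs_induct)
      (simp add: residuum_calkin.abs_eq norm_abs_weak_calkin norm_residuum_le_weak_norm)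
qed

text \<open>The bound says that the induced map on the weak Calkin algebra is bounded below; as the
algebra is complete, its image is complete.\<close>

lemma residuum_calkin_embedding:
  fixes C :: real
  assumes C: "C > 0"
    and bound: "\<And>T :: 'a::banach \<Rightarrow>\<^sub>L 'a. weak_norm T \<le> C * norm (residuum T)"
  shows "inj (residuum_calkin :: 'a weak_calkin \<Rightarrow> _)"
    and "closed (range (residuum_calkin :: 'a weak_calkin \<Rightarrow> _))"
    and "S \<in> range (residuum_calkin :: 'a weak_calkin \<Rightarrow> _) \<Longrightarrow>
          norm (inv residuum_calkin S) \<le> C * norm S"
proof -
  have le: "norm x \<le> C * norm (residuum_calkin x)" for x :: "'a weak_calkin"
    by (induct x rule: weak_calkin.abs_induct)
      (simp add: residuum_calkin.abs_eq norm_abs_weak_calkin bound)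
  show inj: "inj (residuum_calkin :: 'a weak_calkin \<Rightarrow> _)"
  proof (rule injI)
    fix x y :: "'a weak_calkin" assume "residuum_calkin x = residuum_calkin y"
    then have "norm (x - y) \<le> 0" using le[of "x - y"] linear_diff[OF bounded_linear.linear[OF bounded_linear_residuum_calkin], of x y]
      by simp
    then show "x = y" by simp
  qed
  show "closed (range (residuum_calkin :: 'a weak_calkin \<Rightarrow> _))"
  proof (rule complete_imp_closed, rule complete_isometric_image[of "1/C"])
    show "\<forall>x\<in>UNIV. 1 / C * norm x \<le> norm (residuum_calkin (x :: 'a weak_calkin))"
      using C le by (simp add: field_simps)
  qed (use C in \<open>simp_all add: bounded_linear_residuum_calkin complete_UNIV\<close>)
  assume "S \<in> range (residuum_calkin :: 'a weak_calkin \<Rightarrow> _)"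
  then obtain x where "S = residuum_calkin x" by blast
  then show "norm (inv residuum_calkin S) \<le> C * norm S"
    using inj le by simp
qed

lemma residuum_calkin_mult: "residuum_calkin (a * b) = residuum_calkin a o\<^sub>L residuum_calkin b"
  by (induct a rule: weak_calkin.abs_induct, induct b rule: weak_calkin.abs_induct)
    (simp add: times_weak_calkin.abs_eq residuum_calkin.abs_eq residuum_compose)

lemma residuum_calkin_1: "residuum_calkin 1 = id_blinfun"
  by (simp add: one_weak_calkin_def residuum_calkin.abs_eq residuum_id)


section \<open>Limits along a filter on which every bounded sequence converges\<close>

text \<open>Regard a sequence index \<open>n\<close> as the point \<open>(x \<mapsto> x n)\<close> of a product of compact intervals, indexed by
all bounded sequences \<open>x\<close>. These points have a cluster point by Tychonoff's theorem. One filter that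
serves all bounded sequences makes the limits below linear.\<close>

lemma exists_bounded_limit_filter:
  "\<exists>F. F \<le> sequentially \<and> F \<noteq> bot \<and> (\<forall>x :: nat \<Rightarrow> real. Bseq x \<longrightarrow> (\<exists>l. (x \<longlongrightarrow> l) F))"
proof -
  define c where "c x = (if Bseq x then SOME K. \<forall>n. \<bar>x n\<bar> \<le> K else 0)" for x :: "nat \<Rightarrow> real"
  define s where "s n x = (if Bseq x then x n else 0)" for n and x :: "nat \<Rightarrow> real"
  have "\<exists>K. \<forall>n. \<bar>x n\<bar> \<le> K" if "Bseq x" for x :: "nat \<Rightarrow> real"
    using that unfolding Bseq_def by auto
  then have c: "\<bar>x n\<bar> \<le> c x" if "Bseq x" for x n
    using that someI_ex[of "\<lambda>K. \<forall>n. \<bar>x n\<bar> \<le> K"] by (simp add: c_def)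
  have "s n \<in> {f. \<forall>x. \<bar>f x\<bar> \<le> c x}" for n
    using c by (auto simp: s_def c_def)
  then have "eventually (\<lambda>f. f \<in> {f. \<forall>x. \<bar>f x\<bar> \<le> c x}) (filtermap s sequentially)"
    by (simp add: eventually_filtermap)
  moreover have "filtermap s sequentially \<noteq> bot" by (simp add: filtermap_bot_iff)
  ultimately obtain l where l: "inf (nhds l) (filtermap s sequentially) \<noteq> bot"
    using compact_fun_bounded[of c] unfolding compact_filter by blast
  define F where "F = inf sequentially (filtercomap s (nhds l))"
  have "F \<noteq> bot"
  proof
    assume "F = bot"
    then have "eventually (\<lambda>_. False) F" by simp
    then obtain P Q where P: "eventually P sequentially" and Q: "eventually Q (filtercomap s (nhds l))"
      and PQ: "\<And>n. P n \<Longrightarrow> Q n \<Longrightarrow> False"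
      unfolding F_def eventually_inf by blast
    obtain U where U: "eventually U (nhds l)" "\<And>n. U (s n) \<Longrightarrow> Q n"
      using Q unfolding eventually_filtercomap by blast
    have "eventually (\<lambda>f. \<not> U f) (filtermap s sequentially)"
      unfolding eventually_filtermap using P by eventually_elim (use PQ U(2) in blast)
    with U(1) have "eventually (\<lambda>_. False) (inf (nhds l) (filtermap s sequentially))"
      unfolding eventually_inf by blast
    with l show False by (simp add: trivial_limit_def)
  qed
  moreover have "F \<le> sequentially" by (simp add: F_def)
  moreover have "\<exists>l. (x \<longlongrightarrow> l) F" if "Bseq x" for x :: "nat \<Rightarrow> real"
  proof -
    have "filterlim s (nhds l) (filtercomap s (nhds l))" by (rule filterlim_filtercomap)
    then have "(s \<longlongrightarrow> l) F" by (rule tendsto_mono[rotated]) (simp add: F_def)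
    then have "((\<lambda>n. s n x) \<longlongrightarrow> l x) F"
      by (rule continuous_on_tendsto_compose[OF continuous_on_fun_apply[of UNIV x]]) auto
    with that show ?thesis by (auto simp: s_def)
  qed
  ultimately show ?thesis by blast
qed

definition limit_filter :: "nat filter" where
  "limit_filter = (SOME F. F \<le> sequentially \<and> F \<noteq> bot \<and>
    (\<forall>x :: nat \<Rightarrow> real. Bseq x \<longrightarrow> (\<exists>l. (x \<longlongrightarrow> l) F)))"

lemma limit_filter:
  shows limit_filter_le: "limit_filter \<le> sequentially"
    and limit_filter_neq_bot: "limit_filter \<noteq> bot"
    and Bseq_limit_filter: "Bseq x \<Longrightarrow> \<exists>l :: real. (x \<longlongrightarrow> l) limit_filter"
  using someI_ex[OF exists_bounded_limit_filter] unfolding limit_filter_def by blast+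

lemmas tendsto_limit_filter = tendsto_mono[OF limit_filter_le]

lemma eventually_limit_filter: "eventually P sequentially \<Longrightarrow> eventually P limit_filter"
  by (rule filter_leD[OF limit_filter_le])

lemma limit_filter_unique:
  fixes a b :: real
  shows "(x \<longlongrightarrow> a) limit_filter \<Longrightarrow> (x \<longlongrightarrow> b) limit_filter \<Longrightarrow> a = b"
  by (rule tendsto_unique[OF limit_filter_neq_bot])

lemma limit_filter_le_bound:
  fixes a :: real
  assumes "(x \<longlongrightarrow> a) limit_filter" "\<And>n. n \<ge> N \<Longrightarrow> x n \<le> C"
  shows "a \<le> C"
  by (rule tendsto_upperbound[OF assms(1) eventually_limit_filter limit_filter_neq_bot])
    (use assms(2) in \<open>auto simp: eventually_sequentially\<close>)

text \<open>Weak convergence along the fixed filter; every sequence in a weakly compact set converges in this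
sense, without passing to subsequences.\<close>

definition weak_lim :: "(nat \<Rightarrow> 'a::real_normed_vector) \<Rightarrow> 'a \<Rightarrow> bool" where
  "weak_lim x l \<longleftrightarrow> (\<forall>\<phi> :: 'a dual. ((\<lambda>n. blinfun_apply \<phi> (x n)) \<longlongrightarrow> \<phi> l) limit_filter)"

lemma weak_limD:
  fixes \<phi> :: "'a::real_normed_vector dual"
  shows "weak_lim x l \<Longrightarrow> ((\<lambda>n. blinfun_apply \<phi> (x n)) \<longlongrightarrow> \<phi> l) limit_filter"
  by (simp add: weak_lim_def)

lemma weak_lim_add: "weak_lim x a \<Longrightarrow> weak_lim y b \<Longrightarrow> weak_lim (\<lambda>n. x n + y n) (a + b)"
  by (simp add: weak_lim_def blinfun.add_right tendsto_add)

lemma weak_lim_diff: "weak_lim x a \<Longrightarrow> weak_lim y b \<Longrightarrow> weak_lim (\<lambda>n. x n - y n) (a - b)"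
  by (simp add: weak_lim_def blinfun.diff_right tendsto_diff)

lemma weak_lim_scaleR: "weak_lim x a \<Longrightarrow> weak_lim (\<lambda>n. c *\<^sub>R x n) (c *\<^sub>R a)"
  by (simp add: weak_lim_def blinfun.scaleR_right tendsto_mult_left)

lemma weak_lim_blinfun:
  fixes A :: "'a::real_normed_vector \<Rightarrow>\<^sub>L 'b::real_normed_vector"
  assumes "weak_lim x a"
  shows "weak_lim (\<lambda>n. A (x n)) (A a)"
  unfolding weak_lim_def
proof
  fix \<phi> :: "'b dual"
  show "((\<lambda>n. \<phi> (A (x n))) \<longlongrightarrow> \<phi> (A a)) limit_filter"
    using weak_limD[OF assms, of "\<phi> o\<^sub>L A"] by simp
qed

lemma weak_lim_tendsto: "x \<longlonglongrightarrow> l \<Longrightarrow> weak_lim x l"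
  unfolding weak_lim_def
  by (intro allI tendsto_limit_filter) (rule blinfun.tendsto[OF tendsto_const])

lemma weak_lim_norm_le:
  assumes x: "weak_lim x l" and C: "\<And>n. n \<ge> N \<Longrightarrow> norm (x n) \<le> C"
  shows "norm l \<le> C"
proof -
  obtain \<phi> :: "'a dual" where \<phi>: "norm \<phi> \<le> 1" "blinfun_apply \<phi> l = norm l"
    by (rule norming_functional)
  have "\<phi> (x n) \<le> C" if "n \<ge> N" for n
    using norm_blinfun[of \<phi> "x n"] mult_right_mono[OF \<phi>(1) norm_ge_zero[of "x n"]] C[OF that] by simp
  then have "\<phi> l \<le> C" by (rule limit_filter_le_bound[OF weak_limD[OF x]])
  then show ?thesis using \<phi>(2) by simp
qed

lemma weak_lim_unique:
  assumes "weak_lim x a" "weak_lim x b"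
  shows "a = b"
proof -
  have "norm (a - b) \<le> 0" by (rule weak_lim_norm_le[OF weak_lim_diff[OF assms]]) simp
  then show ?thesis by simp
qed

section \<open>The dual of \<open>L\<^sup>1(\<Delta>)\<close> and weak compactness of bounded sets of functions\<close>

interpretation Delta: prob_space Delta_prob
  by (rule prob_space_Delta_prob)

lemma add_abs_L1_Delta:
  "integrable Delta_prob f \<Longrightarrow> integrable Delta_prob g \<Longrightarrow>
    abs_L1_Delta f + abs_L1_Delta g = abs_L1_Delta (\<lambda>x. f x + g x)"
  by (rule plus_L1_Delta.abs_eq) (simp_all add: L1_rel_def)

lemma scaleR_abs_L1_Delta:
  "integrable Delta_prob f \<Longrightarrow> c *\<^sub>R abs_L1_Delta f = abs_L1_Delta (\<lambda>x. c * f x)"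
  by (rule scaleR_L1_Delta.abs_eq) (simp add: L1_rel_def)

lemma abs_L1_Delta_cong_AE:
  assumes "integrable Delta_prob f" "g \<in> borel_measurable Delta_prob" "AE x in Delta_prob. f x = g x"
  shows "abs_L1_Delta f = abs_L1_Delta g"
proof -
  have g: "integrable Delta_prob g"
    by (rule integrable_cong_AE_imp[OF assms(1,2)]) (use assms(3) in \<open>auto elim: eventually_mono\<close>)
  have "norm (abs_L1_Delta f - abs_L1_Delta g) = (\<integral>x. \<bar>f x - g x\<bar> \<partial>Delta_prob)"
    using assms g by (simp add: diff_abs_L1_Delta norm_abs_L1_Delta)
  also have "\<dots> = (\<integral>x. 0 \<partial>Delta_prob)"
    using assms g by (intro integral_cong_AE) auto
  finally show ?thesis by simp
qed

lemma tendsto_abs_L1_Delta: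
  assumes s: "\<And>i. integrable Delta_prob (s i)" and f: "integrable Delta_prob f"
    and w: "integrable Delta_prob w" and lim: "AE x in Delta_prob. (\<lambda>i. s i x) \<longlonglongrightarrow> f x"
    and dom: "\<And>i. AE x in Delta_prob. \<bar>s i x\<bar> \<le> w x"
  shows "(\<lambda>i. abs_L1_Delta (s i)) \<longlonglongrightarrow> abs_L1_Delta f"
proof -
  have [measurable]: "s i \<in> borel_measurable Delta_prob" "f \<in> borel_measurable Delta_prob" for i
    using s f by auto
  have "(\<lambda>i. \<integral>x. \<bar>s i x - f x\<bar> \<partial>Delta_prob) \<longlonglongrightarrow> (\<integral>x. 0 \<partial>Delta_prob)"
  proof (rule integral_dominated_convergence)
    show "integrable Delta_prob (\<lambda>x. w x + \<bar>f x\<bar>)" using w f by simp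
    show "AE x in Delta_prob. (\<lambda>i. \<bar>s i x - f x\<bar>) \<longlonglongrightarrow> 0"
      using lim by eventually_elim (rule tendsto_rabs_zero[OF LIM_zero])
    show "AE x in Delta_prob. norm \<bar>s i x - f x\<bar> \<le> w x + \<bar>f x\<bar>" for i
      using dom[of i] by eventually_elim auto
  qed measurable
  then have "(\<lambda>i. norm (abs_L1_Delta (s i) - abs_L1_Delta f)) \<longlonglongrightarrow> 0"
    using s f by (simp add: diff_abs_L1_Delta norm_abs_L1_Delta)
  then show ?thesis by (rule LIM_zero_cancel[OF tendsto_norm_zero_cancel])
qed

definition ind_L1 :: "(nat \<Rightarrow> real) set \<Rightarrow> L1_Delta" where
  "ind_L1 A = abs_L1_Delta (indicator A)"

lemma integrable_indicator_Delta [simp]: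
  "A \<in> sets Delta_prob \<Longrightarrow> integrable Delta_prob (indicator A :: _ \<Rightarrow> real)"
  by (simp add: Delta.emeasure_finite less_top[symmetric])

lemma norm_ind_L1: "A \<in> sets Delta_prob \<Longrightarrow> norm (ind_L1 A) = measure Delta_prob A"
  by (simp add: ind_L1_def norm_abs_L1_Delta)

text \<open>Density of the simple functions, in the form in which it is used.\<close>

lemma L1_Delta_in_closed_subspace:
  assumes C: "subspace C" "closed C" and ind: "\<And>A. A \<in> sets Delta_prob \<Longrightarrow> ind_L1 A \<in> C"
  shows "f \<in> C"
proof -
  obtain g where g: "integrable Delta_prob g" "f = abs_L1_Delta g" by (rule L1_Delta_repr)
  from g(1) have "abs_L1_Delta g \<in> C"
  proof (induct rule: integrable_induct)
    case (base A c)
    have "c *\<^sub>R ind_L1 A \<in> C" using C(1) ind[OF base(1)] by (rule subspace_scale)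
    then show ?case using base by (simp add: ind_L1_def scaleR_abs_L1_Delta mult.commute)
  next
    case (add f g)
    have "abs_L1_Delta f + abs_L1_Delta g \<in> C" by (rule subspace_add[OF C(1) add(2,4)])
    then show ?case by (simp only: add_abs_L1_Delta[OF add(1,3)])
  next
    case (lim f s)
    have "(\<lambda>i. abs_L1_Delta (s i)) \<longlonglongrightarrow> abs_L1_Delta f"
    proof (rule tendsto_abs_L1_Delta[where w="\<lambda>x. 2 * \<bar>f x\<bar>"])
      show "AE x in Delta_prob. (\<lambda>i. s i x) \<longlonglongrightarrow> f x" using lim(3) by (rule AE_I2)
      show "AE x in Delta_prob. \<bar>s i x\<bar> \<le> 2 * \<bar>f x\<bar>" for i
        using lim(4)[of _ i] by (intro AE_I2) simp
    qed (use lim(1,5) in simp_all)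
    then show ?case by (rule closed_sequentially[OF C(2) lim(2)])
  qed
  with g show ?thesis by simp
qed

lemma blinfun_eq_on_ind_L1:
  fixes A B :: "L1_Delta \<Rightarrow>\<^sub>L 'b::real_normed_vector"
  assumes "\<And>E. E \<in> sets Delta_prob \<Longrightarrow> A (ind_L1 E) = B (ind_L1 E)"
  shows "A = B"
proof (rule blinfun_eqI)
  fix f
  have "f \<in> {f. A f = B f}"
  proof (rule L1_Delta_in_closed_subspace)
    show "subspace {f. A f = B f}"
      by (rule subspaceI) (auto simp: blinfun.add_right blinfun.scaleR_right)
    show "closed {f. A f = B f}"
      by (intro closed_Collect_eq linear_continuous_on blinfun.bounded_linear_right)
  qed (use assms in simp)
  then show "A f = B f" by simp
qed

definition Linf :: "real \<Rightarrow> ((nat \<Rightarrow> real) \<Rightarrow> real) \<Rightarrow> bool" where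
  "Linf M g \<longleftrightarrow> g \<in> borel_measurable Delta_prob \<and> (\<forall>x\<in>space Delta_prob. \<bar>g x\<bar> \<le> M)"

lemma LinfD:
  assumes "Linf M g"
  shows "g \<in> borel_measurable Delta_prob" "x \<in> space Delta_prob \<Longrightarrow> \<bar>g x\<bar> \<le> M"
  using assms by (auto simp: Linf_def)

lemma Linf_mono: "Linf M g \<Longrightarrow> M \<le> N \<Longrightarrow> Linf N g"
  unfolding Linf_def by (meson order_trans)

lemma Linf_nonneg:
  assumes "Linf M g"
  shows "0 \<le> M"
proof -
  obtain x where "x \<in> space Delta_prob" using Delta.not_empty by blast
  then have "\<bar>g x\<bar> \<le> M" by (rule LinfD(2)[OF assms])
  then show ?thesis by simp
qed

lemma Linf_integrable: "Linf M g \<Longrightarrow> integrable Delta_prob g"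
  by (rule Delta.integrable_const_bound[of _ M]) (auto simp: Linf_def intro!: AE_I2)

lemma Linf_integrable_mult:
  assumes g: "Linf M g" and f: "integrable Delta_prob f"
  shows "integrable Delta_prob (\<lambda>x. f x * g x)"
proof (rule Bochner_Integration.integrable_bound)
  show "integrable Delta_prob (\<lambda>x. f x * M)" using f by simp
  show "AE x in Delta_prob. norm (f x * g x) \<le> norm (f x * M)"
  proof (rule AE_I2)
    fix x assume "x \<in> space Delta_prob"
    then have "\<bar>g x\<bar> \<le> \<bar>M\<bar>" using LinfD(2)[OF g, of x] by linarith
    then show "norm (f x * g x) \<le> norm (f x * M)" by (simp add: abs_mult mult_left_mono)
  qed
qed (use LinfD(1)[OF g] f in auto)

lemma Linf_indicator: "A \<in> sets Delta_prob \<Longrightarrow> Linf 1 (indicator A)"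
  by (auto simp: Linf_def indicator_def)

definition pairing :: "((nat \<Rightarrow> real) \<Rightarrow> real) \<Rightarrow> L1_Delta dual" where
  "pairing g = Blinfun (\<lambda>f. \<integral>x. rep_L1_Delta f x * g x \<partial>Delta_prob)"

lemma rep_L1_Delta:
  shows integrable_rep_L1_Delta: "integrable Delta_prob (rep_L1_Delta f)"
    and abs_rep_L1_Delta: "abs_L1_Delta (rep_L1_Delta f) = f"
    and AE_rep_abs_L1_Delta:
      "integrable Delta_prob g \<Longrightarrow> AE x in Delta_prob. rep_L1_Delta (abs_L1_Delta g) x = g x"
proof -
  have "L1_rel (rep_L1_Delta f) (rep_L1_Delta f)"
    by (rule Quotient3_rep_reflp[OF Quotient3_L1_Delta])
  then show "integrable Delta_prob (rep_L1_Delta f)" by (simp add: L1_rel_def)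
  show "abs_L1_Delta (rep_L1_Delta f) = f" by (rule Quotient3_abs_rep[OF Quotient3_L1_Delta])
  assume "integrable Delta_prob g"
  then have "L1_rel g g" by (simp add: L1_rel_def)
  then have "L1_rel (rep_L1_Delta (abs_L1_Delta g)) g"
    by (rule rep_abs_rsp_left[OF Quotient3_L1_Delta])
  then show "AE x in Delta_prob. rep_L1_Delta (abs_L1_Delta g) x = g x" by (simp add: L1_rel_def)
qed

lemma norm_rep_L1_Delta: "norm f = (\<integral>x. \<bar>rep_L1_Delta f x\<bar> \<partial>Delta_prob)"
  using norm_abs_L1_Delta[OF integrable_rep_L1_Delta, of f] by (simp add: abs_rep_L1_Delta)

lemma abs_integral_mult_Linf_le:
  assumes g: "Linf M g" and f: "integrable Delta_prob f"
  shows "\<bar>\<integral>x. f x * g x \<partial>Delta_prob\<bar> \<le> M * (\<integral>x. \<bar>f x\<bar> \<partial>Delta_prob)"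
proof -
  have "\<bar>\<integral>x. f x * g x \<partial>Delta_prob\<bar> \<le> (\<integral>x. \<bar>f x * g x\<bar> \<partial>Delta_prob)" by (rule integral_abs_bound)
  also have "\<dots> \<le> (\<integral>x. \<bar>f x\<bar> * M \<partial>Delta_prob)"
  proof (rule integral_mono)
    show "integrable Delta_prob (\<lambda>x. \<bar>f x * g x\<bar>)"
      using Linf_integrable_mult[OF g f] by (rule integrable_abs)
    show "integrable Delta_prob (\<lambda>x. \<bar>f x\<bar> * M)" using f by simp
    fix x assume "x \<in> space Delta_prob"
    then show "\<bar>f x * g x\<bar> \<le> \<bar>f x\<bar> * M"
      using LinfD(2)[OF g, of x] by (simp add: abs_mult mult_left_mono)
  qed
  finally show ?thesis by (simp add: mult.commute)
qed

lemma pairing_abs: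
  assumes g: "Linf M g" and f: "integrable Delta_prob f"
  shows "pairing g (abs_L1_Delta f) = (\<integral>x. f x * g x \<partial>Delta_prob)"
    and "norm (pairing g) \<le> M"
proof -
  have [measurable]: "g \<in> borel_measurable Delta_prob" "rep_L1_Delta u \<in> borel_measurable Delta_prob" for u
    using LinfD(1)[OF g] integrable_rep_L1_Delta[of u] by auto
  define I where "I = (\<lambda>u. \<integral>x. rep_L1_Delta u x * g x \<partial>Delta_prob)"
  have I: "I (abs_L1_Delta h) = (\<integral>x. h x * g x \<partial>Delta_prob)" if h: "integrable Delta_prob h" for h
  proof -
    have [measurable]: "h \<in> borel_measurable Delta_prob" using h by auto
    show ?thesis unfolding I_def
      by (rule integral_cong_AE, measurable) (use AE_rep_abs_L1_Delta[OF h] in \<open>eventually_elim, simp\<close>)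
  qed
  have bd: "norm (I u) \<le> M * norm u" for u
    unfolding I_def norm_rep_L1_Delta using abs_integral_mult_Linf_le[OF g integrable_rep_L1_Delta, of u] by simp
  have "bounded_linear I"
  proof (rule bounded_linear_intro[of _ M])
    fix u v :: L1_Delta and c :: real
    obtain a where a: "integrable Delta_prob a" "u = abs_L1_Delta a" by (rule L1_Delta_repr)
    obtain b where b: "integrable Delta_prob b" "v = abs_L1_Delta b" by (rule L1_Delta_repr)
    show "I (u + v) = I u + I v"
      using a b Linf_integrable_mult[OF g] by (simp add: add_abs_L1_Delta I distrib_right)
    show "I (c *\<^sub>R u) = c *\<^sub>R I u"
      using a by (simp add: scaleR_abs_L1_Delta I mult.assoc)
    show "norm (I u) \<le> norm u * M" using bd[of u] by (simp add: mult.commute)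
  qed
  then have p: "blinfun_apply (pairing g) = I"
    unfolding pairing_def I_def[symmetric] by (rule bounded_linear_Blinfun_apply)
  show "pairing g (abs_L1_Delta f) = (\<integral>x. f x * g x \<partial>Delta_prob)"
    unfolding p by (rule I[OF f])
  show "norm (pairing g) \<le> M"
    by (rule norm_blinfun_bound[OF Linf_nonneg[OF g]]) (simp add: p bd del: real_norm_def)
qed

text \<open>The function \<open>l + M \<P>\<close> on measurable sets is nonnegative and at most \<open>2 M \<P>\<close>. Hence it is continuous at
the empty set, so it is a measure, and the Radon--Nikodym theorem applies.\<close>

lemma dominated_additive_density:
  fixes l :: "(nat \<Rightarrow> real) set \<Rightarrow> real"
  assumes add: "\<And>A B. A \<in> sets Delta_prob \<Longrightarrow> B \<in> sets Delta_prob \<Longrightarrow> A \<inter> B = {} \<Longrightarrow> l (A \<union> B) = l A + l B"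
    and dom: "\<And>A. A \<in> sets Delta_prob \<Longrightarrow> \<bar>l A\<bar> \<le> M * measure Delta_prob A"
  obtains h where "Linf M h" "\<And>A. A \<in> sets Delta_prob \<Longrightarrow> l A = (\<integral>x. indicator A x * h x \<partial>Delta_prob)"
proof -
  have M0: "0 \<le> M" using dom[OF sets.top] by (simp add: Delta.prob_space)
  define m where "m A = l A + M * measure Delta_prob A" for A
  have m: "0 \<le> m A" "m A \<le> 2 * M * measure Delta_prob A" if "A \<in> sets Delta_prob" for A
    using dom[OF that] by (auto simp: m_def)
  have m0: "m {} = 0" using m[of "{}"] by simp
  define N where "N = measure_of (space Delta_prob) (sets Delta_prob) (\<lambda>A. ennreal (m A))"
  have ca: "countably_additive (sets Delta_prob) (\<lambda>A. ennreal (m A))"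
  proof (rule sets.empty_continuous_imp_countably_additive)
    show "positive (sets Delta_prob) (\<lambda>A. ennreal (m A))"
      by (simp add: positive_def m0)
    show "additive (sets Delta_prob) (\<lambda>A. ennreal (m A))"
      unfolding additive_def
    proof (intro ballI impI)
      fix A B assume AB: "A \<in> sets Delta_prob" "B \<in> sets Delta_prob" "A \<inter> B = {}"
      then have "m (A \<union> B) = m A + m B"
        by (simp add: m_def add Delta.finite_measure_Union algebra_simps)
      then show "ennreal (m (A \<union> B)) = ennreal (m A) + ennreal (m B)"
        using m AB by (simp add: ennreal_plus)
    qed
    show "\<forall>A\<in>sets Delta_prob. ennreal (m A) \<noteq> \<infinity>" by simp
    fix A :: "nat \<Rightarrow> (nat \<Rightarrow> real) set"
    assume A: "range A \<subseteq> sets Delta_prob" "decseq A" "(\<Inter>i. A i) = {}"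
    have "(\<lambda>i. measure Delta_prob (A i)) \<longlonglongrightarrow> measure Delta_prob (\<Inter>i. A i)"
      by (rule Delta.finite_Lim_measure_decseq[OF A(1,2)])
    then have "(\<lambda>i. 2 * M * measure Delta_prob (A i)) \<longlonglongrightarrow> 0"
      using A(3) tendsto_mult_right_zero by auto
    then have "(\<lambda>i. m (A i)) \<longlonglongrightarrow> 0"
      by (rule Lim_null_comparison[rotated]) (use m A(1) in \<open>auto simp: range_subsetD\<close>)
    then show "(\<lambda>i. ennreal (m (A i))) \<longlonglongrightarrow> 0"
      using tendsto_ennrealI by fastforce
  qed
  have N: "space N = space Delta_prob" "sets N = sets Delta_prob"
    by (simp_all add: N_def)
  have eN: "emeasure N A = ennreal (m A)" if "A \<in> sets Delta_prob" for A
    unfolding N_def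
    by (rule emeasure_measure_of_sigma[OF _ _ ca that])
      (simp_all add: positive_def m0 sets.sigma_algebra_axioms)
  have "absolutely_continuous Delta_prob N"
    unfolding absolutely_continuous_def
  proof
    fix A assume "A \<in> null_sets Delta_prob"
    then have A: "A \<in> sets Delta_prob" "measure Delta_prob A = 0"
      by (auto simp: measure_def null_setsD1)
    then have "m A = 0" using m[OF A(1)] by simp
    then show "A \<in> null_sets N" using A by (simp add: null_sets_def N eN)
  qed
  then obtain f where f[measurable]: "f \<in> borel_measurable Delta_prob" and fN: "density Delta_prob f = N"
    using Delta.Radon_Nikodym[of N] N by auto
  have fA: "(\<integral>\<^sup>+x. f x * indicator A x \<partial>Delta_prob) = ennreal (m A)" if "A \<in> sets Delta_prob" for A
    using eN[OF that] that by (simp add: emeasure_density flip: fN)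
  have "(\<integral>\<^sup>+x. f x \<partial>Delta_prob) = (\<integral>\<^sup>+x. f x * indicator (space Delta_prob) x \<partial>Delta_prob)"
    by (rule nn_integral_cong) simp
  then have "(\<integral>\<^sup>+x. f x \<partial>Delta_prob) \<noteq> \<infinity>" using fA[OF sets.top] by simp
  then have fin: "AE x in Delta_prob. f x \<noteq> \<infinity>" by (intro nn_integral_PInf_AE) auto
  define g where "g x = enn2real (f x)" for x
  have [measurable]: "g \<in> borel_measurable Delta_prob" unfolding g_def by measurable
  have hb: "has_bochner_integral Delta_prob (\<lambda>x. indicator A x * g x) (m A)" if A: "A \<in> sets Delta_prob" for A
  proof (rule has_bochner_integral_nn_integral)
    show "(\<integral>\<^sup>+x. ennreal (indicator A x * g x) \<partial>Delta_prob) = ennreal (m A)"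
      unfolding fA[OF A, symmetric]
    proof (rule nn_integral_cong_AE)
      show "AE x in Delta_prob. ennreal (indicator A x * g x) = f x * indicator A x"
        using fin by eventually_elim (auto simp: g_def indicator_def less_top)
    qed
  qed (use A m in \<open>auto simp: g_def\<close>)
  have ig: "integrable Delta_prob g"
  proof (rule Bochner_Integration.integrable_cong[THEN iffD1])
    show "integrable Delta_prob (\<lambda>x. indicator (space Delta_prob) x * g x)"
      using hb[OF sets.top] by (simp add: has_bochner_integral_iff)
  qed auto
  define A where "A = {x \<in> space Delta_prob. 2 * M < g x}"
  have [measurable]: "A \<in> sets Delta_prob" by (simp add: A_def)
  have "(\<integral>x. indicator A x * (g x - 2 * M) \<partial>Delta_prob) = m A - 2 * M * measure Delta_prob A"
    using hb[of A] by (simp add: right_diff_distrib has_bochner_integral_iff mult.commute)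
  also have "\<dots> \<le> 0" using m(2)[of A] by simp
  finally have le0: "(\<integral>x. indicator A x * (g x - 2 * M) \<partial>Delta_prob) \<le> 0" .
  have nn: "0 \<le> indicator A x * (g x - 2 * M)" for x
    by (auto simp: A_def indicator_def)
  have "integrable Delta_prob (\<lambda>x. indicator A x * (g x - 2 * M))"
    using hb[of A] by (simp add: right_diff_distrib has_bochner_integral_iff)
  moreover have "(\<integral>x. indicator A x * (g x - 2 * M) \<partial>Delta_prob) = 0"
    using le0 nn by (intro antisym integral_nonneg_AE AE_I2) auto
  ultimately have "AE x in Delta_prob. indicator A x * (g x - 2 * M) = 0"
    using nn by (subst integral_nonneg_eq_0_iff_AE[symmetric]) auto
  then have gM: "AE x in Delta_prob. g x \<le> 2 * M"
    using AE_space by eventually_elim (auto simp: A_def indicator_def split: if_splits)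
  define h where "h x = max (- M) (min M (g x - M))" for x
  show ?thesis
  proof (rule that[of h])
    show "Linf M h" using M0 unfolding Linf_def h_def by auto
    fix B assume B[measurable]: "B \<in> sets Delta_prob"
    have "(\<integral>x. indicator B x * h x \<partial>Delta_prob) = (\<integral>x. indicator B x * g x - M * indicator B x \<partial>Delta_prob)"
    proof (rule integral_cong_AE)
      show "AE x in Delta_prob. indicator B x * h x = indicator B x * g x - M * indicator B x"
        using gM by eventually_elim (use M0 in \<open>auto simp: h_def g_def indicator_def\<close>)
    qed (auto simp: h_def)
    also have "\<dots> = m B - M * measure Delta_prob B"
      using hb[OF B] by (simp add: has_bochner_integral_iff)
    finally show "l B = (\<integral>x. indicator B x * h x \<partial>Delta_prob)" by (simp add: m_def)
  qed
qed

text \<open>The representing function is the density of the set function \<open>A \<mapsto> \<phi> (ind_L1 A)\<close>, which is dominated by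
\<open>norm \<phi>\<close> times the measure.\<close>

lemma L1_Delta_dual_repr:
  obtains g where "Linf (norm \<phi>) g" "\<phi> = pairing g"
proof -
  have add: "\<phi> (ind_L1 (A \<union> B)) = \<phi> (ind_L1 A) + \<phi> (ind_L1 B)"
    if "A \<in> sets Delta_prob" "B \<in> sets Delta_prob" "A \<inter> B = {}" for A B
  proof -
    have "ind_L1 (A \<union> B) = ind_L1 A + ind_L1 B"
      using that unfolding ind_L1_def
      by (subst add_abs_L1_Delta)
        (auto intro!: arg_cong[of _ _ abs_L1_Delta] simp: indicator_def fun_eq_iff)
    then show ?thesis by (simp add: blinfun.add_right)
  qed
  have dom: "\<bar>\<phi> (ind_L1 A)\<bar> \<le> norm \<phi> * measure Delta_prob A" if "A \<in> sets Delta_prob" for A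
    using norm_blinfun[of \<phi> "ind_L1 A"] that by (simp add: norm_ind_L1)
  obtain g where g: "Linf (norm \<phi>) g"
    "\<And>A. A \<in> sets Delta_prob \<Longrightarrow> \<phi> (ind_L1 A) = (\<integral>x. indicator A x * g x \<partial>Delta_prob)"
    by (rule dominated_additive_density[of "\<lambda>A. \<phi> (ind_L1 A)" "norm \<phi>"]) (rule add dom that | assumption)+
  have "\<phi> = pairing g"
  proof (rule blinfun_eq_on_ind_L1)
    fix E assume E: "E \<in> sets Delta_prob"
    show "\<phi> (ind_L1 E) = pairing g (ind_L1 E)"
      unfolding g(2)[OF E] unfolding ind_L1_def using pairing_abs(1)[OF g(1)] E by simp
  qed
  with g(1) show ?thesis by (rule that)
qed

definition Linf_ball :: "real \<Rightarrow> L1_Delta set" where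
  "Linf_ball M = abs_L1_Delta ` {h. Linf M h}"

lemma norm_Linf_ball:
  assumes "h \<in> Linf_ball M"
  shows "norm h \<le> M"
proof -
  obtain g where g: "Linf M g" "h = abs_L1_Delta g" using assms by (auto simp: Linf_ball_def)
  have "(\<integral>x. \<bar>g x\<bar> \<partial>Delta_prob) \<le> M"
    by (rule Delta.integral_le_const)
      (use Linf_integrable[OF g(1)] LinfD(2)[OF g(1)] in \<open>auto intro!: AE_I2\<close>)
  then show ?thesis by (simp add: g(2) norm_abs_L1_Delta Linf_integrable[OF g(1)])
qed

lemma pairing_indicator_Un:
  assumes "A \<in> sets Delta_prob" "B \<in> sets Delta_prob" "A \<inter> B = {}"
  shows "pairing (indicator (A \<union> B)) = pairing (indicator A) + pairing (indicator B)"
proof (rule blinfun_eqI)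
  fix f
  obtain a where a: "integrable Delta_prob a" "f = abs_L1_Delta a" by (rule L1_Delta_repr)
  note i = Linf_integrable_mult[OF Linf_indicator a(1)] pairing_abs(1)[OF Linf_indicator a(1)]
  have "(\<integral>x. a x * indicator (A \<union> B) x \<partial>Delta_prob)
      = (\<integral>x. a x * indicator A x + a x * indicator B x \<partial>Delta_prob)"
    using assms(3) by (intro Bochner_Integration.integral_cong refl) (auto simp: indicator_def)
  then show "pairing (indicator (A \<union> B)) f = (pairing (indicator A) + pairing (indicator B)) f"
    using assms by (simp add: i a(2) blinfun.add_left)
qed

text \<open>The domination on indicator functions, which holds for the functionals given by functions bounded by
\<open>M\<close> and is preserved by pointwise limits, forces an element of the bidual of \<open>L\<^sup>1(\<Delta>)\<close> to be given by
such a function again. The density of \<open>p\<close> is found from its values on indicator functions, and every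
bounded function is a uniform limit of simple functions.\<close>

lemma functional_in_Linf_ball:
  fixes p :: "L1_Delta dual \<Rightarrow> real"
  assumes add: "\<And>\<phi> \<psi>. p (\<phi> + \<psi>) = p \<phi> + p \<psi>" and scale: "\<And>c \<phi>. p (c *\<^sub>R \<phi>) = c * p \<phi>"
    and bnd: "\<And>\<phi>. \<bar>p \<phi>\<bar> \<le> C * norm \<phi>"
    and dom: "\<And>A. A \<in> sets Delta_prob \<Longrightarrow> \<bar>p (pairing (indicator A))\<bar> \<le> M * measure Delta_prob A"
  shows "p \<in> evaluation ` Linf_ball M"
proof -
  obtain h where h: "Linf M h"
    "\<And>A. A \<in> sets Delta_prob \<Longrightarrow> p (pairing (indicator A)) = (\<integral>x. indicator A x * h x \<partial>Delta_prob)"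
    by (rule dominated_additive_density[of "\<lambda>A. p (pairing (indicator A))" M])
      (simp_all add: pairing_indicator_Un add dom)
  have lin: "linear p" by (rule linearI) (simp_all add: add scale)
  have "bounded_linear p"
    by (rule bounded_linear_intro[of _ C]) (use add scale bnd in \<open>auto simp: mult.commute\<close>)
  then have cont: "continuous_on UNIV p" by (rule linear_continuous_on)
  have "p \<phi> = \<phi> (abs_L1_Delta h)" for \<phi>
  proof -
    obtain g where g: "Linf (norm \<phi>) g" "\<phi> = pairing g" by (rule L1_Delta_dual_repr)
    have [measurable]: "g \<in> borel_measurable Delta_prob" by (rule LinfD[OF g(1)])
    define A where "A k i = {x \<in> space Delta_prob. \<lfloor>real (Suc k) * g x\<rfloor> = i}" for k :: nat and i :: int
    have [measurable]: "A k i \<in> sets Delta_prob" for k i by (simp add: A_def)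
    define N where "N k = \<lceil>real (Suc k) * norm \<phi>\<rceil> + 1" for k
    define \<psi> where "\<psi> k = (\<Sum>i\<in>{-N k..N k}. (real_of_int i / real (Suc k)) *\<^sub>R pairing (indicator (A k i)))" for k
    have eq: "p (\<psi> k) = \<psi> k (abs_L1_Delta h)" for k
    proof -
      have "p (\<psi> k) = (\<Sum>i\<in>{-N k..N k}. real_of_int i / real (Suc k) * p (pairing (indicator (A k i))))"
        by (simp only: \<psi>_def linear_sum[OF lin] scale)
      also have "\<dots> = (\<Sum>i\<in>{-N k..N k}. real_of_int i / real (Suc k) * pairing (indicator (A k i)) (abs_L1_Delta h))"
        by (simp add: h(2) pairing_abs(1)[OF Linf_indicator Linf_integrable[OF h(1)]] mult.commute)
      also have "\<dots> = \<psi> k (abs_L1_Delta h)"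
        by (simp only: \<psi>_def blinfun.sum_left blinfun.scaleR_left real_scaleR_def)
      finally show ?thesis .
    qed
    have "norm (\<phi> - \<psi> k) \<le> 1 / real (Suc k)" for k
    proof (rule norm_blinfun_bound)
      fix f
      obtain a where a: "integrable Delta_prob a" "f = abs_L1_Delta a" by (rule L1_Delta_repr)
      note i = Linf_integrable_mult[OF Linf_indicator a(1)] pairing_abs(1)[OF Linf_indicator a(1)]
      have L: "Linf (1 / real (Suc k)) (\<lambda>x. g x - (\<Sum>i\<in>{-N k..N k}. real_of_int i / real (Suc k) * indicator (A k i) x))"
        unfolding Linf_def
      proof (intro conjI ballI)
        fix x assume x: "x \<in> space Delta_prob"
        let ?j = "\<lfloor>real (Suc k) * g x\<rfloor>"
        have "\<bar>real (Suc k) * g x\<bar> \<le> real (Suc k) * norm \<phi>"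
          using mult_left_mono[OF LinfD(2)[OF g(1) x], of "real (Suc k)"]
          by (simp only: abs_mult abs_of_nat of_nat_0_le_iff)
        then have j: "?j \<in> {-N k..N k}"
          unfolding N_def atLeastAtMost_iff by linarith
        have "(\<Sum>i\<in>{-N k..N k}. real_of_int i / real (Suc k) * indicator (A k i) x)
            = (\<Sum>i\<in>{-N k..N k}. if i = ?j then real_of_int i / real (Suc k) else 0)"
          using x by (intro sum.cong) (auto simp: A_def)
        also have "\<dots> = real_of_int ?j / real (Suc k)" using j by simp
        finally have s: "(\<Sum>i\<in>{-N k..N k}. real_of_int i / real (Suc k) * indicator (A k i) x)
          = real_of_int ?j / real (Suc k)" .
        have "\<bar>real (Suc k) * g x - real_of_int ?j\<bar> \<le> 1" by linarith
        moreover have "g x - real_of_int ?j / real (Suc k) = (real (Suc k) * g x - real_of_int ?j) / real (Suc k)"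
          by (simp add: field_simps)
        ultimately show "\<bar>g x - (\<Sum>i\<in>{-N k..N k}. real_of_int i / real (Suc k) * indicator (A k i) x)\<bar> \<le> 1 / real (Suc k)"
          unfolding s by (simp only: abs_divide) (simp add: divide_right_mono)
      qed measurable
      have "\<psi> k f = (\<Sum>i\<in>{-N k..N k}. real_of_int i / real (Suc k) * (\<integral>x. a x * indicator (A k i) x \<partial>Delta_prob))"
        by (simp only: \<psi>_def blinfun.sum_left blinfun.scaleR_left real_scaleR_def a(2))
          (simp add: pairing_abs(1)[OF Linf_indicator a(1)])
      also have "\<dots> = (\<integral>x. (\<Sum>i\<in>{-N k..N k}. real_of_int i / real (Suc k) * (a x * indicator (A k i) x)) \<partial>Delta_prob)"
        using i(1) by (subst Bochner_Integration.integral_sum) auto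
      finally have "(\<phi> - \<psi> k) f = (\<integral>x. a x * g x - (\<Sum>i\<in>{-N k..N k}. real_of_int i / real (Suc k) * (a x * indicator (A k i) x)) \<partial>Delta_prob)"
        using i(1) Linf_integrable_mult[OF g(1) a(1)] pairing_abs(1)[OF g(1) a(1)]
        by (simp add: blinfun.diff_left a(2) flip: g(2))
      also have "\<dots> = (\<integral>x. a x * (g x - (\<Sum>i\<in>{-N k..N k}. real_of_int i / real (Suc k) * indicator (A k i) x)) \<partial>Delta_prob)"
        by (simp add: right_diff_distrib sum_distrib_left mult.left_commute)
      finally have "(\<phi> - \<psi> k) f = \<dots>" .
      then show "norm ((\<phi> - \<psi> k) f) \<le> 1 / real (Suc k) * norm f"
        using abs_integral_mult_Linf_le[OF L a(1)] a norm_abs_L1_Delta[OF a(1)] by simp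
    qed simp
    then have "(\<lambda>k. \<psi> k - \<phi>) \<longlonglongrightarrow> 0"
      by (intro Lim_null_comparison[OF _ LIMSEQ_inverse_real_of_nat])
        (simp add: norm_minus_commute inverse_eq_divide)
    then have lim: "\<psi> \<longlonglongrightarrow> \<phi>" by (rule LIM_zero_cancel)
    have "(\<lambda>k. p (\<psi> k)) \<longlonglongrightarrow> p \<phi>"
      by (rule continuous_on_tendsto_compose[OF cont lim]) auto
    moreover have "(\<lambda>k. p (\<psi> k)) \<longlonglongrightarrow> \<phi> (abs_L1_Delta h)"
      unfolding eq by (rule blinfun.tendsto[OF lim tendsto_const])
    ultimately show ?thesis by (rule LIMSEQ_unique)
  qed
  then have "p = evaluation (abs_L1_Delta h)" by (auto simp: evaluation_def)
  with h(1) show ?thesis by (auto simp: Linf_ball_def)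
qed

text \<open>In the space of all real functions on the dual, this set is cut out of a product of compact intervals
by closed conditions.\<close>

lemma compact_Linf_ball: "compact (evaluation ` Linf_ball M)"
proof -
  define S where "S = {p :: L1_Delta dual \<Rightarrow> real. (\<forall>\<phi> \<psi>. p (\<phi> + \<psi>) = p \<phi> + p \<psi>) \<and>
    (\<forall>c \<phi>. p (c *\<^sub>R \<phi>) = c * p \<phi>) \<and> (\<forall>\<phi>. \<bar>p \<phi>\<bar> \<le> M * norm \<phi>) \<and>
    (\<forall>A\<in>sets Delta_prob. \<bar>p (pairing (indicator A))\<bar> \<le> M * measure Delta_prob A)}"
  have "evaluation ` Linf_ball M = S"
  proof
    show "S \<subseteq> evaluation ` Linf_ball M"
    proof
      fix p assume "p \<in> S"
      then show "p \<in> evaluation ` Linf_ball M"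
        by (intro functional_in_Linf_ball[where C=M]) (auto simp: S_def)
    qed
    show "evaluation ` Linf_ball M \<subseteq> S"
    proof
      fix p assume "p \<in> evaluation ` Linf_ball M"
      then obtain h where h: "Linf M h" "p = evaluation (abs_L1_Delta h)" by (auto simp: Linf_ball_def)
      have "norm (abs_L1_Delta h) \<le> M" by (rule norm_Linf_ball) (use h in \<open>auto simp: Linf_ball_def\<close>)
      then have 1: "\<bar>\<phi> (abs_L1_Delta h)\<bar> \<le> M * norm \<phi>" for \<phi> :: "L1_Delta dual"
        using norm_blinfun[of \<phi> "abs_L1_Delta h"]
          mult_left_mono[of "norm (abs_L1_Delta h)" M "norm \<phi>"]
        by (simp add: mult.commute[of M])
      have 2: "\<bar>pairing (indicator A) (abs_L1_Delta h)\<bar> \<le> M * measure Delta_prob A"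
        if "A \<in> sets Delta_prob" for A
        using pairing_abs(1)[OF Linf_indicator[OF that] Linf_integrable[OF h(1)]]
          abs_integral_mult_Linf_le[OF h(1), of "indicator A"] that by (simp add: mult.commute)
      from 1 2 show "p \<in> S"
        by (simp add: S_def h(2) evaluation_def blinfun.add_left blinfun.scaleR_left)
    qed
  qed
  moreover have "closed S"
    unfolding S_def Ball_def
    by (intro closed_Collect_conj closed_Collect_all closed_Collect_imp open_Collect_const
        closed_Collect_eq closed_Collect_le continuous_intros continuous_on_fun_apply)
  moreover have "S = {f. \<forall>\<phi>. \<bar>f \<phi>\<bar> \<le> M * norm \<phi>} \<inter> S" by (auto simp: S_def)
  ultimately show ?thesis
    using compact_Int_closed[OF compact_fun_bounded[of "\<lambda>\<phi>. M * norm \<phi>"], of S] by simp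
qed

lemma Linf_ball_weak_lim:
  assumes x: "\<And>n. x n \<in> Linf_ball M"
  shows "\<exists>l\<in>Linf_ball M. weak_lim x l"
proof -
  have "\<exists>l. ((\<lambda>n. blinfun_apply \<phi> (x n)) \<longlongrightarrow> l) limit_filter" for \<phi> :: "L1_Delta dual"
  proof (rule Bseq_limit_filter)
    have "compact ((\<lambda>f. f \<phi>) ` evaluation ` Linf_ball M)"
      by (intro compact_continuous_image continuous_on_fun_apply compact_Linf_ball)
    then have "bounded ((\<lambda>f. f \<phi>) ` evaluation ` Linf_ball M)" by (rule compact_imp_bounded)
    then have "bounded (range (\<lambda>n. \<phi> (x n)))"
      by (rule bounded_subset) (use x in \<open>auto simp: evaluation_def image_image\<close>)
    then show "Bseq (\<lambda>n. \<phi> (x n))" by (simp add: Bseq_eq_bounded)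
  qed
  then obtain p :: "L1_Delta dual \<Rightarrow> real"
    where p: "\<And>\<phi>. ((\<lambda>n. blinfun_apply \<phi> (x n)) \<longlongrightarrow> p \<phi>) limit_filter"
    by metis
  have "p \<in> evaluation ` Linf_ball M"
  proof (rule Lim_in_closed_set[OF compact_fun_imp_closed[OF compact_Linf_ball]])
    show "((\<lambda>n. evaluation (x n)) \<longlongrightarrow> p) limit_filter"
    proof -
      have "limitin (product_topology (\<lambda>_. euclidean) UNIV) (\<lambda>n. evaluation (x n)) p limit_filter"
        by (simp add: limitin_componentwise evaluation_def p)
      then show ?thesis by (simp add: euclidean_product_topology)
    qed
  qed (use x in \<open>auto simp: limit_filter_neq_bot\<close>)
  then obtain l where "l \<in> Linf_ball M" "p = evaluation l" by blast
  with p show ?thesis by (auto simp: weak_lim_def evaluation_def)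
qed

text \<open>The operator maps into \<open>L\<^sup>\<infinity>(\<Delta>)\<close> and has norm at most \<open>M\<close> as an operator from \<open>L\<^sup>1(\<Delta>)\<close> to
\<open>L\<^sup>\<infinity>(\<Delta>)\<close>.\<close>

definition Linf_valued :: "real \<Rightarrow> (L1_Delta \<Rightarrow>\<^sub>L L1_Delta) \<Rightarrow> bool" where
  "Linf_valued M V \<longleftrightarrow> (\<forall>f. V f \<in> Linf_ball (M * norm f))"

lemma Linf_valued_imp_weakly_compact:
  assumes "Linf_valued M V" "0 \<le> M"
  shows "weakly_compact_op V"
  unfolding weakly_compact_op_iff
proof (intro exI conjI)
  show "compact (evaluation ` Linf_ball M)" by (rule compact_Linf_ball)
  show "blinfun_apply V ` cball 0 1 \<subseteq> Linf_ball M"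
  proof clarify
    fix f :: L1_Delta assume "f \<in> cball 0 1"
    then have "M * norm f \<le> M" using assms(2) by (simp add: mult_left_le)
    moreover obtain h where "Linf (M * norm f) h" "V f = abs_L1_Delta h"
      using assms(1) by (auto simp: Linf_valued_def Linf_ball_def)
    ultimately show "V f \<in> Linf_ball M" by (auto simp: Linf_ball_def intro: Linf_mono)
  qed
qed

lemma Linf_valued_weak_lim:
  assumes V: "\<And>n. Linf_valued M (V n)"
  obtains U where "Linf_valued M U" "\<And>f. weak_lim (\<lambda>n. V n f) (U f)"
proof -
  have "\<forall>f. \<exists>l\<in>Linf_ball (M * norm f). weak_lim (\<lambda>n. V n f) l"
    using V by (intro allI Linf_ball_weak_lim) (simp add: Linf_valued_def)
  then obtain W where W: "\<And>f. W f \<in> Linf_ball (M * norm f)" "\<And>f. weak_lim (\<lambda>n. V n f) (W f)"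
    by metis
  have "bounded_linear W"
  proof (rule bounded_linear_intro[of _ M])
    show "W (f + g) = W f + W g" for f g
      using weak_lim_unique[OF W(2)[of "f + g"]] weak_lim_add[OF W(2)[of f] W(2)[of g]]
      by (simp add: blinfun.add_right)
    show "W (c *\<^sub>R f) = c *\<^sub>R W f" for c f
      using weak_lim_unique[OF W(2)[of "c *\<^sub>R f"]] weak_lim_scaleR[OF W(2)[of f]]
      by (simp add: blinfun.scaleR_right)
    show "norm (W f) \<le> norm f * M" for f
      using norm_Linf_ball[OF W(1)[of f]] by (simp add: mult.commute)
  qed
  then have "blinfun_apply (Blinfun W) = W" by (rule bounded_linear_Blinfun_apply)
  with W show ?thesis by (intro that[of "Blinfun W"]) (auto simp: Linf_valued_def)
qed


section \<open>Cylinder sets and operators that factor through finitely many coordinates\<close>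

lemma space_Delta_prob: "space Delta_prob = {x. \<forall>j. x j \<in> {-1, 1}}"
  by (auto simp: Delta_prob_def space_PiM space_uniform_count_measure PiE_iff)

lemma sets_coordinate [measurable]: "{x \<in> space Delta_prob. x j = c} \<in> sets Delta_prob"
proof -
  have "{x \<in> space Delta_prob. rademacher j x = c} \<in> sets Delta_prob" by measurable
  then show ?thesis by (simp add: rademacher_def)
qed

lemma measure_coordinates:
  assumes J: "finite J" and v: "\<And>j. j \<in> J \<Longrightarrow> v j \<in> {-1, 1}"
  shows "measure Delta_prob {x \<in> space Delta_prob. \<forall>j\<in>J. x j = v j} = (1/2) ^ card J"
proof -
  interpret prob_space "uniform_count_measure {-1, 1 :: real}"
    by (rule prob_space_uniform_count_measure) auto
  interpret Pr: product_prob_space "\<lambda>_ :: nat. uniform_count_measure {-1, 1 :: real}" UNIV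
    by unfold_locales
  have "{x \<in> space Delta_prob. \<forall>j\<in>J. x j = v j}
      = prod_emb UNIV (\<lambda>_. uniform_count_measure {-1, 1}) J (Pi\<^sub>E J (\<lambda>j. {v j}))"
    by (auto simp: prod_emb_def Delta_prob_def space_PiM PiE_iff restrict_def)
  then have "measure Delta_prob {x \<in> space Delta_prob. \<forall>j\<in>J. x j = v j}
      = (\<Prod>j\<in>J. measure (uniform_count_measure {-1, 1}) {v j})"
    using Pr.measure_PiM_emb[of J "\<lambda>j. {v j}"] J v
    by (simp add: Delta_prob_def sets_uniform_count_measure)
  also have "\<dots> = (\<Prod>j\<in>J. 1/2)"
  proof (rule prod.cong[OF refl])
    fix j assume "j \<in> J"
    then have "{v j} \<subseteq> {-1, 1}" using v by blast
    then show "measure (uniform_count_measure {-1, 1 :: real}) {v j} = 1/2"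
      by (subst measure_uniform_count_measure) auto
  qed
  finally show ?thesis by simp
qed

text \<open>Words are extensional functions so that \<open>words n\<close> is finite and every point of \<open>\<Delta>\<close> has exactly one
of them as its restriction.\<close>

definition words :: "nat \<Rightarrow> (nat \<Rightarrow> real) set" where
  "words n = (\<Pi>\<^sub>E j\<in>{..<n}. {-1, 1})"

definition cyl :: "nat \<Rightarrow> (nat \<Rightarrow> real) \<Rightarrow> (nat \<Rightarrow> real) set" where
  "cyl n w = {x \<in> space Delta_prob. \<forall>j\<in>{..<n}. x j = w j}"

lemma finite_words [simp]: "finite (words n)"
  unfolding words_def by (intro finite_PiE) auto

lemma wordsD: "w \<in> words n \<Longrightarrow> j < n \<Longrightarrow> w j \<in> {-1, 1}"
  by (auto simp: words_def PiE_iff)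

lemma sets_cyl [measurable, simp]: "cyl n w \<in> sets Delta_prob"
proof -
  have "cyl n w = space Delta_prob \<inter> (\<Inter>j\<in>{..<n}. {x \<in> space Delta_prob. x j = w j})"
    by (auto simp: cyl_def)
  also have "\<dots> \<in> sets Delta_prob"
    by (cases "n = 0") (auto intro!: sets.Int sets.finite_INT)
  finally show ?thesis .
qed

lemma measure_cyl: "w \<in> words n \<Longrightarrow> measure Delta_prob (cyl n w) = (1/2) ^ n"
  unfolding cyl_def using measure_coordinates[of "{..<n}" w] wordsD[of w n] by simp

lemma indicator_cyl:
  assumes "x \<in> space Delta_prob" "w \<in> words n"
  shows "indicator (cyl n w) x = (if w = restrict x {..<n} then 1 else 0 :: real)"
proof -
  have "x \<in> cyl n w \<longleftrightarrow> w = restrict x {..<n}"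
    using assms by (auto simp: cyl_def words_def fun_eq_iff restrict_def PiE_iff extensional_def)
  then show ?thesis by (simp add: indicator_def)
qed

lemma sum_indicator_cyl:
  assumes "x \<in> space Delta_prob"
  shows "(\<Sum>w\<in>words n. indicator (cyl n w) x * c w) = (c (restrict x {..<n}) :: real)"
proof -
  have r: "restrict x {..<n} \<in> words n"
    using assms by (auto simp: words_def space_Delta_prob PiE_iff)
  have "(\<Sum>w\<in>words n. indicator (cyl n w) x * c w)
      = (\<Sum>w\<in>words n. if w = restrict x {..<n} then c w else 0)"
    using assms by (intro sum.cong refl) (simp add: indicator_cyl)
  also have "\<dots> = c (restrict x {..<n})" using r by simp
  finally show ?thesis .
qed

lemma integral_split_cyl:
  fixes f :: "(nat \<Rightarrow> real) \<Rightarrow> real"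
  assumes f: "integrable Delta_prob f"
  shows "(\<Sum>w\<in>words n. \<integral>x. f x * indicator (cyl n w) x \<partial>Delta_prob) = (\<integral>x. f x \<partial>Delta_prob)"
proof -
  have "(\<Sum>w\<in>words n. \<integral>x. f x * indicator (cyl n w) x \<partial>Delta_prob)
      = (\<integral>x. (\<Sum>w\<in>words n. f x * indicator (cyl n w) x) \<partial>Delta_prob)"
    by (rule Bochner_Integration.integral_sum[symmetric]) (rule Linf_integrable_mult[OF Linf_indicator[OF sets_cyl] f])
  also have "\<dots> = (\<integral>x. f x \<partial>Delta_prob)"
  proof (rule Bochner_Integration.integral_cong[OF refl])
    fix x assume "x \<in> space Delta_prob"
    then show "(\<Sum>w\<in>words n. f x * indicator (cyl n w) x) = f x"
      using sum_indicator_cyl[of x n "\<lambda>_. f x"] by (simp add: mult.commute)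
  qed
  finally show ?thesis .
qed

abbreviation cyl_integral :: "nat \<Rightarrow> (nat \<Rightarrow> real) \<Rightarrow> L1_Delta dual" where
  "cyl_integral n w \<equiv> pairing (indicator (cyl n w))"

lemma cyl_integral_abs:
  "integrable Delta_prob f \<Longrightarrow> cyl_integral n w (abs_L1_Delta f) = (\<integral>x. f x * indicator (cyl n w) x \<partial>Delta_prob)"
  by (rule pairing_abs(1)[OF Linf_indicator]) auto

lemma sum_abs_cyl_integral_le: "(\<Sum>w\<in>words n. \<bar>cyl_integral n w f\<bar>) \<le> norm f"
proof -
  obtain a where a: "integrable Delta_prob a" "f = abs_L1_Delta a" by (rule L1_Delta_repr)
  have "\<bar>cyl_integral n w f\<bar> \<le> (\<integral>x. \<bar>a x\<bar> * indicator (cyl n w) x \<partial>Delta_prob)" for w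
    using integral_abs_bound[of Delta_prob "\<lambda>x. a x * indicator (cyl n w) x"]
    by (simp add: a cyl_integral_abs abs_mult)
  then have "(\<Sum>w\<in>words n. \<bar>cyl_integral n w f\<bar>)
      \<le> (\<Sum>w\<in>words n. \<integral>x. \<bar>a x\<bar> * indicator (cyl n w) x \<partial>Delta_prob)"
    by (intro sum_mono)
  also have "\<dots> = norm f"
    using a by (subst integral_split_cyl) (auto simp: norm_abs_L1_Delta)
  finally show ?thesis .
qed

lemma integral_rademacher_cyl:
  assumes w: "w \<in> words n"
  shows "(\<integral>x. rademacher j x * indicator (cyl n w) x \<partial>Delta_prob) = (if j < n then w j * (1/2) ^ n else 0)"
proof (cases "j < n")
  case True
  have "(\<integral>x. rademacher j x * indicator (cyl n w) x \<partial>Delta_prob)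
      = (\<integral>x. w j * indicator (cyl n w) x \<partial>Delta_prob)"
    using True by (intro Bochner_Integration.integral_cong refl)
      (auto simp: indicator_def cyl_def rademacher_def)
  then show ?thesis using True w by (simp add: measure_cyl)
next
  case False
  define C where "C s = {x \<in> space Delta_prob. \<forall>i\<in>insert j {..<n}. x i = (w(j := s)) i}" for s
  have C: "C s = cyl n w \<inter> {x \<in> space Delta_prob. x j = s}" for s
    using False by (auto simp: C_def cyl_def)
  have [measurable]: "C s \<in> sets Delta_prob" for s unfolding C by measurable
  have m: "measure Delta_prob (C s) = (1/2) ^ Suc n" if "s \<in> {-1, 1}" for s
    unfolding C_def using that False wordsD[OF w] by (subst measure_coordinates) auto
  have "(\<integral>x. rademacher j x * indicator (cyl n w) x \<partial>Delta_prob)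
      = (\<integral>x. indicator (C 1) x - indicator (C (-1)) x \<partial>Delta_prob)"
  proof (rule Bochner_Integration.integral_cong[OF refl])
    fix x assume "x \<in> space Delta_prob"
    then have "x j = -1 \<or> x j = 1" by (auto simp: space_Delta_prob)
    then show "rademacher j x * indicator (cyl n w) x = indicator (C 1) x - indicator (C (-1)) x"
      using \<open>x \<in> space Delta_prob\<close> by (auto simp: C indicator_def rademacher_def)
  qed
  also have "\<dots> = measure Delta_prob (C 1) - measure Delta_prob (C (-1))"
    by simp
  finally show ?thesis using False m by simp
qed

lemma cyl_integral_rademacher:
  "w \<in> words n \<Longrightarrow> cyl_integral n w (rademacher_L1 j) = (if j < n then w j * (1/2) ^ n else 0)"
  unfolding rademacher_L1_def
  by (subst cyl_integral_abs[OF integrable_rademacher]) (rule integral_rademacher_cyl)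

lift_definition rank_one :: "'a::real_normed_vector dual \<Rightarrow> 'b::real_normed_vector \<Rightarrow> 'a \<Rightarrow>\<^sub>L 'b"
  is "\<lambda>\<phi> y x. blinfun_apply \<phi> x *\<^sub>R y"
  by (rule bounded_linear_scaleR_const[OF blinfun.bounded_linear_right])

lemma weakly_compact_rank_one: "weakly_compact_op (rank_one \<phi> y)"
  unfolding weakly_compact_op_iff
proof (intro exI conjI)
  show "blinfun_apply (rank_one \<phi> y) ` cball 0 1 \<subseteq> (\<lambda>t. t *\<^sub>R y) ` {- norm \<phi>..norm \<phi>}"
  proof clarify
    fix x :: 'a assume "x \<in> cball 0 1"
    then have "\<bar>blinfun_apply \<phi> x\<bar> \<le> norm \<phi>"
      using norm_blinfun[of \<phi> x] mult_left_mono[of "norm x" 1 "norm \<phi>"] by simp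
    then show "rank_one \<phi> y x \<in> (\<lambda>t. t *\<^sub>R y) ` {- norm \<phi>..norm \<phi>}"
      by (intro image_eqI[of _ _ "blinfun_apply \<phi> x"]) (auto simp: rank_one.rep_eq)
  qed
  have "evaluation ` (\<lambda>t. t *\<^sub>R y) ` {- norm \<phi>..norm \<phi>} = (\<lambda>t \<psi>. t * blinfun_apply \<psi> y) ` {- norm \<phi>..norm \<phi>}"
    by (simp add: image_image evaluation_def blinfun.scaleR_right)
  also have "compact \<dots>"
    by (intro compact_continuous_image continuous_on_coordinatewise_then_product
        continuous_intros compact_Icc)
  finally show "compact (evaluation ` (\<lambda>t. t *\<^sub>R y) ` {- norm \<phi>..norm \<phi>})" .
qed

text \<open>The operator sends the normalised indicator function of the cylinder set of \<open>w\<close> to \<open>h w\<close> and factors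
through the conditional expectation onto the first \<open>n\<close> coordinates.\<close>

definition cyl_op :: "nat \<Rightarrow> ((nat \<Rightarrow> real) \<Rightarrow> 'b::real_normed_vector) \<Rightarrow> L1_Delta \<Rightarrow>\<^sub>L 'b" where
  "cyl_op n h = (\<Sum>w\<in>words n. rank_one (cyl_integral n w) (h w))"

lemma cyl_op_apply: "cyl_op n h f = (\<Sum>w\<in>words n. cyl_integral n w f *\<^sub>R h w)"
  unfolding cyl_op_def by (simp add: blinfun.sum_left rank_one.rep_eq)

lemma weakly_compact_cyl_op: "weakly_compact_op (cyl_op n h)"
  unfolding cyl_op_def
  using subspace_sum[OF subspace_weakly_compact_op, of "words n" "\<lambda>w. rank_one (cyl_integral n w) (h w)"]
  by (simp add: weakly_compact_rank_one)

lemma norm_cyl_op_le: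
  assumes "\<And>w. w \<in> words n \<Longrightarrow> norm (h w) \<le> C" "0 \<le> C"
  shows "norm (cyl_op n h) \<le> C"
proof (rule norm_blinfun_bound[OF assms(2)])
  fix f
  have "norm (cyl_op n h f) \<le> (\<Sum>w\<in>words n. norm (cyl_integral n w f *\<^sub>R h w))"
    unfolding cyl_op_apply by (rule norm_sum)
  also have "\<dots> \<le> (\<Sum>w\<in>words n. \<bar>cyl_integral n w f\<bar> * C)"
    using assms by (intro sum_mono) (auto intro: mult_left_mono)
  also have "\<dots> = C * (\<Sum>w\<in>words n. \<bar>cyl_integral n w f\<bar>)"
    by (simp add: sum_distrib_left mult.commute)
  also have "\<dots> \<le> C * norm f"
    by (intro mult_left_mono sum_abs_cyl_integral_le assms)
  finally show "norm (cyl_op n h f) \<le> C * norm f" .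
qed

lemma blinfun_cyl_op: "blinfun_apply A (cyl_op n h f) = cyl_op n (\<lambda>w. blinfun_apply A (h w)) f"
  by (simp add: cyl_op_apply blinfun.sum_right blinfun.scaleR_right)

lemma cyl_op_diff: "cyl_op n h f - cyl_op n k f = cyl_op n (\<lambda>w. h w - k w) f"
  by (simp add: cyl_op_apply sum_subtractf scaleR_diff_right)

lemma cyl_op_rademacher:
  "cyl_op n h (rademacher_L1 j) = (if j < n then (1/2) ^ n *\<^sub>R (\<Sum>w\<in>words n. w j *\<^sub>R h w) else 0)"
  unfolding cyl_op_apply
  by (auto simp: cyl_integral_rademacher scaleR_sum_right mult.commute intro!: sum.cong sum.neutral)

lemma abs_L1_Delta_sum:
  assumes "finite W" "\<And>w. w \<in> W \<Longrightarrow> integrable Delta_prob (g w)"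
  shows "(\<Sum>w\<in>W. c w *\<^sub>R abs_L1_Delta (g w)) = abs_L1_Delta (\<lambda>x. \<Sum>w\<in>W. c w * g w x)"
  using assms
proof (induction W)
  case empty
  then show ?case by (simp add: zero_L1_Delta_def)
next
  case (insert v W)
  then have "integrable Delta_prob (\<lambda>x. \<Sum>w\<in>W. c w * g w x)"
    by (intro Bochner_Integration.integrable_sum) auto
  with insert show ?case by (simp add: scaleR_abs_L1_Delta add_abs_L1_Delta)
qed

lemma Linf_sum:
  assumes "finite W" "\<And>w. w \<in> W \<Longrightarrow> Linf M (g w)"
  shows "Linf (M * (\<Sum>w\<in>W. \<bar>c w\<bar>)) (\<lambda>x. \<Sum>w\<in>W. c w * g w x)"
  unfolding Linf_def
proof (intro conjI ballI)
  show "(\<lambda>x. \<Sum>w\<in>W. c w * g w x) \<in> borel_measurable Delta_prob"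
    using assms by (intro borel_measurable_sum borel_measurable_times) (auto simp: Linf_def)
  fix x assume x: "x \<in> space Delta_prob"
  have "\<bar>\<Sum>w\<in>W. c w * g w x\<bar> \<le> (\<Sum>w\<in>W. \<bar>c w * g w x\<bar>)" by (rule sum_abs)
  also have "\<dots> \<le> (\<Sum>w\<in>W. \<bar>c w\<bar> * M)"
    using assms x by (intro sum_mono) (auto simp: Linf_def abs_mult intro!: mult_left_mono)
  finally show "\<bar>\<Sum>w\<in>W. c w * g w x\<bar> \<le> M * (\<Sum>w\<in>W. \<bar>c w\<bar>)"
    by (simp add: sum_distrib_left mult.commute)
qed

lemma Linf_valued_cyl_op:
  assumes h: "\<And>w. w \<in> words n \<Longrightarrow> h w \<in> Linf_ball M" and M: "0 \<le> M"
  shows "Linf_valued M (cyl_op n h)"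
  unfolding Linf_valued_def
proof
  fix f
  have "\<forall>w\<in>words n. \<exists>g. Linf M g \<and> h w = abs_L1_Delta g"
    using h by (auto simp: Linf_ball_def)
  then obtain g where g: "\<And>w. w \<in> words n \<Longrightarrow> Linf M (g w)" "\<And>w. w \<in> words n \<Longrightarrow> h w = abs_L1_Delta (g w)"
    by metis
  let ?c = "\<lambda>w. cyl_integral n w f"
  have "cyl_op n h f = (\<Sum>w\<in>words n. ?c w *\<^sub>R abs_L1_Delta (g w))"
    unfolding cyl_op_apply by (intro sum.cong refl) (simp add: g)
  also have "\<dots> = abs_L1_Delta (\<lambda>x. \<Sum>w\<in>words n. ?c w * g w x)"
    by (rule abs_L1_Delta_sum) (auto intro: Linf_integrable g)
  finally have eq: "cyl_op n h f = abs_L1_Delta (\<lambda>x. \<Sum>w\<in>words n. ?c w * g w x)" .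
  have "Linf (M * norm f) (\<lambda>x. \<Sum>w\<in>words n. ?c w * g w x)"
    by (rule Linf_mono[OF Linf_sum[OF finite_words g(1)] mult_left_mono[OF sum_abs_cyl_integral_le M]])
  with eq show "cyl_op n h f \<in> Linf_ball (M * norm f)" by (auto simp: Linf_ball_def)
qed

definition cyl_density :: "nat \<Rightarrow> (nat \<Rightarrow> real) \<Rightarrow> L1_Delta" where
  "cyl_density n w = 2 ^ n *\<^sub>R ind_L1 (cyl n w)"

lemma norm_cyl_density: "w \<in> words n \<Longrightarrow> norm (cyl_density n w) = 1"
  by (simp add: cyl_density_def norm_ind_L1 measure_cyl power_divide)

text \<open>The conditional expectation onto the first \<open>n\<close> coordinates.\<close>

text \<open>The conditional expectation onto the first \<open>n\<close> coordinates.\<close>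

definition cond_exp_cyl :: "nat \<Rightarrow> L1_Delta \<Rightarrow>\<^sub>L L1_Delta" where
  "cond_exp_cyl n = cyl_op n (cyl_density n)"

lemma norm_cond_exp_cyl_le: "norm (cond_exp_cyl n) \<le> 1"
  unfolding cond_exp_cyl_def by (rule norm_cyl_op_le) (simp_all add: norm_cyl_density)

lemma cond_exp_cyl_indicator:
  assumes A: "A \<in> sets Delta_prob"
    and dep: "\<And>x y. x \<in> space Delta_prob \<Longrightarrow> y \<in> space Delta_prob \<Longrightarrow> (\<And>j. j < n \<Longrightarrow> x j = y j) \<Longrightarrow> x \<in> A \<Longrightarrow> y \<in> A"
  shows "cond_exp_cyl n (ind_L1 A) = ind_L1 A"
proof -
  define c where "c w = (if cyl n w \<subseteq> A then 1 else 0 :: real)" for w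
  have *: "indicator A x * indicator (cyl n w) x = c w * indicator (cyl n w) x"
    for w and x :: "nat \<Rightarrow> real"
  proof (cases "x \<in> cyl n w")
    case True
    have "y \<in> A" if "x \<in> A" "y \<in> cyl n w" for y
      by (rule dep[of x y]) (use True that in \<open>simp_all add: cyl_def\<close>)
    with True have "x \<in> A \<longleftrightarrow> cyl n w \<subseteq> A" by blast
    then show ?thesis by (auto simp: c_def indicator_def)
  qed simp
  have "cyl_integral n w (ind_L1 A) *\<^sub>R cyl_density n w = c w *\<^sub>R ind_L1 (cyl n w)" if w: "w \<in> words n" for w
    using A measure_cyl[OF w] by (simp add: ind_L1_def cyl_integral_abs * cyl_density_def power_divide)
  then have "cond_exp_cyl n (ind_L1 A) = (\<Sum>w\<in>words n. c w *\<^sub>R ind_L1 (cyl n w))"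
    by (simp add: cond_exp_cyl_def cyl_op_apply)
  also have "\<dots> = abs_L1_Delta (\<lambda>x. \<Sum>w\<in>words n. c w * indicator (cyl n w) x)"
    unfolding ind_L1_def by (rule abs_L1_Delta_sum) auto
  also have "\<dots> = ind_L1 A"
    unfolding ind_L1_def
  proof (rule abs_L1_Delta_cong_AE)
    show "AE x in Delta_prob. (\<Sum>w\<in>words n. c w * indicator (cyl n w) x) = indicator A x"
    proof (rule AE_I2)
      fix x assume x: "x \<in> space Delta_prob"
      have "(\<Sum>w\<in>words n. c w * indicator (cyl n w) x) = (\<Sum>w\<in>words n. indicator (cyl n w) x * indicator A x)"
        by (intro sum.cong refl) (metis * mult.commute)
      then show "(\<Sum>w\<in>words n. c w * indicator (cyl n w) x) = indicator A x"
        using sum_indicator_cyl[OF x, of n "\<lambda>_. indicator A x"] by simp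
    qed
    show "integrable Delta_prob (\<lambda>x. \<Sum>w\<in>words n. c w * indicator (cyl n w) x)"
      by (intro Bochner_Integration.integrable_sum integrable_mult_right) simp
  qed (use A in simp)
  finally show ?thesis .
qed

text \<open>The functions for which this holds form a closed subspace, because the operators are contractions. It
contains the indicator functions of the rectangles that generate the product \<open>\<sigma>\<close>-algebra, on
which the sequence is eventually constant; Dynkin's argument extends this to all measurable sets.\<close>

lemma cond_exp_cyl_tendsto: "(\<lambda>n. cond_exp_cyl n f) \<longlonglongrightarrow> f"
proof -
  define C where "C = {f. (\<lambda>n. cond_exp_cyl n f) \<longlonglongrightarrow> f}"
  have sub: "subspace C"
    by (rule subspaceI) (auto simp: C_def blinfun.add_right blinfun.scaleR_right intro: tendsto_add tendsto_scaleR)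
  have "closed C"
    unfolding closed_sequential_limits
  proof (intro allI impI)
    fix s l assume "(\<forall>k. s k \<in> C) \<and> s \<longlonglongrightarrow> l"
    then have s: "\<And>k. (\<lambda>n. cond_exp_cyl n (s k)) \<longlonglongrightarrow> s k" "s \<longlonglongrightarrow> l" by (auto simp: C_def)
    have "(\<lambda>n. cond_exp_cyl n l) \<longlonglongrightarrow> l"
    proof (rule LIMSEQ_I)
      fix e :: real assume e: "e > 0"
      then obtain k where k: "norm (s k - l) < e/3"
        using LIMSEQ_D[OF s(2), of "e/3"] by auto
      obtain N where N: "\<And>n. n \<ge> N \<Longrightarrow> norm (cond_exp_cyl n (s k) - s k) < e/3"
        using LIMSEQ_D[OF s(1), of "e/3" k] e by auto
      show "\<exists>N. \<forall>n\<ge>N. norm (cond_exp_cyl n l - l) < e"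
      proof (intro exI allI impI)
        fix n assume "N \<le> n"
        have "norm (cond_exp_cyl n (l - s k)) \<le> norm (cond_exp_cyl n) * norm (l - s k)" by (rule norm_blinfun)
        also have "\<dots> \<le> 1 * norm (l - s k)" by (intro mult_right_mono norm_cond_exp_cyl_le) simp
        finally have "norm (cond_exp_cyl n (l - s k)) < e/3" using k by (simp add: norm_minus_commute)
        moreover have eq: "cond_exp_cyl n l - l = cond_exp_cyl n (l - s k) + (cond_exp_cyl n (s k) - s k) + (s k - l)"
          by (simp add: blinfun.diff_right)
        ultimately show "norm (cond_exp_cyl n l - l) < e"
          unfolding eq using N[OF \<open>N \<le> n\<close>] k
            norm_triangle_ineq[of "cond_exp_cyl n (l - s k) + (cond_exp_cyl n (s k) - s k)" "s k - l"]
            norm_triangle_ineq[of "cond_exp_cyl n (l - s k)" "cond_exp_cyl n (s k) - s k"]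
          by linarith
      qed
    qed
    then show "l \<in> C" by (simp add: C_def)
  qed
  let ?M = "\<lambda>_ :: nat. uniform_count_measure {-1, 1 :: real}"
  have sets: "sets Delta_prob = sigma_sets (\<Pi>\<^sub>E i\<in>UNIV. space (?M i)) (prod_algebra UNIV ?M)"
    by (simp add: Delta_prob_def sets_PiM)
  have space: "space Delta_prob = (\<Pi>\<^sub>E i\<in>UNIV. space (?M i))"
    by (simp add: Delta_prob_def space_PiM)
  have gen: "ind_L1 A \<in> C" if A: "A \<in> prod_algebra UNIV ?M" for A
  proof -
    obtain J E where J: "A = prod_emb UNIV ?M J (\<Pi>\<^sub>E j\<in>J. E j)" "finite J"
      using A by (rule prod_algebraE) blast
    obtain N where N: "\<And>j. j \<in> J \<Longrightarrow> j < N" using J(2) by (meson finite_nat_set_iff_bounded)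
    have As: "A \<in> sets Delta_prob" unfolding sets using A by (rule sigma_sets.Basic)
    have "cond_exp_cyl n (ind_L1 A) = ind_L1 A" if "n \<ge> N" for n
    proof (rule cond_exp_cyl_indicator[OF As])
      fix x y assume xy: "x \<in> space Delta_prob" "y \<in> space Delta_prob" "\<And>j. j < n \<Longrightarrow> x j = y j" "x \<in> A"
      then have "restrict x J = restrict y J" using N that by (force simp: restrict_def)
      then show "y \<in> A" using xy by (simp add: J(1) prod_emb_def space)
    qed
    then have "eventually (\<lambda>n. cond_exp_cyl n (ind_L1 A) = ind_L1 A) sequentially"
      by (rule eventually_sequentiallyI)
    then show ?thesis unfolding C_def mem_Collect_eq by (rule tendsto_eventually)
  qed
  have space_in: "ind_L1 (space Delta_prob) \<in> C"
    using gen[OF space_in_prod_algebra[of UNIV ?M]] by (simp add: space)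
  have "ind_L1 A \<in> C" if "A \<in> sets Delta_prob" for A
    using Int_stable_prod_algebra prod_algebra_sets_into_space that[unfolded sets]
  proof (induct rule: sigma_sets_induct_disjoint)
    case (basic A)
    then show ?case by (rule gen)
  next
    case empty
    have "ind_L1 {} = 0" by (simp add: ind_L1_def zero_L1_Delta_def indicator_def[abs_def])
    then show ?case using subspace_0[OF sub] by simp
  next
    case (compl A)
    then have A: "A \<in> sets Delta_prob" by (simp add: sets)
    have "ind_L1 (space Delta_prob - A) = ind_L1 (space Delta_prob) - ind_L1 A"
      unfolding ind_L1_def using A sets.sets_into_space[OF A]
      by (subst diff_abs_L1_Delta) (auto intro!: arg_cong[of _ _ abs_L1_Delta] simp: fun_eq_iff indicator_def)
    then show ?case using subspace_diff[OF sub space_in compl(2)] by (simp add: space)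
  next
    case (union A)
    have A: "A i \<in> sets Delta_prob" for i using union(2) by (auto simp: sets)
    have fin: "ind_L1 (\<Union>i<k. A i) \<in> C" for k
    proof (induction k)
      case 0
      have "ind_L1 {} = 0" by (simp add: ind_L1_def zero_L1_Delta_def indicator_def[abs_def])
      then show ?case using subspace_0[OF sub] by simp
    next
      case (Suc k)
      have "ind_L1 (\<Union>i<Suc k. A i) = ind_L1 (\<Union>i<k. A i) + ind_L1 (A k)"
      proof -
        have "x \<notin> A k" if "i < k" "x \<in> A i" for i x
          using disjoint_family_onD[OF union(1), of i k] that by auto
        then have "indicator (\<Union>i<Suc k. A i) x = indicator (\<Union>i<k. A i) x + (indicator (A k) x :: real)" for x
          by (auto simp: indicator_def less_Suc_eq)
        then show ?thesis
          unfolding ind_L1_def using A by (subst add_abs_L1_Delta) (auto intro!: arg_cong[of _ _ abs_L1_Delta])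
      qed
      then show ?case using subspace_add[OF sub Suc union(3)] by simp
    qed
    have "(\<lambda>k. ind_L1 (\<Union>i<k. A i)) \<longlonglongrightarrow> ind_L1 (\<Union>i. A i)"
      unfolding ind_L1_def
    proof (rule tendsto_abs_L1_Delta[where w="\<lambda>_. 1"])
      show "AE x in Delta_prob. (\<lambda>k. indicator (\<Union>i<k. A i) x :: real) \<longlonglongrightarrow> indicator (\<Union>i. A i) x"
        by (rule AE_I2) (rule LIMSEQ_indicator_UN)
      show "AE x in Delta_prob. \<bar>indicator (\<Union>i<k. A i) x :: real\<bar> \<le> 1" for k
        by (auto simp: indicator_def)
    qed (use A in auto)
    then show ?case by (rule closed_sequentially[OF \<open>closed C\<close> fin])
  qed
  then have "f \<in> C" by (rule L1_Delta_in_closed_subspace[OF sub \<open>closed C\<close>])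
  then show ?thesis by (simp add: C_def)
qed


section \<open>Riesz products\<close>

text \<open>The complex factors have modulus \<open>sqrt (1 + (t j)\<^sup>2)\<close> on \<open>\<Delta>\<close>, so the product is bounded in terms of
the \<open>\<ell>\<^sup>2\<close>-norm of \<open>t\<close> alone, whereas its first-order part is \<open>\<i>\<close> times the sum of the
\<open>t j * x j\<close>.\<close>

definition riesz :: "nat set \<Rightarrow> (nat \<Rightarrow> real) \<Rightarrow> (nat \<Rightarrow> real) \<Rightarrow> real" where
  "riesz B t x = Im (\<Prod>j\<in>B. 1 + \<i> * complex_of_real (t j * x j))"

lemma cmod_one_plus_i_le: "cmod (1 + \<i> * complex_of_real s) \<le> exp (s\<^sup>2 / 2)"
proof (rule power2_le_imp_le)
  have "(cmod (1 + \<i> * complex_of_real s))\<^sup>2 = 1 + s\<^sup>2" by (simp add: cmod_power2)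
  also have "\<dots> \<le> exp (s\<^sup>2)" by (rule exp_ge_add_one_self)
  also have "\<dots> = (exp (s\<^sup>2 / 2))\<^sup>2" by (simp add: exp_double[symmetric])
  finally show "(cmod (1 + \<i> * complex_of_real s))\<^sup>2 \<le> (exp (s\<^sup>2 / 2))\<^sup>2" .
qed simp

lemma abs_riesz_le:
  assumes "finite B" and t: "(\<Sum>j\<in>B. (t j)\<^sup>2) \<le> 1" and x: "\<And>j. j \<in> B \<Longrightarrow> \<bar>x j\<bar> = 1"
  shows "\<bar>riesz B t x\<bar> \<le> 2"
proof -
  have "\<bar>riesz B t x\<bar> \<le> cmod (\<Prod>j\<in>B. 1 + \<i> * complex_of_real (t j * x j))"
    unfolding riesz_def by (rule abs_Im_le_cmod)
  also have "\<dots> = (\<Prod>j\<in>B. cmod (1 + \<i> * complex_of_real (t j * x j)))"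
    by (rule prod_norm[symmetric])
  also have "\<dots> \<le> (\<Prod>j\<in>B. exp ((t j * x j)\<^sup>2 / 2))"
    by (intro prod_mono conjI cmod_one_plus_i_le norm_ge_zero)
  also have "\<dots> = exp (\<Sum>j\<in>B. (t j * x j)\<^sup>2 / 2)"
    by (rule exp_sum[OF assms(1), symmetric])
  also have "(\<Sum>j\<in>B. (t j * x j)\<^sup>2 / 2) = (\<Sum>j\<in>B. (t j)\<^sup>2 / 2)"
  proof (rule sum.cong[OF refl])
    fix j assume "j \<in> B"
    then have "(x j)\<^sup>2 = 1" using x[of j] by (metis one_power2 power2_abs)
    then show "(t j * x j)\<^sup>2 / 2 = (t j)\<^sup>2 / 2" by (simp add: power_mult_distrib)
  qed
  also have "exp (\<Sum>j\<in>B. (t j)\<^sup>2 / 2) \<le> exp (1/2)"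
    using t by (simp add: sum_divide_distrib[symmetric])
  also have "\<dots> \<le> 2" by (rule exp_half_le2)
  finally show ?thesis .
qed

text \<open>Summing over all words turns the product into a product of sums over \<open>{-1, 1}\<close>. The factor of an index
\<open>j \<noteq> k\<close> is \<open>2\<close>, whether or not \<open>j\<close> belongs to \<open>B\<close>.\<close>

lemma sum_words_riesz:
  assumes B: "B \<subseteq> {..<m}" and k: "k < m"
  shows "(\<Sum>w\<in>words m. w k * riesz B t w) = (if k \<in> B then 2 ^ m * t k else 0)"
proof -
  define f where "f j s = (if j = k then complex_of_real s else 1) *
    (if j \<in> B then 1 + \<i> * complex_of_real (t j * s) else 1)" for j s
  have pr: "(\<Prod>j\<in>{..<m}. f j (w j))
      = complex_of_real (w k) * (\<Prod>j\<in>B. 1 + \<i> * complex_of_real (t j * w j))" for w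
  proof -
    have "(\<Prod>j\<in>{..<m}. if j = k then complex_of_real (w j) else 1) = complex_of_real (w k)"
      using k by simp
    moreover have "(\<Prod>j\<in>{..<m}. if j \<in> B then 1 + \<i> * complex_of_real (t j * w j) else 1)
        = (\<Prod>j\<in>B. 1 + \<i> * complex_of_real (t j * w j))"
      using B by (simp add: prod.If_cases Int_absorb1)
    ultimately show ?thesis by (simp only: f_def prod.distrib)
  qed
  have s: "(\<Sum>s\<in>{-1, 1}. f j s) = (if j = k then (if k \<in> B then 2 * \<i> * t k else 0) else 2)" for j
    by (auto simp: f_def)
  have "(\<Sum>w\<in>words m. w k * riesz B t w) = Im (\<Sum>w\<in>words m. \<Prod>j\<in>{..<m}. f j (w j))"
    by (simp add: pr riesz_def)
  also have "(\<Sum>w\<in>words m. \<Prod>j\<in>{..<m}. f j (w j)) = (\<Prod>j\<in>{..<m}. \<Sum>s\<in>{-1, 1}. f j s)"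
    unfolding words_def by (rule prod_sum_PiE[symmetric]) auto
  also have "\<dots> = (\<Prod>j\<in>insert k ({..<m} - {k}). if j = k then (if k \<in> B then 2 * \<i> * t k else 0) else 2)"
    using k by (intro prod.cong) (auto simp: s)
  also have "\<dots> = (if k \<in> B then 2 * \<i> * t k else 0) * (\<Prod>j\<in>{..<m} - {k}. 2)"
    by (subst prod.insert) (auto intro!: prod.cong)
  also have "\<dots> = (if k \<in> B then 2 * \<i> * t k else 0) * 2 ^ (m - 1)"
    using k by simp
  also have "Im \<dots> = (if k \<in> B then 2 * 2 ^ (m - 1) * t k else 0)"
    by simp
  also have "2 * 2 ^ (m - 1) = (2 ^ m :: real)" using k by (cases m) auto
  finally show ?thesis .
qed

text \<open>The Riesz product of the normalised sequence, scaled back. It depends measurably on \<open>a\<close> and has the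
Rademacher coefficients \<open>a\<close> on \<open>B\<close>, and its supremum norm is at most twice the \<open>\<ell>\<^sup>2\<close>-norm of \<open>a\<close>.
For \<open>a = 0\<close> on \<open>B\<close> the first factor is \<open>0\<close>, whatever the quotients by \<open>0\<close> are.\<close>

definition riesz_kernel :: "nat set \<Rightarrow> (nat \<Rightarrow> real) \<Rightarrow> (nat \<Rightarrow> real) \<Rightarrow> real" where
  "riesz_kernel B a x = sqrt (\<Sum>j\<in>B. (a j)\<^sup>2) * riesz B (\<lambda>j. a j / sqrt (\<Sum>j\<in>B. (a j)\<^sup>2)) x"

lemma abs_riesz_kernel_le:
  assumes "finite B" and x: "\<And>j. j \<in> B \<Longrightarrow> \<bar>x j\<bar> = 1"
  shows "\<bar>riesz_kernel B a x\<bar> \<le> 2 * sqrt (\<Sum>j\<in>B. (a j)\<^sup>2)"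
proof -
  define s where "s = sqrt (\<Sum>j\<in>B. (a j)\<^sup>2)"
  have s0: "0 \<le> s" by (simp add: s_def sum_nonneg)
  have "(\<Sum>j\<in>B. (a j / s)\<^sup>2) = (\<Sum>j\<in>B. (a j)\<^sup>2) / s\<^sup>2"
    by (simp add: power_divide sum_divide_distrib)
  also have "s\<^sup>2 = (\<Sum>j\<in>B. (a j)\<^sup>2)" by (simp add: s_def sum_nonneg)
  also have "(\<Sum>j\<in>B. (a j)\<^sup>2) / (\<Sum>j\<in>B. (a j)\<^sup>2) \<le> 1" by (simp add: divide_le_eq_1)
  finally have "\<bar>riesz B (\<lambda>j. a j / s) x\<bar> \<le> 2" by (rule abs_riesz_le[OF assms(1) _ x])
  then have "s * \<bar>riesz B (\<lambda>j. a j / s) x\<bar> \<le> s * 2" by (rule mult_left_mono[OF _ s0])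
  then show ?thesis using s0 by (simp add: riesz_kernel_def s_def[symmetric] abs_mult)
qed

lemma sum_words_riesz_kernel:
  assumes B: "B \<subseteq> {..<m}" and k: "k < m"
  shows "(\<Sum>w\<in>words m. w k * riesz_kernel B a w) = (if k \<in> B then 2 ^ m * a k else 0)"
proof -
  define s where "s = sqrt (\<Sum>j\<in>B. (a j)\<^sup>2)"
  have fin: "finite B" using B finite_subset by blast
  have "s = 0 \<Longrightarrow> k \<in> B \<Longrightarrow> a k = 0"
    using fin by (simp add: s_def sum_nonneg_eq_0_iff)
  moreover have "(\<Sum>w\<in>words m. w k * riesz_kernel B a w)
      = s * (\<Sum>w\<in>words m. w k * riesz B (\<lambda>j. a j / s) w)"
    by (simp add: riesz_kernel_def s_def[symmetric] sum_distrib_left mult.left_commute)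
  ultimately show ?thesis
    by (auto simp: sum_words_riesz[OF B k])
qed

lemma borel_measurable_riesz_kernel:
  assumes "\<And>j. j \<in> B \<Longrightarrow> v j \<in> borel_measurable M"
  shows "(\<lambda>y. riesz_kernel B (\<lambda>j. v j y) x) \<in> borel_measurable M"
proof -
  define S where "S y = sqrt (\<Sum>j\<in>B. (v j y)\<^sup>2)" for y
  have S: "S \<in> borel_measurable M"
  proof -
    have [measurable]: "(\<lambda>y. \<Sum>j\<in>B. (v j y)\<^sup>2) \<in> borel_measurable M"
      using assms by (intro borel_measurable_sum borel_measurable_power)
    show ?thesis unfolding S_def by measurable
  qed
  have "(\<lambda>y. \<Prod>j\<in>B. 1 + \<i> * complex_of_real (v j y / S y * x j)) \<in> borel_measurable M"
    using assms S
    by (intro borel_measurable_prod borel_measurable_add borel_measurable_times borel_measurable_const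
        borel_measurable_of_real borel_measurable_divide) auto
  then have "(\<lambda>y. Im (\<Prod>j\<in>B. 1 + \<i> * complex_of_real (v j y / S y * x j))) \<in> borel_measurable M"
    by (rule borel_measurable_continuous_on[OF continuous_on_Im[OF continuous_on_id], rotated])
  with S show ?thesis
    unfolding riesz_kernel_def riesz_def S_def[symmetric] by (intro borel_measurable_times)
qed

section \<open>Bessel's inequality for the Rademacher functions\<close>

lemma Linf_mult: "Linf A f \<Longrightarrow> Linf B g \<Longrightarrow> Linf (A * B) (\<lambda>x. f x * g x)"
  unfolding Linf_def by (auto simp: abs_mult intro!: mult_mono' )

lemma Linf_rademacher: "Linf 1 (rademacher j)"
proof -
  have "\<bar>rademacher j x\<bar> \<le> 1" if "x \<in> space Delta_prob" for x
  proof -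
    have "x j = -1 \<or> x j = 1" using that by (auto simp: space_Delta_prob)
    then show ?thesis by (auto simp: rademacher_def)
  qed
  then show ?thesis by (simp add: Linf_def)
qed

text \<open>For \<open>i < j\<close> the function \<open>r\<^sub>i\<close> is constant on the cylinder sets of length \<open>j\<close>, and \<open>r\<^sub>j\<close> has mean
zero on each of them.\<close>

lemma integral_rademacher_mult:
  "(\<integral>x. rademacher i x * rademacher j x \<partial>Delta_prob) = (if i = j then 1 else 0)"
proof -
  have less: "(\<integral>x. rademacher i x * rademacher j x \<partial>Delta_prob) = 0" if ij: "i < j" for i j
  proof -
    have "(\<integral>x. (rademacher i x * rademacher j x) * indicator (cyl j w) x \<partial>Delta_prob) = 0"
      if w: "w \<in> words j" for w
    proof -
      have "(\<integral>x. (rademacher i x * rademacher j x) * indicator (cyl j w) x \<partial>Delta_prob)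
          = (\<integral>x. w i * (rademacher j x * indicator (cyl j w) x) \<partial>Delta_prob)"
        using ij by (intro Bochner_Integration.integral_cong refl)
          (auto simp: indicator_def cyl_def rademacher_def)
      then show ?thesis using integral_rademacher_cyl[OF w, of j] by simp
    qed
    then show ?thesis
      using integral_split_cyl[of "\<lambda>x. rademacher i x * rademacher j x" j]
        Linf_integrable[OF Linf_mult[OF Linf_rademacher Linf_rademacher]] by simp
  qed
  consider "i < j" | "j < i" | "i = j" by linarith
  then show ?thesis
  proof cases
    case 3
    have "(\<integral>x. rademacher i x * rademacher j x \<partial>Delta_prob) = (\<integral>x. 1 \<partial>Delta_prob)"
    proof (rule Bochner_Integration.integral_cong[OF refl])
      fix x assume "x \<in> space Delta_prob"
      then have "x i = -1 \<or> x i = 1" by (auto simp: space_Delta_prob)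
      then show "rademacher i x * rademacher j x = 1" using 3 by (auto simp: rademacher_def)
    qed
    then show ?thesis using 3 by (simp add: Delta.prob_space)
  qed (use less[of i j] less[of j i] in \<open>simp_all add: mult.commute\<close>)
qed

lemma integral_rademacher_sum_square:
  "(\<integral>x. (\<Sum>j<m. a j * rademacher j x)\<^sup>2 \<partial>Delta_prob) = (\<Sum>j<m. (a j)\<^sup>2)"
proof -
  have int: "integrable Delta_prob (\<lambda>x. rademacher i x * rademacher j x)" for i j
    by (rule Linf_integrable[OF Linf_mult[OF Linf_rademacher Linf_rademacher]])
  have "(\<integral>x. (\<Sum>j<m. a j * rademacher j x)\<^sup>2 \<partial>Delta_prob)
      = (\<integral>x. (\<Sum>i<m. \<Sum>j<m. a i * a j * (rademacher i x * rademacher j x)) \<partial>Delta_prob)"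
    by (intro Bochner_Integration.integral_cong refl) (simp add: power2_eq_square sum_product algebra_simps)
  also have "\<dots> = (\<Sum>i<m. \<Sum>j<m. a i * a j * (\<integral>x. rademacher i x * rademacher j x \<partial>Delta_prob))"
    by (simp add: Bochner_Integration.integral_sum int)
  also have "\<dots> = (\<Sum>i<m. (a i)\<^sup>2)"
    by (simp add: integral_rademacher_mult power2_eq_square if_distrib cong: if_cong)
  finally show ?thesis .
qed

lemma integral_square_le:
  assumes g: "Linf M g"
  shows "(\<integral>x. \<bar>g x\<bar> \<partial>Delta_prob) \<le> sqrt (\<integral>x. (g x)\<^sup>2 \<partial>Delta_prob)"
proof (rule real_le_rsqrt)
  define c where "c = (\<integral>x. \<bar>g x\<bar> \<partial>Delta_prob)"
  have i: "integrable Delta_prob (\<lambda>x. \<bar>g x\<bar>)" "integrable Delta_prob (\<lambda>x. (g x)\<^sup>2)"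
    using Linf_integrable[OF g] Linf_integrable[OF Linf_mult[OF g g]] by (auto simp: power2_eq_square)
  have "0 \<le> (\<integral>x. (\<bar>g x\<bar> - c)\<^sup>2 \<partial>Delta_prob)" by (rule integral_nonneg_AE) simp
  also have "\<dots> = (\<integral>x. (g x)\<^sup>2 - 2 * c * \<bar>g x\<bar> + c\<^sup>2 \<partial>Delta_prob)"
    by (intro Bochner_Integration.integral_cong refl) (simp add: power2_diff algebra_simps)
  also have "\<dots> = (\<integral>x. (g x)\<^sup>2 \<partial>Delta_prob) - 2 * c * c + c\<^sup>2"
    using i by (simp add: c_def Delta.prob_space)
  finally show "(\<integral>x. \<bar>g x\<bar> \<partial>Delta_prob)\<^sup>2 \<le> (\<integral>x. (g x)\<^sup>2 \<partial>Delta_prob)"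
    by (simp add: c_def[symmetric] power2_eq_square)
qed

lemma Linf_rademacher_sum: "Linf (\<Sum>j<m. \<bar>a j\<bar>) (\<lambda>x. \<Sum>j<m. a j * rademacher j x)"
  using Linf_sum[of "{..<m}" 1 rademacher a] Linf_rademacher by simp

lemma rademacher_L1_sum:
  "(\<Sum>j<m. a j *\<^sub>R rademacher_L1 j) = abs_L1_Delta (\<lambda>x. \<Sum>j<m. a j * rademacher j x)"
  unfolding rademacher_L1_def by (rule abs_L1_Delta_sum) (auto simp: integrable_rademacher)

lemma norm_rademacher_sum_le:
  "norm (\<Sum>j<m. a j *\<^sub>R rademacher_L1 j) \<le> sqrt (\<Sum>j<m. (a j)\<^sup>2)"
  using integral_square_le[OF Linf_rademacher_sum[where m=m and a=a]]
  by (simp only: rademacher_L1_sum norm_abs_L1_Delta[OF Linf_integrable[OF Linf_rademacher_sum]]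
      integral_rademacher_sum_square)

lemma bessel_rademacher:
  assumes g: "Linf M g"
  shows "(\<Sum>j<m. (\<integral>x. rademacher j x * g x \<partial>Delta_prob)\<^sup>2) \<le> (\<integral>x. (g x)\<^sup>2 \<partial>Delta_prob)"
proof -
  define a where "a j = (\<integral>x. rademacher j x * g x \<partial>Delta_prob)" for j
  define s where "s x = (\<Sum>j<m. a j * rademacher j x)" for x
  have s: "Linf (\<Sum>j<m. \<bar>a j\<bar>) s" unfolding s_def by (rule Linf_rademacher_sum)
  have i: "integrable Delta_prob (\<lambda>x. (g x)\<^sup>2)" "integrable Delta_prob (\<lambda>x. (s x)\<^sup>2)"
    "integrable Delta_prob (\<lambda>x. s x * g x)" "integrable Delta_prob (\<lambda>x. rademacher j x * g x)" for j
    using Linf_integrable[OF Linf_mult[OF g g]] Linf_integrable[OF Linf_mult[OF s s]]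
      Linf_integrable[OF Linf_mult[OF s g]] Linf_integrable[OF Linf_mult[OF Linf_rademacher g]]
    by (auto simp: power2_eq_square)
  have sg: "(\<integral>x. s x * g x \<partial>Delta_prob) = (\<Sum>j<m. (a j)\<^sup>2)"
  proof -
    have "(\<integral>x. s x * g x \<partial>Delta_prob) = (\<integral>x. (\<Sum>j<m. a j * (rademacher j x * g x)) \<partial>Delta_prob)"
      by (intro Bochner_Integration.integral_cong refl) (simp add: s_def sum_distrib_right mult.assoc)
    also have "\<dots> = (\<Sum>j<m. a j * a j)"
      unfolding a_def using i(4) by (subst Bochner_Integration.integral_sum) auto
    finally show ?thesis by (simp add: power2_eq_square)
  qed
  have "0 \<le> (\<integral>x. (g x - s x)\<^sup>2 \<partial>Delta_prob)" by (rule integral_nonneg_AE) simp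
  also have "\<dots> = (\<integral>x. (g x)\<^sup>2 - 2 * (s x * g x) + (s x)\<^sup>2 \<partial>Delta_prob)"
    by (intro Bochner_Integration.integral_cong refl) (simp add: power2_diff algebra_simps)
  also have "\<dots> = (\<integral>x. (g x)\<^sup>2 \<partial>Delta_prob) - 2 * (\<Sum>j<m. (a j)\<^sup>2) + (\<Sum>j<m. (a j)\<^sup>2)"
    using i integral_rademacher_sum_square[of a m] by (simp add: sg s_def[symmetric])
  finally show ?thesis by (simp add: a_def)
qed

lemma abs_L1_Delta_eq_AE:
  assumes f: "integrable Delta_prob f" and g: "integrable Delta_prob g" and eq: "abs_L1_Delta f = abs_L1_Delta g"
  shows "AE x in Delta_prob. f x = g x"
  using AE_rep_abs_L1_Delta[OF f] AE_rep_abs_L1_Delta[OF g] unfolding eq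
  by eventually_elim simp

lemma AE_bounded_imp_Linf_ball:
  assumes h: "h \<in> borel_measurable Delta_prob" and M: "0 \<le> M" and b: "AE x in Delta_prob. \<bar>h x\<bar> \<le> M"
  shows "integrable Delta_prob h" "abs_L1_Delta h \<in> Linf_ball M"
proof -
  show i: "integrable Delta_prob h"
    by (rule Delta.integrable_const_bound[of _ M]) (use h b in auto)
  define k where "k x = max (- M) (min M (h x))" for x
  have k: "Linf M k" unfolding Linf_def k_def using h M by auto
  have "AE x in Delta_prob. h x = k x"
    using b by eventually_elim (auto simp: k_def)
  then have "abs_L1_Delta h = abs_L1_Delta k"
    by (rule abs_L1_Delta_cong_AE[OF i LinfD(1)[OF k]])
  with k show "abs_L1_Delta h \<in> Linf_ball M" by (auto simp: Linf_ball_def)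
qed

text \<open>The inequality for integer coefficients extends by homogeneity to rational and by continuity to real
coefficients; then \<open>b\<close> itself is taken as the vector of coefficients.\<close>

lemma bessel_limit:
  fixes b :: "nat \<Rightarrow> real"
  assumes M: "0 \<le> M"
    and le: "\<And>l :: int list. \<bar>\<Sum>j<m. real_of_int (l ! j) * b j\<bar> \<le> M * sqrt (\<Sum>j<m. (real_of_int (l ! j))\<^sup>2)"
  shows "(\<Sum>j<m. (b j)\<^sup>2) \<le> M\<^sup>2"
proof -
  define a where "a k j = real_of_int \<lfloor>real (Suc k) * b j\<rfloor> / real (Suc k)" for k j
  have lim: "(\<lambda>k. a k j) \<longlonglongrightarrow> b j" for j
  proof -
    have "(\<lambda>k. a k j - b j) \<longlonglongrightarrow> 0"
    proof (rule Lim_null_comparison[OF _ LIMSEQ_inverse_real_of_nat])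
      have "norm (a k j - b j) \<le> inverse (real (Suc k))" for k
      proof -
        have "a k j - b j = (real_of_int \<lfloor>real (Suc k) * b j\<rfloor> - real (Suc k) * b j) / real (Suc k)"
          by (simp add: a_def field_simps)
        moreover have "\<bar>real_of_int \<lfloor>real (Suc k) * b j\<rfloor> - real (Suc k) * b j\<bar> \<le> 1" by linarith
        ultimately show ?thesis
          by (simp only: real_norm_def abs_divide) (simp add: inverse_eq_divide divide_right_mono)
      qed
      then show "eventually (\<lambda>k. norm (a k j - b j) \<le> inverse (real (Suc k))) sequentially" by simp
    qed
    then show ?thesis by (rule LIM_zero_cancel)
  qed
  have *: "(\<Sum>j<m. a k j * b j) \<le> M * sqrt (\<Sum>j<m. (a k j)\<^sup>2)" for k
  proof -
    define l where "l = map (\<lambda>j. \<lfloor>real (Suc k) * b j\<rfloor>) [0..<m]"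
    have l: "real_of_int (l ! j) = real (Suc k) * a k j" if "j < m" for j
      using that by (simp add: l_def a_def)
    have "\<bar>\<Sum>j<m. real (Suc k) * (a k j * b j)\<bar> \<le> M * sqrt (\<Sum>j<m. (real (Suc k))\<^sup>2 * (a k j)\<^sup>2)"
      using le[of l] by (simp add: l power_mult_distrib mult.assoc del: of_nat_Suc)
    also have "(\<Sum>j<m. (real (Suc k))\<^sup>2 * (a k j)\<^sup>2) = (real (Suc k))\<^sup>2 * (\<Sum>j<m. (a k j)\<^sup>2)"
      by (rule sum_distrib_left[symmetric])
    also have "sqrt \<dots> = real (Suc k) * sqrt (\<Sum>j<m. (a k j)\<^sup>2)"
      by (simp only: real_sqrt_mult real_sqrt_abs abs_of_nat)
    finally have "\<bar>real (Suc k) * (\<Sum>j<m. a k j * b j)\<bar> \<le> M * (real (Suc k) * sqrt (\<Sum>j<m. (a k j)\<^sup>2))"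
      unfolding sum_distrib_left .
    then have "real (Suc k) * (\<Sum>j<m. a k j * b j) \<le> real (Suc k) * (M * sqrt (\<Sum>j<m. (a k j)\<^sup>2))"
      by (simp only: mult.left_commute[of M])
    then show ?thesis by (simp only: mult_le_cancel_left_pos of_nat_0_less_iff zero_less_Suc)
  qed
  define S where "S = (\<Sum>j<m. (b j)\<^sup>2)"
  have S0: "0 \<le> S" unfolding S_def by (intro sum_nonneg) simp
  have "(\<Sum>j<m. b j * b j) \<le> M * sqrt (\<Sum>j<m. (b j)\<^sup>2)"
  proof (rule LIMSEQ_le)
    show "(\<lambda>k. \<Sum>j<m. a k j * b j) \<longlonglongrightarrow> (\<Sum>j<m. b j * b j)"
      by (intro tendsto_intros lim)
    show "(\<lambda>k. M * sqrt (\<Sum>j<m. (a k j)\<^sup>2)) \<longlonglongrightarrow> M * sqrt (\<Sum>j<m. (b j)\<^sup>2)"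
      by (intro tendsto_intros lim)
  qed (use * in blast)
  then have S: "S \<le> M * sqrt S" by (simp add: S_def power2_eq_square)
  have "sqrt S \<le> M"
  proof (cases "S = 0")
    case False
    then have "0 < sqrt S" using S0 by simp
    moreover have "sqrt S * sqrt S \<le> M * sqrt S" using S S0 by simp
    ultimately show ?thesis by (rule mult_right_le_imp_le[rotated])
  qed (use M in simp)
  then show ?thesis unfolding S_def[symmetric] using S0 M by (simp add: real_sqrt_le_iff' sqrt_le_D)
qed

text \<open>For fixed coefficients the image of a Rademacher sum is bounded by \<open>M\<close> times the \<open>\<ell>\<^sup>2\<close>-norm of the
coefficients, almost everywhere. Integer coefficients are used because countably many exceptional null
sets can be discarded at once.\<close>

lemma bessel_Linf_valued:
  assumes V: "Linf_valued M V" and M: "0 \<le> M"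
    and v: "\<And>j. integrable Delta_prob (v j)" "\<And>j. V (rademacher_L1 j) = abs_L1_Delta (v j)"
  shows "AE y in Delta_prob. (\<Sum>j<m. (v j y)\<^sup>2) \<le> M\<^sup>2"
proof -
  have "AE y in Delta_prob. \<bar>\<Sum>j<m. real_of_int (l ! j) * v j y\<bar>
      \<le> M * sqrt (\<Sum>j<m. (real_of_int (l ! j))\<^sup>2)" for l :: "int list"
  proof -
    let ?f = "\<Sum>j<m. real_of_int (l ! j) *\<^sub>R rademacher_L1 j"
    obtain h where h: "Linf (M * norm ?f) h" "V ?f = abs_L1_Delta h"
      using V by (auto simp: Linf_valued_def Linf_ball_def)
    have "V ?f = (\<Sum>j<m. real_of_int (l ! j) *\<^sub>R abs_L1_Delta (v j))"
      by (simp add: blinfun.sum_right blinfun.scaleR_right v(2))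
    also have "\<dots> = abs_L1_Delta (\<lambda>y. \<Sum>j<m. real_of_int (l ! j) * v j y)"
      by (rule abs_L1_Delta_sum) (auto simp: v(1))
    finally have "AE y in Delta_prob. (\<Sum>j<m. real_of_int (l ! j) * v j y) = h y"
      by (intro abs_L1_Delta_eq_AE Linf_integrable[OF h(1)] Bochner_Integration.integrable_sum
          integrable_mult_right v(1)) (simp add: h(2))
    then show ?thesis
      using AE_space
    proof eventually_elim
      fix y assume y: "(\<Sum>j<m. real_of_int (l ! j) * v j y) = h y" "y \<in> space Delta_prob"
      have "\<bar>h y\<bar> \<le> M * norm ?f" by (rule LinfD(2)[OF h(1) y(2)])
      also have "\<dots> \<le> M * sqrt (\<Sum>j<m. (real_of_int (l ! j))\<^sup>2)"
        by (intro mult_left_mono norm_rademacher_sum_le M)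
      finally show "\<bar>\<Sum>j<m. real_of_int (l ! j) * v j y\<bar>
          \<le> M * sqrt (\<Sum>j<m. (real_of_int (l ! j))\<^sup>2)" unfolding y(1) .
    qed
  qed
  then have "AE y in Delta_prob. \<forall>l :: int list. \<bar>\<Sum>j<m. real_of_int (l ! j) * v j y\<bar>
      \<le> M * sqrt (\<Sum>j<m. (real_of_int (l ! j))\<^sup>2)"
    unfolding AE_all_countable by blast
  then show ?thesis by eventually_elim (rule bessel_limit[OF M], blast)
qed

section \<open>Extending operators from the Rademacher span\<close>

lemma weak_lim_eventually_const:
  assumes "\<And>n. n \<ge> N \<Longrightarrow> x n = c"
  shows "weak_lim x c"
  by (rule weak_lim_tendsto, rule tendsto_eventually, rule eventually_sequentiallyI[of N]) (rule assms)

text \<open>The approximating operators on the first \<open>m\<close> coordinates have the kernel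
\<open>(x, y) \<mapsto> riesz_kernel {n..<m} (v y) x\<close>. Its supremum over \<open>x\<close> is at most twice the \<open>\<ell>\<^sup>2\<close>-norm of the
\<open>v j y\<close>, for each \<open>y\<close>; so the norm on \<open>L\<^sup>1(\<Delta>)\<close> is controlled by the integral of these
\<open>\<ell>\<^sup>2\<close>-norms over \<open>y\<close>, that is, by a Hilbert--Schmidt norm. By Bessel's inequality the kernels are
bounded by \<open>2 M\<close> uniformly in \<open>m\<close>, so there is a weak limit with values in \<open>L\<^sup>\<infinity>(\<Delta>)\<close>.\<close>

lemma rademacher_extension:
  assumes V: "Linf_valued M V" and M: "0 \<le> M" and \<sigma>: "0 \<le> \<sigma>"
    and v: "\<And>j. Linf M (v j)" "\<And>j. V (rademacher_L1 j) = abs_L1_Delta (v j)"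
    and sum: "\<And>m. (\<Sum>j\<in>{n..<m}. \<integral>y. (v j y)\<^sup>2 \<partial>Delta_prob) \<le> \<sigma>\<^sup>2"
  obtains D where "Linf_valued (2 * M) D" "norm D \<le> 2 * \<sigma>"
    "\<And>j. D (rademacher_L1 j) = (if n \<le> j then V (rademacher_L1 j) else 0)"
proof -
  define k where "k m w = (\<lambda>y. riesz_kernel {n..<m} (\<lambda>j. v j y) w)" for m w
  define q where "q m y = (\<Sum>j\<in>{n..<m}. (v j y)\<^sup>2)" for m y
  have q0: "0 \<le> q m y" for m y unfolding q_def by (intro sum_nonneg) simp
  have qm [measurable]: "q m \<in> borel_measurable Delta_prob" for m
    unfolding q_def using LinfD(1)[OF v(1)] by (intro borel_measurable_sum borel_measurable_power)
  have qM: "AE y in Delta_prob. q m y \<le> M\<^sup>2" for m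
    using bessel_Linf_valued[OF V M Linf_integrable[OF v(1)] v(2), of m]
  proof eventually_elim
    fix y assume "(\<Sum>j<m. (v j y)\<^sup>2) \<le> M\<^sup>2"
    moreover have "q m y \<le> (\<Sum>j<m. (v j y)\<^sup>2)"
      unfolding q_def by (intro sum_mono2) auto
    ultimately show "q m y \<le> M\<^sup>2" by simp
  qed
  have qL: "Linf (sqrt (\<Sum>j\<in>{n..<m}. M\<^sup>2)) (\<lambda>y. sqrt (q m y))" for m
    unfolding Linf_def
  proof (intro conjI ballI)
    fix y assume y: "y \<in> space Delta_prob"
    have "(v j y)\<^sup>2 \<le> M\<^sup>2" for j
      using LinfD(2)[OF v(1)[of j] y] by (rule power2_le_iff_abs_le[OF M, THEN iffD2])
    then have "q m y \<le> (\<Sum>j\<in>{n..<m}. M\<^sup>2)" unfolding q_def by (intro sum_mono)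
    then show "\<bar>sqrt (q m y)\<bar> \<le> sqrt (\<Sum>j\<in>{n..<m}. M\<^sup>2)" using q0 by (simp add: abs_of_nonneg)
  qed measurable
  have km: "k m w \<in> borel_measurable Delta_prob" for m w
    unfolding k_def by (intro borel_measurable_riesz_kernel LinfD(1)[OF v(1)])
  have kq: "\<bar>k m w y\<bar> \<le> 2 * sqrt (q m y)" if w: "w \<in> words m" for m w y
    unfolding k_def q_def
  proof (rule abs_riesz_kernel_le)
    show "\<bar>w j\<bar> = 1" if "j \<in> {n..<m}" for j using wordsD[OF w, of j] that by auto
  qed simp
  have kM: "AE y in Delta_prob. \<bar>k m w y\<bar> \<le> 2 * M" if w: "w \<in> words m" for m w
    using qM[of m]
  proof eventually_elim
    fix y assume "q m y \<le> M\<^sup>2"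
    then have "sqrt (q m y) \<le> M" using M by (simp add: real_le_lsqrt q0)
    then show "\<bar>k m w y\<bar> \<le> 2 * M" using kq[OF w, of y] by linarith
  qed
  have ki: "integrable Delta_prob (k m w)" and kb: "abs_L1_Delta (k m w) \<in> Linf_ball (2 * M)"
    if w: "w \<in> words m" for m w
    using AE_bounded_imp_Linf_ball[OF km _ kM[OF w]] M by auto
  have kn: "norm (abs_L1_Delta (k m w)) \<le> 2 * \<sigma>" if w: "w \<in> words m" for m w
  proof -
    have vi: "integrable Delta_prob (\<lambda>y. (v j y)\<^sup>2)" for j
      using Linf_integrable[OF Linf_mult[OF v(1) v(1)]] by (simp add: power2_eq_square)
    have "norm (abs_L1_Delta (k m w)) = (\<integral>y. \<bar>k m w y\<bar> \<partial>Delta_prob)"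
      by (rule norm_abs_L1_Delta[OF ki[OF w]])
    also have "\<dots> \<le> (\<integral>y. 2 * \<bar>sqrt (q m y)\<bar> \<partial>Delta_prob)"
      using ki[OF w] Linf_integrable[OF qL] kq[OF w] q0 by (intro integral_mono) auto
    also have "\<dots> = 2 * (\<integral>y. \<bar>sqrt (q m y)\<bar> \<partial>Delta_prob)" by simp
    also have "\<dots> \<le> 2 * sqrt (\<integral>y. (sqrt (q m y))\<^sup>2 \<partial>Delta_prob)"
      using integral_square_le[OF qL[of m]] by simp
    also have "(\<integral>y. (sqrt (q m y))\<^sup>2 \<partial>Delta_prob) = (\<Sum>j\<in>{n..<m}. \<integral>y. (v j y)\<^sup>2 \<partial>Delta_prob)"
      using q0 vi by (simp add: q_def Bochner_Integration.integral_sum sum_nonneg)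
    also have "sqrt \<dots> \<le> \<sigma>" by (rule real_le_lsqrt[OF \<sigma> sum])
    finally show ?thesis by simp
  qed
  define Dm where "Dm m = cyl_op m (\<lambda>w. abs_L1_Delta (k m w))" for m
  have "Linf_valued (2 * M) (Dm m)" for m
    unfolding Dm_def using kb M by (intro Linf_valued_cyl_op) auto
  then obtain D where D: "Linf_valued (2 * M) D" "\<And>f. weak_lim (\<lambda>m. Dm m f) (D f)"
    using Linf_valued_weak_lim by blast
  show ?thesis
  proof (rule that[OF D(1)])
    have Dn: "norm (Dm m) \<le> 2 * \<sigma>" for m
      unfolding Dm_def using kn \<sigma> by (intro norm_cyl_op_le) auto
    show "norm D \<le> 2 * \<sigma>"
    proof (rule norm_blinfun_bound)
      fix f
      have "norm (Dm m f) \<le> 2 * \<sigma> * norm f" for m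
        using norm_blinfun[of "Dm m" f] mult_right_mono[OF Dn[of m] norm_ge_zero[of f]] by linarith
      then show "norm (D f) \<le> 2 * \<sigma> * norm f" by (rule weak_lim_norm_le[OF D(2)])
    qed (use \<sigma> in simp)
    fix j
    have "Dm m (rademacher_L1 j) = (if n \<le> j then V (rademacher_L1 j) else 0)" if "m \<ge> Suc j" for m
    proof -
      have jm: "j < m" using that by simp
      have "Dm m (rademacher_L1 j) = (\<Sum>w\<in>words m. ((1/2) ^ m * w j) *\<^sub>R abs_L1_Delta (k m w))"
        using jm by (simp add: Dm_def cyl_op_rademacher scaleR_sum_right)
      also have "\<dots> = abs_L1_Delta (\<lambda>y. \<Sum>w\<in>words m. ((1/2) ^ m * w j) * k m w y)"
        by (rule abs_L1_Delta_sum) (auto intro: ki)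
      also have "(\<lambda>y. \<Sum>w\<in>words m. ((1/2) ^ m * w j) * k m w y) = (\<lambda>y. if n \<le> j then v j y else 0)"
      proof
        fix y
        have "(\<Sum>w\<in>words m. ((1/2) ^ m * w j) * k m w y) = (1/2) ^ m * (\<Sum>w\<in>words m. w j * k m w y)"
          by (simp add: sum_distrib_left mult.assoc)
        also have "\<dots> = (if n \<le> j then v j y else 0)"
          unfolding k_def using jm
          by (subst sum_words_riesz_kernel) (auto simp: power_divide)
        finally show "(\<Sum>w\<in>words m. ((1/2) ^ m * w j) * k m w y) = (if n \<le> j then v j y else 0)" .
      qed
      finally show ?thesis by (simp add: v(2) zero_L1_Delta_def)
    qed
    then have "weak_lim (\<lambda>m. Dm m (rademacher_L1 j)) (if n \<le> j then V (rademacher_L1 j) else 0)"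
      by (rule weak_lim_eventually_const)
    then show "D (rademacher_L1 j) = (if n \<le> j then V (rademacher_L1 j) else 0)"
      by (rule weak_lim_unique[OF D(2)])
  qed
qed

lemma Linf_valued_rademacher_repr:
  assumes "Linf_valued M V"
  obtains v where "\<And>j. Linf M (v j)" "\<And>j. V (rademacher_L1 j) = abs_L1_Delta (v j)"
proof -
  have "\<exists>v. Linf M v \<and> V (rademacher_L1 j) = abs_L1_Delta v" for j
  proof -
    obtain h where h: "Linf (M * norm (rademacher_L1 j)) h" "V (rademacher_L1 j) = abs_L1_Delta h"
      using assms by (auto simp: Linf_valued_def Linf_ball_def)
    moreover have "norm (rademacher_L1 j) = 1"
    proof -
      have "norm (rademacher_L1 j) = (\<integral>x. \<bar>rademacher j x\<bar> \<partial>Delta_prob)"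
        unfolding rademacher_L1_def by (rule norm_abs_L1_Delta[OF integrable_rademacher])
      also have "\<dots> = (\<integral>x. 1 \<partial>Delta_prob)"
      proof (rule Bochner_Integration.integral_cong[OF refl])
        fix x assume "x \<in> space Delta_prob"
        then have "x j = -1 \<or> x j = 1" by (auto simp: space_Delta_prob)
        then show "\<bar>rademacher j x\<bar> = 1" by (auto simp: rademacher_def)
      qed
      finally show ?thesis by (simp add: Delta.prob_space)
    qed
    ultimately show ?thesis by auto
  qed
  then show ?thesis using that by metis
qed

text \<open>The squares of the \<open>L\<^sup>2\<close>-norms of the images of the Rademacher functions are summable, by Bessel's
inequality, so the extension has small norm if sufficiently many Rademacher functions are left out.\<close>

lemma rademacher_extension_small:
  assumes V: "Linf_valued M V" and M: "0 \<le> M" and e: "0 < e"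
  obtains n D where "weakly_compact_op D" "norm D \<le> e"
    "\<And>j. D (rademacher_L1 j) = (if n \<le> j then V (rademacher_L1 j) else 0)"
proof -
  obtain v where v: "\<And>j. Linf M (v j)" "\<And>j. V (rademacher_L1 j) = abs_L1_Delta (v j)"
    using Linf_valued_rademacher_repr[OF V] by blast
  define s where "s j = (\<integral>y. (v j y)\<^sup>2 \<partial>Delta_prob)" for j
  have vi: "integrable Delta_prob (\<lambda>y. (v j y)\<^sup>2)" for j
    using Linf_integrable[OF Linf_mult[OF v(1) v(1)]] by (simp add: power2_eq_square)
  have s0: "0 \<le> s j" for j unfolding s_def by (rule integral_nonneg_AE) simp
  have "(\<Sum>j<m. s j) \<le> M\<^sup>2" for m
  proof -
    have "(\<Sum>j<m. s j) = (\<integral>y. (\<Sum>j<m. (v j y)\<^sup>2) \<partial>Delta_prob)"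
      unfolding s_def using vi by (simp add: Bochner_Integration.integral_sum)
    also have "\<dots> \<le> M\<^sup>2"
      by (rule Delta.integral_le_const[OF _ bessel_Linf_valued[OF V M Linf_integrable[OF v(1)] v(2)]])
        (intro Bochner_Integration.integrable_sum vi)
    finally show ?thesis .
  qed
  then have "summable s" by (rule summableI_nonneg_bounded[OF s0])
  then obtain n where n: "\<And>m k. m \<ge> n \<Longrightarrow> norm (sum s {m..<k}) < (e/2)\<^sup>2"
    unfolding summable_Cauchy using e by (meson half_gt_zero zero_less_power)
  obtain D where D: "Linf_valued (2 * M) D" "norm D \<le> 2 * (e/2)"
    "\<And>j. D (rademacher_L1 j) = (if n \<le> j then V (rademacher_L1 j) else 0)"
    by (rule rademacher_extension[OF V M _ v, of "e/2" n])
      (use e n[of n] in \<open>auto simp: s_def less_imp_le abs_less_iff\<close>)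
  show ?thesis
    by (rule that[OF Linf_valued_imp_weakly_compact[OF D(1)] _ D(3)]) (use M D(2) in auto)
qed

text \<open>Subtracting \<open>\<psi>\<close> turns the functional given by \<open>g\<close> into one that vanishes on \<open>R\<close>, at a cost that is
small if \<open>g\<close> is small in \<open>L\<^sup>2\<close>. It is obtained from the extension of the operator \<open>f \<mapsto> (\<integral>f g) 1\<close>.\<close>

lemma rademacher_functional_correction:
  assumes g: "Linf 1 g"
  obtains \<psi> :: "L1_Delta dual" where "\<And>j. \<psi> (rademacher_L1 j) = pairing g (rademacher_L1 j)"
    "norm \<psi> \<le> 2 * sqrt (\<integral>x. (g x)\<^sup>2 \<partial>Delta_prob)"
proof -
  define V where "V = rank_one (pairing g) (abs_L1_Delta (\<lambda>_. 1))"
  have c: "c *\<^sub>R abs_L1_Delta (\<lambda>_. 1) = abs_L1_Delta (\<lambda>_. c)" for c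
    by (simp add: scaleR_abs_L1_Delta)
  have V: "Linf_valued 1 V"
    unfolding Linf_valued_def
  proof
    fix f
    have "\<bar>pairing g f\<bar> \<le> norm f"
      using norm_blinfun[of "pairing g" f] mult_right_mono[OF pairing_abs(2)[OF g integrable_rademacher] norm_ge_zero[of f]]
      by simp
    then show "V f \<in> Linf_ball (1 * norm f)"
      by (auto simp: V_def rank_one.rep_eq c Linf_ball_def Linf_def)
  qed
  define a where "a j = pairing g (rademacher_L1 j)" for j
  have a: "a j = (\<integral>x. rademacher j x * g x \<partial>Delta_prob)" for j
    unfolding a_def rademacher_L1_def by (rule pairing_abs(1)[OF g integrable_rademacher])
  have Vr: "V (rademacher_L1 j) = abs_L1_Delta (\<lambda>_. a j)" for j
    by (simp add: V_def rank_one.rep_eq c a_def)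
  have aL: "Linf 1 (\<lambda>_. a j)" for j
  proof -
    have "\<bar>a j\<bar> \<le> 1 * (\<integral>x. \<bar>rademacher j x\<bar> \<partial>Delta_prob)"
      unfolding a by (rule abs_integral_mult_Linf_le[OF g integrable_rademacher])
    also have "\<dots> \<le> 1"
      using Linf_rademacher[of j] Linf_integrable[OF Linf_rademacher]
      by (auto intro!: Delta.integral_le_const AE_I2 dest: LinfD)
    finally show ?thesis by (simp add: Linf_def)
  qed
  define \<sigma> where "\<sigma> = sqrt (\<integral>x. (g x)\<^sup>2 \<partial>Delta_prob)"
  have s0: "0 \<le> (\<integral>x. (g x)\<^sup>2 \<partial>Delta_prob)" by (rule integral_nonneg_AE) simp
  have sum: "(\<Sum>j\<in>{0..<m}. \<integral>y. (a j)\<^sup>2 \<partial>Delta_prob) \<le> \<sigma>\<^sup>2" for m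
    using bessel_rademacher[OF g, of m] s0
    by (simp add: a \<sigma>_def Delta.prob_space atLeast0LessThan)
  have \<sigma>0: "0 \<le> \<sigma>" by (simp add: \<sigma>_def s0)
  obtain D :: "L1_Delta \<Rightarrow>\<^sub>L L1_Delta" where D: "norm D \<le> 2 * \<sigma>"
    "\<And>j. D (rademacher_L1 j) = V (rademacher_L1 j)"
  proof (rule rademacher_extension[OF V zero_le_one \<sigma>0 aL Vr sum])
    fix D :: "L1_Delta \<Rightarrow>\<^sub>L L1_Delta"
    assume "norm D \<le> 2 * \<sigma>"
      "\<And>j. D (rademacher_L1 j) = (if 0 \<le> j then V (rademacher_L1 j) else 0)"
    then show thesis by (intro that[of D]) simp_all
  qed
  have one: "Linf 1 (\<lambda>_. 1)" by (simp add: Linf_def)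
  show ?thesis
  proof (rule that[of "pairing (\<lambda>_. 1) o\<^sub>L D"])
    fix j
    show "(pairing (\<lambda>_. 1) o\<^sub>L D) (rademacher_L1 j) = pairing g (rademacher_L1 j)"
      using pairing_abs(1)[OF one, of "\<lambda>_. a j"] by (simp add: D(2) Vr Delta.prob_space) (simp add: a_def)
  next
    have "norm (pairing (\<lambda>_. 1) o\<^sub>L D) \<le> norm (pairing (\<lambda>_. 1)) * norm D" by (rule norm_blinfun_compose)
    also have "\<dots> \<le> 1 * (2 * \<sigma>)"
      using pairing_abs(2)[OF one integrable_rademacher] D(1) by (intro mult_mono) auto
    finally show "norm (pairing (\<lambda>_. 1) o\<^sub>L D) \<le> 2 * sqrt (\<integral>x. (g x)\<^sup>2 \<partial>Delta_prob)"
      by (simp add: \<sigma>_def)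
  qed
qed


section \<open>The quotient map and uniform integrability of lifts\<close>

definition L1_quotient :: "L1_Delta \<Rightarrow>\<^sub>L L1_mod_R" where
  "L1_quotient = Blinfun abs_L1_mod_R"

lemma L1_quotient_apply: "blinfun_apply L1_quotient = abs_L1_mod_R"
  unfolding L1_quotient_def
proof (rule bounded_linear_Blinfun_apply, rule bounded_linear_intro[of _ 1])
  show "norm (abs_L1_mod_R f) \<le> norm f * 1" for f
    by (simp add: norm_L1_mod_R.abs_eq infdist_subspace_le_norm[OF subspace_Rademacher_span])
qed (simp_all add: plus_L1_mod_R.abs_eq scaleR_L1_mod_R.abs_eq)

lemma norm_L1_quotient_le: "norm (L1_quotient f) \<le> norm f"
  by (simp add: L1_quotient_apply norm_L1_mod_R.abs_eq infdist_subspace_le_norm[OF subspace_Rademacher_span])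

lemma L1_quotient_lift:
  assumes "e > 0"
  obtains f where "L1_quotient f = x" "norm f < norm x + e"
  using abs_L1_mod_R_repr[OF assms] unfolding L1_quotient_apply by blast

lemma norm_le_norm_compose_L1_quotient:
  fixes B :: "L1_mod_R \<Rightarrow>\<^sub>L 'b::real_normed_vector"
  assumes le: "\<And>f. norm (B (L1_quotient f)) \<le> K * norm f" and K: "0 \<le> K"
  shows "norm B \<le> K"
proof (rule norm_blinfun_bound[OF K])
  fix x
  show "norm (B x) \<le> K * norm x"
  proof (rule field_le_epsilon)
    fix e :: real assume e: "e > 0"
    then have "e / (K + 1) > 0" using K by simp
    then obtain f where f: "L1_quotient f = x" "norm f < norm x + e / (K + 1)" by (rule L1_quotient_lift)
    have "norm (B x) \<le> K * norm f" using le[of f] f(1) by simp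
    also have "\<dots> \<le> K * (norm x + e / (K + 1))" using f(2) K by (intro mult_left_mono) auto
    also have "\<dots> = K * norm x + e * (K / (K + 1))" by (simp add: algebra_simps)
    also have "e * (K / (K + 1)) \<le> e * 1" using e K by (intro mult_left_mono) auto
    finally show "norm (B x) \<le> K * norm x + e" by simp
  qed
qed

lemma descend_to_quotient:
  fixes A :: "L1_Delta \<Rightarrow>\<^sub>L 'b::real_normed_vector"
  assumes A: "\<And>j. A (rademacher_L1 j) = 0"
  obtains B :: "L1_mod_R \<Rightarrow>\<^sub>L 'b" where "\<And>f. B (L1_quotient f) = A f"
proof -
  have sub: "subspace {f. A f = 0}"
    by (rule subspaceI) (auto simp: blinfun.add_right blinfun.scaleR_right)
  have "closed {f. A f = 0}"
    by (intro closed_Collect_eq linear_continuous_on blinfun.bounded_linear_right continuous_on_const)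
  then have R: "Rademacher_span \<subseteq> {f. A f = 0}"
    unfolding Rademacher_span_def
    by (intro closure_minimal span_minimal sub) (use A in auto)
  have AQ: "A f = A g" if "L1_quotient f = L1_quotient g" for f g
  proof -
    have "f - g \<in> Rademacher_span"
      using that by (simp add: L1_quotient_apply L1_mod_R.abs_eq_iff)
    then show ?thesis using R by (auto simp: blinfun.diff_right)
  qed
  define s where "s x = (SOME f. L1_quotient f = x)" for x
  have s: "L1_quotient (s x) = x" for x
    unfolding s_def by (rule someI_ex) (use L1_quotient_lift[of 1 x] in auto)
  define b where "b x = A (s x)" for x
  have b: "b (L1_quotient f) = A f" for f
    unfolding b_def by (rule AQ) (rule s)
  have "bounded_linear b"
  proof (rule bounded_linear_intro[of _ "norm A"])
    fix x y :: L1_mod_R and c :: real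
    obtain f where f: "x = L1_quotient f" using s[of x] by metis
    obtain g where g: "y = L1_quotient g" using s[of y] by metis
    show "b (x + y) = b x + b y"
      using b[of "f + g"] by (simp add: f g b blinfun.add_right)
    show "b (c *\<^sub>R x) = c *\<^sub>R b x"
      using b[of "c *\<^sub>R f"] by (simp add: f b blinfun.scaleR_right)
    show "norm (b x) \<le> norm x * norm A"
    proof (rule field_le_epsilon)
      fix e :: real assume e: "e > 0"
      have "norm A + 1 > 0" using norm_ge_zero[of A] by linarith
      then obtain h where h: "L1_quotient h = x" "norm h < norm x + e / (norm A + 1)"
        using L1_quotient_lift[of "e / (norm A + 1)" x] e by auto
      have "norm (b x) \<le> norm A * norm h"
        using b[of h] h(1) norm_blinfun[of A h] by simp
      also have "\<dots> \<le> norm A * (norm x + e / (norm A + 1))"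
        using h(2) by (intro mult_left_mono) auto
      also have "\<dots> = norm x * norm A + e * (norm A / (norm A + 1))" by (simp add: algebra_simps)
      also have "e * (norm A / (norm A + 1)) \<le> e * 1"
        using e \<open>norm A + 1 > 0\<close> by (intro mult_left_mono) auto
      finally show "norm (b x) \<le> norm x * norm A + e" by simp
    qed
  qed
  then have "blinfun_apply (Blinfun b) = b" by (rule bounded_linear_Blinfun_apply)
  with b show ?thesis by (intro that[of "Blinfun b"]) simp
qed

abbreviation mass :: "((nat \<Rightarrow> real) \<Rightarrow> real) \<Rightarrow> (nat \<Rightarrow> real) set \<Rightarrow> real" where
  "mass h A \<equiv> \<integral>x. \<bar>h x\<bar> * indicator A x \<partial>Delta_prob"

lemma integral_absolutely_continuous:
  fixes h :: "(nat \<Rightarrow> real) \<Rightarrow> real"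
  assumes h: "integrable Delta_prob h" and e: "e > 0"
  obtains d where "d > 0"
    "\<And>B. B \<in> sets Delta_prob \<Longrightarrow> measure Delta_prob B \<le> d \<Longrightarrow> mass h B \<le> e"
proof -
  have [measurable]: "h \<in> borel_measurable Delta_prob" using h by auto
  define A where "A k = {x \<in> space Delta_prob. real k < \<bar>h x\<bar>}" for k :: nat
  have [measurable]: "A k \<in> sets Delta_prob" for k by (simp add: A_def)
  have intB: "integrable Delta_prob (\<lambda>x. \<bar>h x\<bar> * indicator B x)" if "B \<in> sets Delta_prob" for B
    by (rule Linf_integrable_mult[OF Linf_indicator[OF that]]) (use h in simp)
  have "(\<lambda>k. \<integral>x. \<bar>h x\<bar> * indicator (A k) x \<partial>Delta_prob) \<longlonglongrightarrow> (\<integral>x. 0 \<partial>Delta_prob)"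
  proof (rule integral_dominated_convergence)
    show "integrable Delta_prob (\<lambda>x. \<bar>h x\<bar>)" using h by simp
    show "AE x in Delta_prob. (\<lambda>k. \<bar>h x\<bar> * indicator (A k) x) \<longlonglongrightarrow> 0"
    proof (rule AE_I2, rule tendsto_eventually)
      fix x assume "x \<in> space Delta_prob"
      obtain K :: nat where "\<bar>h x\<bar> \<le> real K" using real_arch_simple by blast
      then show "eventually (\<lambda>k. \<bar>h x\<bar> * indicator (A k) x = 0) sequentially"
        by (intro eventually_sequentiallyI[of K]) (auto simp: A_def)
    qed
    show "AE x in Delta_prob. norm (\<bar>h x\<bar> * indicator (A k) x) \<le> \<bar>h x\<bar>" for k
      by (rule AE_I2) (auto simp: indicator_def)
  qed measurable
  then obtain k where "norm (mass h (A k) - 0) < e/2"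
    using LIMSEQ_D[of _ _ "e/2"] e by fastforce
  then have k: "mass h (A k) < e/2" by simp
  show ?thesis
  proof (rule that[of "e / (2 * (real k + 1))"])
    show "e / (2 * (real k + 1)) > 0" using e by simp
    fix B assume B: "B \<in> sets Delta_prob" "measure Delta_prob B \<le> e / (2 * (real k + 1))"
    have "mass h B
        \<le> (\<integral>x. \<bar>h x\<bar> * indicator (A k) x + real k * indicator B x \<partial>Delta_prob)"
    proof (rule integral_mono)
      fix x assume "x \<in> space Delta_prob"
      then show "\<bar>h x\<bar> * indicator B x \<le> \<bar>h x\<bar> * indicator (A k) x + real k * indicator B x"
        by (auto simp: A_def indicator_def)
    qed (use B intB in auto)
    also have "\<dots> = mass h (A k) + real k * measure Delta_prob B"
      using B intB by simp
    also have "real k * measure Delta_prob B \<le> (real k + 1) * (e / (2 * (real k + 1)))"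
      using B e by (intro mult_mono) auto
    also have "\<dots> = e/2" by (simp add: field_simps)
    finally show "mass h B \<le> e" using k by simp
  qed
qed

lemma bidual_weak_limit:
  fixes z :: "nat \<Rightarrow> 'a::real_normed_vector"
  assumes z: "\<And>n. norm (z n) \<le> 1"
  obtains u :: "'a bidual" where "norm u \<le> 1"
    "\<And>\<phi>. ((\<lambda>n. blinfun_apply \<phi> (z n)) \<longlongrightarrow> u \<phi>) limit_filter"
proof -
  have bd: "\<bar>blinfun_apply \<phi> (z n)\<bar> \<le> norm \<phi>" for \<phi> :: "'a dual" and n
    using norm_blinfun[of \<phi> "z n"] mult_left_mono[OF z[of n] norm_ge_zero[of \<phi>]] by simp
  have "\<exists>l. ((\<lambda>n. blinfun_apply \<phi> (z n)) \<longlongrightarrow> l) limit_filter" for \<phi> :: "'a dual"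
    by (rule Bseq_limit_filter, rule BseqI'[of _ "norm \<phi>"]) (simp add: bd)
  then obtain p :: "'a dual \<Rightarrow> real" where p: "\<And>\<phi>. ((\<lambda>n. blinfun_apply \<phi> (z n)) \<longlongrightarrow> p \<phi>) limit_filter"
    by metis
  have ple: "\<bar>p \<phi>\<bar> \<le> norm \<phi>" for \<phi>
    by (rule limit_filter_le_bound[OF tendsto_rabs[OF p]]) (rule bd)
  have "bounded_linear p"
  proof (rule bounded_linear_intro[of _ 1])
    show "p (\<phi> + \<psi>) = p \<phi> + p \<psi>" for \<phi> \<psi>
      by (rule limit_filter_unique[OF p]) (simp add: blinfun.add_left tendsto_add[OF p p])
    show "p (c *\<^sub>R \<phi>) = c *\<^sub>R p \<phi>" for c \<phi>
      by (rule limit_filter_unique[OF p]) (simp add: blinfun.scaleR_left tendsto_mult_left[OF p])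
  qed (simp add: ple)
  then have "blinfun_apply (Blinfun p) = p" by (rule bounded_linear_Blinfun_apply)
  with p ple show ?thesis
    by (intro that[of "Blinfun p"] norm_blinfun_bound) auto
qed

text \<open>Let \<open>\<omega>\<close> be the limit, as the measure of \<open>A\<close> tends to \<open>0\<close>, of the largest mass on \<open>A\<close> of such a lift;
suppose that it exceeds \<open>c\<close>, the norm of the residuum operator. Choose lifts \<open>h n\<close> with mass nearly
\<open>\<omega>\<close> on sets \<open>A n\<close> whose measures decrease fast. As no lift has mass much larger than \<open>\<omega>\<close> on the
union of all these sets, each \<open>h n\<close> has almost no mass on that union outside its own set \<open>A n\<close>.
So the single function \<open>G m\<close>, which on disjoint parts of the sets \<open>A n\<close> with \<open>n \<ge> m\<close> equals the sign
of \<open>h n\<close>, pairs with every \<open>h n\<close>, \<open>n \<ge> m\<close>, to nearly \<open>\<omega>\<close>. Since \<open>G m\<close> lives on a small set, a small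
correction makes it a functional \<open>g m\<close> on \<open>X\<close>.

Let \<open>u\<close> be a weak-star limit of the points of the unit ball whose images the \<open>h n\<close> lift. The
second adjoint of \<open>T\<close> at \<open>u\<close> is within \<open>c + \<eta>\<close> of some point \<open>y\<close> of \<open>X\<close>, by the definition of
the residuum operator. Evaluate at \<open>g m\<close>: the second adjoint gives nearly \<open>\<omega>\<close>, whereas \<open>y\<close>
contributes nothing in the limit because \<open>G m\<close> lives on ever smaller sets. Hence \<open>\<omega>\<close> is
nearly at most \<open>c\<close>.\<close>

lemma lifts_asymptotically_equiintegrable:
  fixes T :: "L1_mod_R \<Rightarrow>\<^sub>L L1_mod_R" and C :: real
  assumes e: "e > 0"
  obtains d where "d > 0"
    "\<And>h z A. integrable Delta_prob h \<Longrightarrow> (\<integral>x. \<bar>h x\<bar> \<partial>Delta_prob) \<le> C \<Longrightarrow> norm z \<le> 1 \<Longrightarrow>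
      L1_quotient (abs_L1_Delta h) = T z \<Longrightarrow> A \<in> sets Delta_prob \<Longrightarrow> measure Delta_prob A \<le> d \<Longrightarrow>
      mass h A \<le> norm (residuum T) + e"
proof -
  define c where "c = norm (residuum T)"
  define H where "H = {h. integrable Delta_prob h \<and> (\<integral>x. \<bar>h x\<bar> \<partial>Delta_prob) \<le> C \<and>
    (\<exists>z. norm z \<le> 1 \<and> L1_quotient (abs_L1_Delta h) = T z)}"
  define S where "S = {r. \<exists>d>0. \<forall>h\<in>H. \<forall>A\<in>sets Delta_prob. measure Delta_prob A \<le> d \<longrightarrow>
    mass h A \<le> r}"
  have intA: "integrable Delta_prob (\<lambda>x. \<bar>h x\<bar> * indicator A x)" if "h \<in> H" "A \<in> sets Delta_prob"
    for h :: "(nat \<Rightarrow> real) \<Rightarrow> real" and A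
    by (rule Linf_integrable_mult[OF Linf_indicator[OF that(2)]]) (use that(1) in \<open>simp add: H_def\<close>)
  have C0: "0 \<le> C" if "h \<in> H" for h
  proof -
    have "0 \<le> (\<integral>x. \<bar>h x\<bar> \<partial>Delta_prob)" by (rule integral_nonneg_AE) simp
    also have "\<dots> \<le> C" using that by (simp add: H_def)
    finally show ?thesis .
  qed
  have zeroH: "(\<lambda>_. 0) \<in> H \<or> H = {}"
  proof (cases "H = {}")
    case False
    then have "0 \<le> C" using C0 by blast
    moreover have "abs_L1_Delta (\<lambda>_. 0) = 0" by (simp add: zero_L1_Delta_def)
    ultimately show ?thesis by (auto simp: H_def blinfun.zero_right intro: exI[of _ 0])
  qed simp
  have "c + e \<in> S"
  proof (cases "H = {}")
    case True
    then show ?thesis by (auto simp: S_def intro: exI[of _ 1])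
  next
    case False
    have CS: "C \<in> S"
      unfolding S_def mem_Collect_eq
    proof (intro exI[of _ 1] conjI ballI impI)
      fix h A assume h: "h \<in> H" "A \<in> sets Delta_prob"
      have "mass h A \<le> (\<integral>x. \<bar>h x\<bar> \<partial>Delta_prob)"
        using intA[OF h] h(1) by (intro integral_mono) (auto simp: H_def indicator_def)
      then show "mass h A \<le> C" using h(1) by (simp add: H_def)
    qed simp
    have S0: "0 \<le> r" if "r \<in> S" for r :: real
    proof -
      obtain d where d: "d > 0" "\<forall>h\<in>H. \<forall>A\<in>sets Delta_prob. measure Delta_prob A \<le> d \<longrightarrow>
          mass h A \<le> r"
        using \<open>r \<in> S\<close> unfolding S_def mem_Collect_eq by (elim exE conjE)
      have "(\<lambda>_. 0) \<in> H" using zeroH False by simp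
      from bspec[OF bspec[OF d(2) this] sets.empty_sets] d(1) show ?thesis by simp
    qed
    have bdd: "bdd_below S" by (rule bdd_belowI[of _ 0]) (rule S0)
    define \<omega> where "\<omega> = Inf S"
    have up: "r \<in> S" if "\<omega> < r" for r
    proof -
      have "S \<noteq> {}" using CS by blast
      then obtain s where s: "s \<in> S" "s < r"
        using \<open>\<omega> < r\<close> cInf_less_iff[OF _ bdd, of r] by (auto simp: \<omega>_def)
      from s(1) obtain d where d: "d > 0" "\<forall>h\<in>H. \<forall>A\<in>sets Delta_prob. measure Delta_prob A \<le> d \<longrightarrow>
          mass h A \<le> s"
        unfolding S_def mem_Collect_eq by (elim exE conjE)
      show ?thesis
        unfolding S_def mem_Collect_eq
      proof (intro exI[of _ d] conjI ballI impI d(1))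
        fix h A assume "h \<in> H" "A \<in> sets Delta_prob" "measure Delta_prob A \<le> d"
        from d(2)[rule_format, OF this] s(2)
        show "mass h A \<le> r" by linarith
      qed
    qed
    have low: "r \<notin> S" if "r < \<omega>" for r
      using that cInf_lower[OF _ bdd, of r] by (auto simp: \<omega>_def)
    have "\<omega> \<le> c"
    proof (rule ccontr)
      assume "\<not> \<omega> \<le> c"
      define \<eta> where "\<eta> = (\<omega> - c) / 10"
      have \<eta>: "\<eta> > 0" "\<omega> = c + 10 * \<eta>" using \<open>\<not> \<omega> \<le> c\<close> by (auto simp: \<eta>_def field_simps)
      have "\<omega> + \<eta> \<in> S" using up \<eta>(1) by simp
      then obtain d0 where d0': "d0 > 0" "\<forall>h\<in>H. \<forall>A\<in>sets Delta_prob. measure Delta_prob A \<le> d0 \<longrightarrow>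
          mass h A \<le> \<omega> + \<eta>"
        unfolding S_def mem_Collect_eq by (elim exE conjE)
      note d0 = d0'(1) d0'(2)[rule_format]
      \<comment> \<open>One step of the selection: from a bound \<open>p\<close> on the measure, a lift, a set of measure at most
        \<open>p\<close>, and a bound for the next step below which the lift has mass at most \<open>\<eta>\<close>.\<close>
      define R where "R p t \<longleftrightarrow> fst t \<in> H \<and> fst (snd t) \<in> sets Delta_prob \<and>
        measure Delta_prob (fst (snd t)) \<le> p \<and>
        \<omega> - \<eta> < mass (fst t) (fst (snd t)) \<and>
        0 < snd (snd t) \<and> snd (snd t) \<le> p / 2 \<and>
        (\<forall>B\<in>sets Delta_prob. measure Delta_prob B \<le> 2 * snd (snd t) \<longrightarrow>
          mass (fst t) B \<le> \<eta>)"
        for p :: real and t :: "((nat \<Rightarrow> real) \<Rightarrow> real) \<times> (nat \<Rightarrow> real) set \<times> real"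
      have step: "\<exists>t. R p t"
        if p: "p > 0" for p
      proof -
        have "\<omega> - \<eta> \<notin> S" using low \<eta>(1) by simp
        have "\<exists>h\<in>H. \<exists>A\<in>sets Delta_prob. measure Delta_prob A \<le> p \<and>
            \<not> mass h A \<le> \<omega> - \<eta>"
        proof (rule ccontr)
          assume "\<not> ?thesis"
          then have "\<forall>h\<in>H. \<forall>A\<in>sets Delta_prob. measure Delta_prob A \<le> p \<longrightarrow>
            mass h A \<le> \<omega> - \<eta>" by blast
          then have "\<omega> - \<eta> \<in> S" unfolding S_def mem_Collect_eq by (intro exI[of _ p] conjI p)
          with \<open>\<omega> - \<eta> \<notin> S\<close> show False by contradiction
        qed
        then obtain h A where hA: "h \<in> H" "A \<in> sets Delta_prob" "measure Delta_prob A \<le> p"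
          "\<omega> - \<eta> < mass h A"
          unfolding not_le by blast
        have "integrable Delta_prob h" using hA(1) by (simp add: H_def)
        then obtain d where d: "d > 0" "\<And>B. B \<in> sets Delta_prob \<Longrightarrow> measure Delta_prob B \<le> d \<Longrightarrow>
            mass h B \<le> \<eta>"
          using integral_absolutely_continuous[OF _ \<eta>(1)] by metis
        show ?thesis
          unfolding R_def using hA d(1) p
          by (intro exI[of _ "(h, A, min (p/2) (d/2))"]) (auto intro!: d(2))
      qed
      then obtain F where F: "\<And>p. p > 0 \<Longrightarrow> R p (F p)" by metis
      define hh where "hh p = fst (F p)" for p
      define AA where "AA p = fst (snd (F p))" for p
      define pp where "pp p = snd (snd (F p))" for p
      have st: "p > 0 \<Longrightarrow> hh p \<in> H" "p > 0 \<Longrightarrow> AA p \<in> sets Delta_prob"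
        "p > 0 \<Longrightarrow> measure Delta_prob (AA p) \<le> p"
        "p > 0 \<Longrightarrow> \<omega> - \<eta> < mass (hh p) (AA p)"
        "p > 0 \<Longrightarrow> 0 < pp p" "p > 0 \<Longrightarrow> pp p \<le> p / 2"
        "p > 0 \<Longrightarrow> B \<in> sets Delta_prob \<Longrightarrow> measure Delta_prob B \<le> 2 * pp p \<Longrightarrow>
          mass (hh p) B \<le> \<eta>" for p B
        using F[of p] unfolding R_def hh_def AA_def pp_def by auto
      \<comment> \<open>Starting at \<open>d0 / 2\<close> makes the union of all the sets have measure at most \<open>d0\<close>.\<close>
      define p where "p n = (pp ^^ n) (d0 / 2)" for n
      have p0: "p n > 0" for n
        by (induction n) (use d0(1) st(5) in \<open>auto simp: p_def\<close>)
      have pS: "p (Suc n) = pp (p n)" for n by (simp add: p_def)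
      define h where "h n = hh (p n)" for n
      define A where "A n = AA (p n)" for n
      have hH: "h n \<in> H" for n unfolding h_def by (rule st(1)[OF p0])
      have As [measurable]: "A n \<in> sets Delta_prob" for n unfolding A_def by (rule st(2)[OF p0])
      have Ap: "measure Delta_prob (A n) \<le> p n" for n unfolding A_def by (rule st(3)[OF p0])
      have hA: "\<omega> - \<eta> < mass (h n) (A n)" for n
        unfolding A_def h_def by (rule st(4)[OF p0])
      have hB: "mass (h n) B \<le> \<eta>"
        if "B \<in> sets Delta_prob" "measure Delta_prob B \<le> 2 * p (Suc n)" for n B
        unfolding h_def by (rule st(7)[OF p0]) (use that in \<open>auto simp: pS\<close>)
      have hi: "integrable Delta_prob (h n)" for n using hH[of n] by (simp add: H_def)
      have [measurable]: "h n \<in> borel_measurable Delta_prob" for n using hi by auto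
      \<comment> \<open>By geometric decay the union of the sets from \<open>m\<close> on has measure at most \<open>2 * p m\<close>.\<close>
      have pdec: "p (m + i) \<le> p m * (1/2) ^ i" for m i
      proof (induction i)
        case (Suc i)
        have "p (m + Suc i) \<le> p (m + i) / 2" using st(6)[OF p0[of "m + i"]] by (simp add: pS)
        with Suc show ?case by simp
      qed simp
      define U where "U m = (\<Union>i. A (m + i))" for m
      have Us [measurable]: "U m \<in> sets Delta_prob" for m unfolding U_def by measurable
      have Up: "measure Delta_prob (U m) \<le> 2 * p m" for m
      proof -
        have sm: "summable (\<lambda>i. p m * (1/2) ^ i)" by (intro summable_mult summable_geometric) simp
        have le: "measure Delta_prob (A (m + i)) \<le> p m * (1/2) ^ i" for i
          using Ap[of "m + i"] pdec[of m i] by simp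
        have sA: "summable (\<lambda>i. measure Delta_prob (A (m + i)))"
          by (rule summable_comparison_test[OF exI[of _ 0] sm]) (use le in auto)
        have "measure Delta_prob (U m) \<le> (\<Sum>i. measure Delta_prob (A (m + i)))"
          unfolding U_def by (rule Delta.finite_measure_subadditive_countably) (use sA in auto)
        also have "\<dots> \<le> (\<Sum>i. p m * (1/2) ^ i)" by (rule suminf_le[OF le sA sm])
        also have "\<dots> = p m * 2" by (subst suminf_mult) (auto simp: suminf_geometric summable_geometric)
        finally show ?thesis by simp
      qed
      have Usub: "A j \<subseteq> U m" if "m \<le> j" for m j
      proof -
        have "A (m + (j - m)) \<subseteq> U m" unfolding U_def by blast
        then show ?thesis using that by simp
      qed
      have U0: "U m \<subseteq> U 0" for m
      proof -
        have "A (m + i) \<subseteq> U 0" for i by (rule Usub) simp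
        then show ?thesis unfolding U_def[of m] by blast
      qed
      \<comment> \<open>Later sets are removed from earlier ones and not conversely: \<open>A n\<close> thereby loses only the mass
        of \<open>h n\<close> on \<open>U (Suc n)\<close>, which was made small after \<open>h n\<close> had been chosen.\<close>
      define D where "D j = A j - U (Suc j)" for j
      have Ds [measurable]: "D j \<in> sets Delta_prob" for j unfolding D_def by measurable
      have Ddisj: "i = j" if "x \<in> D i" "x \<in> D j" for i j x
      proof -
        have "\<not> i < j" "\<not> j < i" using that Usub[of "Suc i" j] Usub[of "Suc j" i] by (auto simp: D_def)
        then show ?thesis by simp
      qed
      define G where "G m x = (\<Sum>i. indicator (D (m + i)) x * sgn (h (m + i) x))" for m x
      have G1: "G m x = sgn (h n x)" if "x \<in> D n" "m \<le> n" for m n x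
      proof -
        have "(\<lambda>i. indicator (D (m + i)) x * sgn (h (m + i) x))
            = (\<lambda>i. if i = n - m then sgn (h n x) else 0)"
        proof
          fix i
          show "indicator (D (m + i)) x * sgn (h (m + i) x) = (if i = n - m then sgn (h n x) else 0)"
          proof (cases "x \<in> D (m + i)")
            case True
            then have "m + i = n" using Ddisj that(1) by blast
            with True show ?thesis by auto
          next
            case False
            then have "i \<noteq> n - m" using that by auto
            with False show ?thesis by simp
          qed
        qed
        then show ?thesis
          unfolding G_def using sums_unique[OF sums_single[of "n - m" "\<lambda>_. sgn (h n x)"]] by simp
      qed
      have G0: "G m x = 0" if "\<And>n. m \<le> n \<Longrightarrow> x \<notin> D n" for m x
        using that by (simp add: G_def)
      have Gabs: "\<bar>G m x\<bar> \<le> indicator (U m) x" for m x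
      proof (cases "\<exists>n\<ge>m. x \<in> D n")
        case True
        then obtain n where n: "m \<le> n" "x \<in> D n" by blast
        then have "x \<in> U m" using Usub[OF n(1)] by (auto simp: D_def)
        then show ?thesis using G1[OF n(2,1)] by (simp add: abs_sgn_eq)
      next
        case False
        then show ?thesis using G0[of m x] by auto
      qed
      have GL: "Linf 1 (G m)" for m
        unfolding Linf_def
      proof (intro conjI ballI)
        show "G m \<in> borel_measurable Delta_prob"
          unfolding G_def[abs_def] by (intro borel_measurable_suminf) measurable
        show "\<bar>G m x\<bar> \<le> 1" for x using Gabs[of m x] by (cases "x \<in> U m") auto
      qed
      have big: "\<omega> - 5 * \<eta> \<le> (\<integral>x. h n x * G m x \<partial>Delta_prob)" if mn: "m \<le> n" for m n
      proof -
        have i1: "integrable Delta_prob (\<lambda>x. \<bar>h n x\<bar> * indicator B x)" if "B \<in> sets Delta_prob" for B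
          by (rule intA[OF hH that])
        \<comment> \<open>Here the near maximality of the mass of \<open>h n\<close> on \<open>A n\<close> is used.\<close>
        have "mass (h n) (U 0) \<le> \<omega> + \<eta>"
          using d0(2)[OF hH Us[of 0]] Up[of 0] by (simp add: p_def)
        moreover have "mass (h n) (U 0)
            = mass (h n) (A n) + mass (h n) (U 0 - A n)"
        proof -
          have "indicator (U 0) x = indicator (A n) x + (indicator (U 0 - A n) x :: real)" for x
            using Usub[of 0 n] by (auto simp: indicator_def)
          then have "mass (h n) (U 0)
              = (\<integral>x. \<bar>h n x\<bar> * indicator (A n) x + \<bar>h n x\<bar> * indicator (U 0 - A n) x \<partial>Delta_prob)"
            by (simp add: distrib_left)
          then show ?thesis using i1 by simp
        qed
        ultimately have "mass (h n) (U 0 - A n) \<le> 2 * \<eta>"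
          using hA[of n] by linarith
        moreover have "mass (h n) (U (Suc n)) \<le> \<eta>"
          by (rule hB[OF Us Up])
        moreover have "mass (h n) (A n)
            - 2 * mass (h n) (U (Suc n))
            - mass (h n) (U 0 - A n)
          = (\<integral>x. \<bar>h n x\<bar> * indicator (A n) x - 2 * (\<bar>h n x\<bar> * indicator (U (Suc n)) x)
              - \<bar>h n x\<bar> * indicator (U 0 - A n) x \<partial>Delta_prob)"
          using i1 by simp
        moreover have "\<dots> \<le> (\<integral>x. h n x * G m x \<partial>Delta_prob)"
        proof (rule integral_mono)
          show "integrable Delta_prob (\<lambda>x. h n x * G m x)" by (rule Linf_integrable_mult[OF GL hi])
          fix x
          have "\<bar>h n x * G m x\<bar> \<le> \<bar>h n x\<bar> * indicator (U m) x"
            using Gabs[of m x] by (simp add: abs_mult mult_left_mono)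
          then have lo: "- (\<bar>h n x\<bar> * indicator (U m) x) \<le> h n x * G m x" by linarith
          show "\<bar>h n x\<bar> * indicator (A n) x - 2 * (\<bar>h n x\<bar> * indicator (U (Suc n)) x)
              - \<bar>h n x\<bar> * indicator (U 0 - A n) x \<le> h n x * G m x"
          proof (cases "x \<in> D n")
            case True
            then have "h n x * G m x = \<bar>h n x\<bar>" by (simp only: G1[OF True mn] abs_sgn)
            moreover have "0 \<le> \<bar>h n x\<bar> * indicator (U 0 - A n) x" by simp
            ultimately show ?thesis using True by (simp add: D_def)
          next
            case False
            then show ?thesis
              using lo U0[of m] U0[of "Suc n"]
              by (cases "x \<in> A n"; cases "x \<in> U (Suc n)"; cases "x \<in> U m"; cases "x \<in> U 0")
                (auto simp: D_def)
          qed
        qed (use i1 in auto)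
        ultimately show ?thesis using hA[of n] by linarith
      qed
      define \<tau> where "\<tau> m = 2 * sqrt (2 * p m)" for m
      have p_lim: "p \<longlonglongrightarrow> 0"
      proof (rule Lim_null_comparison)
        show "eventually (\<lambda>n. norm (p n) \<le> p 0 * (1/2) ^ n) sequentially"
          using pdec[of 0] p0 by (auto simp: abs_of_pos)
        show "(\<lambda>n. p 0 * (1/2) ^ n) \<longlonglongrightarrow> 0"
          by (intro tendsto_mult_right_zero LIMSEQ_realpow_zero) auto
      qed
      have \<tau>_lim: "\<tau> \<longlonglongrightarrow> 0"
        unfolding \<tau>_def[abs_def] using tendsto_mult[OF tendsto_const tendsto_real_sqrt[OF tendsto_mult[OF tendsto_const p_lim]], of 2 2]
        by simp
      have "\<exists>\<psi> :: L1_Delta dual. (\<forall>j. blinfun_apply \<psi> (rademacher_L1 j) = pairing (G m) (rademacher_L1 j)) \<and> norm \<psi> \<le> \<tau> m" for m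
      proof -
        obtain \<psi> :: "L1_Delta dual" where \<psi>: "\<And>j. blinfun_apply \<psi> (rademacher_L1 j) = pairing (G m) (rademacher_L1 j)"
          "norm \<psi> \<le> 2 * sqrt (\<integral>x. (G m x)\<^sup>2 \<partial>Delta_prob)"
          using rademacher_functional_correction[OF GL] by metis
        have "(\<integral>x. (G m x)\<^sup>2 \<partial>Delta_prob) \<le> (\<integral>x. indicator (U m) x \<partial>Delta_prob)"
        proof (rule integral_mono)
          show "integrable Delta_prob (\<lambda>x. (G m x)\<^sup>2)"
            using Linf_integrable[OF Linf_mult[OF GL GL]] by (simp add: power2_eq_square)
          show "(G m x)\<^sup>2 \<le> indicator (U m) x" for x
            using Gabs[of m x] by (cases "x \<in> U m") (auto simp: abs_square_le_1)
        qed simp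
        also have "\<dots> \<le> 2 * p m" using Up[of m] by simp
        finally have "norm \<psi> \<le> \<tau> m" using \<psi>(2) unfolding \<tau>_def by (meson mult_left_mono order_trans real_sqrt_le_mono zero_le_numeral)
        with \<psi>(1) show ?thesis by blast
      qed
      then obtain \<psi> :: "nat \<Rightarrow> L1_Delta dual" where
        \<psi>: "\<And>m j. blinfun_apply (\<psi> m) (rademacher_L1 j) = pairing (G m) (rademacher_L1 j)" "\<And>m. norm (\<psi> m) \<le> \<tau> m"
        by metis
      have "\<exists>g :: L1_mod_R dual. \<forall>f. blinfun_apply g (L1_quotient f) = (pairing (G m) - \<psi> m) f" for m
        by (rule descend_to_quotient[of "pairing (G m) - \<psi> m"]) (auto simp: blinfun.diff_left \<psi>(1))
      then obtain g :: "nat \<Rightarrow> L1_mod_R dual" where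
        g: "\<And>m f. blinfun_apply (g m) (L1_quotient f) = pairing (G m) f - \<psi> m f"
        by (metis blinfun.diff_left)
      have \<psi>le: "\<bar>\<psi> m f\<bar> \<le> \<tau> m * norm f" for m f
        using norm_blinfun[of "\<psi> m" f] mult_right_mono[OF \<psi>(2)[of m] norm_ge_zero[of f]] by simp
      have gn: "norm (g m) \<le> 1 + \<tau> m" for m
      proof (rule norm_le_norm_compose_L1_quotient)
        have "0 \<le> norm (\<psi> m)" by simp
        then show "0 \<le> 1 + \<tau> m" using \<psi>(2)[of m] by linarith
        fix f
        have "\<bar>pairing (G m) f\<bar> \<le> 1 * norm f"
          using norm_blinfun[of "pairing (G m)" f]
            mult_right_mono[OF pairing_abs(2)[OF GL[of m] hi[of 0]] norm_ge_zero[of f]] by simp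
        then show "norm (g m (L1_quotient f)) \<le> (1 + \<tau> m) * norm f"
          using \<psi>le[of m f] by (simp add: g distrib_right)
      qed
      have "\<exists>z. norm z \<le> 1 \<and> L1_quotient (abs_L1_Delta (h n)) = T z" for n
        using hH[of n] by (simp add: H_def)
      then obtain z where z: "\<And>n. norm (z n) \<le> 1" "\<And>n. L1_quotient (abs_L1_Delta (h n)) = T (z n)"
        by metis
      obtain u :: "L1_mod_R bidual" where u: "norm u \<le> 1" "\<And>\<phi>. ((\<lambda>n. blinfun_apply \<phi> (z n)) \<longlongrightarrow> u \<phi>) limit_filter"
        using bidual_weak_limit[of z] z(1) by metis
      define v where "v = adjoint_op (adjoint_op T) u"
      have vlim: "((\<lambda>n. blinfun_apply \<phi> (T (z n))) \<longlongrightarrow> v \<phi>) limit_filter" for \<phi> :: "L1_mod_R dual"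
        using u(2)[of "\<phi> o\<^sub>L T"] by (simp add: v_def adjoint_op.rep_eq)
      have "norm (abs_co v) \<le> c * norm (abs_co u)"
        unfolding v_def residuum_abs_co[symmetric] c_def by (rule norm_blinfun)
      also have "\<dots> \<le> c * 1"
        using norm_abs_co_le[of u] u(1) by (intro mult_left_mono) (auto simp: c_def)
      finally have "norm (abs_co v) < c + \<eta>" using \<eta> by simp
      then obtain y where y: "norm (v - canonical_embedding y) < c + \<eta>"
        by (rule norm_co_less_witness)
      obtain f where f: "L1_quotient f = y" using L1_quotient_lift[of 1 y] by auto
      obtain a where a: "integrable Delta_prob a" "f = abs_L1_Delta a" by (rule L1_Delta_repr)
      define \<beta> where "\<beta> m = mass a (U m)" for m
      have ai: "integrable Delta_prob (\<lambda>x. \<bar>a x\<bar> * indicator (U m) x)" for m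
        by (rule Linf_integrable_mult[OF Linf_indicator[OF Us]]) (use a in simp)
      have \<beta>0: "0 \<le> \<beta> m" for m unfolding \<beta>_def by (rule integral_nonneg_AE) simp
      have \<beta>_lim: "\<beta> \<longlonglongrightarrow> 0"
      proof (rule LIMSEQ_I)
        fix r :: real assume "r > 0"
        then have "r/2 > 0" by simp
        then obtain d where d: "d > 0" "\<And>B. B \<in> sets Delta_prob \<Longrightarrow> measure Delta_prob B \<le> d \<Longrightarrow>
            mass a B \<le> r/2"
          using integral_absolutely_continuous[OF a(1)] by metis
        obtain N where N: "\<And>n. n \<ge> N \<Longrightarrow> norm (p n - 0) < d/2"
          using LIMSEQ_D[OF p_lim, of "d/2"] d(1) by auto
        have "norm (\<beta> n - 0) < r" if "n \<ge> N" for n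
        proof -
          have "measure Delta_prob (U n) \<le> d" using N[OF that] Up[of n] p0[of n] by simp
          then have "\<beta> n \<le> r/2" unfolding \<beta>_def by (rule d(2)[OF Us])
          then show ?thesis using \<beta>0[of n] \<open>r > 0\<close> by simp
        qed
        then show "\<exists>N. \<forall>n\<ge>N. norm (\<beta> n - 0) < r" by blast
      qed
      have main: "\<omega> - 5 * \<eta> - \<tau> m * C \<le> (c + \<eta>) * (1 + \<tau> m) + (\<beta> m + \<tau> m * norm f)" for m
      proof -
        have \<tau>0: "0 \<le> \<tau> m" using \<psi>(2)[of m] norm_ge_zero[of "\<psi> m"] by linarith
        have lb: "\<omega> - 5 * \<eta> - \<tau> m * C \<le> g m (T (z n))" if "m \<le> n" for n
        proof -
          have "\<bar>\<psi> m (abs_L1_Delta (h n))\<bar> \<le> \<tau> m * (\<integral>x. \<bar>h n x\<bar> \<partial>Delta_prob)"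
            using \<psi>le[of m "abs_L1_Delta (h n)"] by (simp add: norm_abs_L1_Delta hi)
          also have "\<dots> \<le> \<tau> m * C"
            using hH[of n] \<tau>0 by (intro mult_left_mono) (auto simp: H_def)
          finally have "\<bar>\<psi> m (abs_L1_Delta (h n))\<bar> \<le> \<tau> m * C" .
          then show ?thesis
            using big[OF that] by (simp add: z(2)[symmetric] g pairing_abs(1)[OF GL hi])
        qed
        have "- v (g m) \<le> - (\<omega> - 5 * \<eta> - \<tau> m * C)"
        proof (rule limit_filter_le_bound[OF tendsto_minus[OF vlim[of "g m"]]])
          fix n assume "m \<le> n"
          from lb[OF this] show "- g m (T (z n)) \<le> - (\<omega> - 5 * \<eta> - \<tau> m * C)" by linarith
        qed
        then have "\<omega> - 5 * \<eta> - \<tau> m * C \<le> v (g m)" by simp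
        also have "v (g m) = (v - canonical_embedding y) (g m) + g m y"
          by (simp add: blinfun.diff_left canonical_embedding.rep_eq)
        also have "(v - canonical_embedding y) (g m) \<le> norm (v - canonical_embedding y) * norm (g m)"
          using norm_blinfun[of "v - canonical_embedding y" "g m"] by simp
        also have "\<dots> \<le> (c + \<eta>) * (1 + \<tau> m)"
          using y gn[of m] \<eta> by (intro mult_mono) (auto simp: c_def)
        also have "g m y \<le> \<beta> m + \<tau> m * norm f"
        proof -
          have "pairing (G m) f = (\<integral>x. a x * G m x \<partial>Delta_prob)"
            unfolding a(2) by (rule pairing_abs(1)[OF GL a(1)])
          also have "\<dots> \<le> \<beta> m"
            unfolding \<beta>_def
          proof (rule integral_mono[OF Linf_integrable_mult[OF GL a(1)] ai])
            fix x
            have "a x * G m x \<le> \<bar>a x\<bar> * \<bar>G m x\<bar>" by (metis abs_ge_self abs_mult)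
            also have "\<dots> \<le> \<bar>a x\<bar> * indicator (U m) x" using Gabs[of m x] by (intro mult_left_mono) auto
            finally show "a x * G m x \<le> \<bar>a x\<bar> * indicator (U m) x" .
          qed
          finally show ?thesis using \<psi>le[of m f] by (simp add: f[symmetric] g)
        qed
        finally show ?thesis by simp
      qed
      have "\<omega> - 5 * \<eta> - 0 * C \<le> (c + \<eta>) * (1 + 0) + (0 + 0 * norm f)"
      proof (rule LIMSEQ_le)
        show "(\<lambda>m. \<omega> - 5 * \<eta> - \<tau> m * C) \<longlonglongrightarrow> \<omega> - 5 * \<eta> - 0 * C"
          by (intro tendsto_intros \<tau>_lim)
        show "(\<lambda>m. (c + \<eta>) * (1 + \<tau> m) + (\<beta> m + \<tau> m * norm f)) \<longlonglongrightarrow> (c + \<eta>) * (1 + 0) + (0 + 0 * norm f)"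
          by (intro tendsto_intros \<tau>_lim \<beta>_lim)
      qed (use main in blast)
      with \<eta> show False by simp
    qed
    then show ?thesis using up[of "c + e"] e by simp
  qed
  then obtain d where d: "d > 0" "\<forall>h\<in>H. \<forall>A\<in>sets Delta_prob. measure Delta_prob A \<le> d \<longrightarrow>
      mass h A \<le> c + e"
    unfolding S_def mem_Collect_eq by (elim exE conjE)
  show ?thesis
    by (rule that[OF d(1)]) (use d(2)[rule_format] in \<open>auto simp: H_def c_def\<close>)
qed


section \<open>Approximation by weakly compact operators\<close>

text \<open>A lift of norm at most \<open>C\<close> exceeds \<open>M = C / d\<close> in modulus only on a set of measure at most \<open>d\<close>, so
cutting it off at the level \<open>M\<close> costs at most its mass on such a set.\<close>

lemma truncation:
  fixes T :: "L1_mod_R \<Rightarrow>\<^sub>L L1_mod_R"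
  assumes e: "e > 0"
  obtains M where "0 \<le> M"
    "\<And>z. norm z \<le> 1 \<Longrightarrow> \<exists>h\<in>Linf_ball M. norm (T z - L1_quotient h) \<le> norm (residuum T) + e"
proof -
  define C where "C = norm T + 1"
  have C: "C > 0" unfolding C_def using norm_ge_zero[of T] by linarith
  obtain d where d: "d > 0"
    "\<And>h z A. integrable Delta_prob h \<Longrightarrow> (\<integral>x. \<bar>h x\<bar> \<partial>Delta_prob) \<le> C \<Longrightarrow> norm z \<le> 1 \<Longrightarrow>
      L1_quotient (abs_L1_Delta h) = T z \<Longrightarrow> A \<in> sets Delta_prob \<Longrightarrow> measure Delta_prob A \<le> d \<Longrightarrow>
      mass h A \<le> norm (residuum T) + e"
  proof (rule lifts_asymptotically_equiintegrable[OF e, of C T])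
    fix d assume d: "d > 0"
      "\<And>h z A. integrable Delta_prob h \<Longrightarrow> (\<integral>x. \<bar>h x\<bar> \<partial>Delta_prob) \<le> C \<Longrightarrow> norm z \<le> 1 \<Longrightarrow>
        L1_quotient (abs_L1_Delta h) = T z \<Longrightarrow> A \<in> sets Delta_prob \<Longrightarrow> measure Delta_prob A \<le> d \<Longrightarrow>
        mass h A \<le> norm (residuum T) + e"
    show thesis by (rule that[OF d])
  qed
  define M where "M = C / d"
  have M: "M > 0" using C d(1) by (simp add: M_def)
  show ?thesis
  proof (rule that[of M])
    show "0 \<le> M" using M by simp
    fix z :: L1_mod_R assume z: "norm z \<le> 1"
    obtain f where f: "L1_quotient f = T z" "norm f < norm (T z) + 1"
      using L1_quotient_lift[of 1 "T z"] by auto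
    obtain h where h: "integrable Delta_prob h" "f = abs_L1_Delta h" by (rule L1_Delta_repr)
    have [measurable]: "h \<in> borel_measurable Delta_prob" using h by auto
    have "norm (T z) \<le> norm T"
      using norm_blinfun[of T z] mult_left_mono[OF z norm_ge_zero[of T]] by simp
    with f(2) h have hC: "(\<integral>x. \<bar>h x\<bar> \<partial>Delta_prob) \<le> C"
      by (simp add: norm_abs_L1_Delta C_def)
    define A where "A = {x \<in> space Delta_prob. M < \<bar>h x\<bar>}"
    have As [measurable]: "A \<in> sets Delta_prob" by (simp add: A_def)
    have hA: "integrable Delta_prob (\<lambda>x. \<bar>h x\<bar> * indicator A x)"
      by (rule Linf_integrable_mult[OF Linf_indicator[OF As]]) (use h in simp)
    have "M * measure Delta_prob A = (\<integral>x. M * indicator A x \<partial>Delta_prob)" by simp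
    also have "\<dots> \<le> (\<integral>x. \<bar>h x\<bar> \<partial>Delta_prob)"
    proof (rule integral_mono)
      show "integrable Delta_prob (\<lambda>x. M * indicator A x)" using As by simp
      show "integrable Delta_prob (\<lambda>x. \<bar>h x\<bar>)" using h by simp
      show "M * indicator A x \<le> \<bar>h x\<bar>" for x by (auto simp: A_def indicator_def)
    qed
    also have "\<dots> \<le> M * d" using hC d(1) by (simp add: M_def)
    finally have "measure Delta_prob A \<le> d" using M by simp
    then have small: "mass h A \<le> norm (residuum T) + e"
      using d(2)[OF h(1) hC z _ As] f(1) h(2) by simp
    define t where "t x = max (- M) (min M (h x))" for x
    have t: "Linf M t" unfolding Linf_def t_def using M by auto
    have ti: "integrable Delta_prob t" by (rule Linf_integrable[OF t])
    have "norm (T z - L1_quotient (abs_L1_Delta t)) = norm (L1_quotient (abs_L1_Delta (\<lambda>x. h x - t x)))"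
      using h ti by (simp add: f(1)[symmetric] diff_abs_L1_Delta[symmetric] blinfun.diff_right)
    also have "\<dots> \<le> norm (abs_L1_Delta (\<lambda>x. h x - t x))" by (rule norm_L1_quotient_le)
    also have "\<dots> = (\<integral>x. \<bar>h x - t x\<bar> \<partial>Delta_prob)"
      using h ti by (simp add: norm_abs_L1_Delta)
    also have "\<dots> \<le> mass h A"
    proof (rule integral_mono)
      fix x assume "x \<in> space Delta_prob"
      then show "\<bar>h x - t x\<bar> \<le> \<bar>h x\<bar> * indicator A x"
        using M by (auto simp: t_def A_def indicator_def max_def min_def abs_if)
    qed (use h ti hA in auto)
    finally have "norm (T z - L1_quotient (abs_L1_Delta t)) \<le> norm (residuum T) + e"
      using small by simp
    with t show "\<exists>h\<in>Linf_ball M. norm (T z - L1_quotient h) \<le> norm (residuum T) + e"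
      by (auto simp: Linf_ball_def)
  qed
qed

text \<open>The operator \<open>V\<close> is the weak limit of operators which send the normalised indicator functions
of the cylinder sets of length \<open>n\<close> to truncated lifts of their images. No compatibility between
different \<open>n\<close> is needed, because the limit is taken weakly.\<close>

lemma Linf_valued_approximation:
  fixes T :: "L1_mod_R \<Rightarrow>\<^sub>L L1_mod_R"
  assumes e: "e > 0"
  obtains M V where "0 \<le> M" "Linf_valued M V"
    "\<And>f. norm (T (L1_quotient f) - L1_quotient (V f)) \<le> (norm (residuum T) + e) * norm f"
proof -
  define c where "c = norm (residuum T) + e"
  have c0: "0 \<le> c" unfolding c_def using e norm_ge_zero[of "residuum T"] by linarith
  obtain M where M: "0 \<le> M" "\<And>z. norm z \<le> 1 \<Longrightarrow> \<exists>h\<in>Linf_ball M. norm (T z - L1_quotient h) \<le> c"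
    using truncation[OF e, of T] unfolding c_def by blast
  define z where "z n w = L1_quotient (cyl_density n w)" for n w
  have z1: "norm (z n w) \<le> 1" if "w \<in> words n" for n w
    using norm_L1_quotient_le[of "cyl_density n w"] norm_cyl_density[OF that] by (simp add: z_def)
  define k where "k n w = (SOME h. h \<in> Linf_ball M \<and> norm (T (z n w) - L1_quotient h) \<le> c)" for n w
  have k: "k n w \<in> Linf_ball M \<and> norm (T (z n w) - L1_quotient (k n w)) \<le> c" if "w \<in> words n" for n w
    unfolding k_def by (rule someI_ex) (use M(2)[OF z1[OF that]] in blast)
  obtain V where V: "Linf_valued M V" "\<And>f. weak_lim (\<lambda>n. cyl_op n (k n) f) (V f)"
  proof -
    have "Linf_valued M (cyl_op n (k n))" for n
      by (rule Linf_valued_cyl_op) (use k M(1) in auto)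
    from Linf_valued_weak_lim[of M "\<lambda>n. cyl_op n (k n)", OF this] show ?thesis using that by blast
  qed
  show ?thesis
  proof (rule that[OF M(1) V(1)])
    fix f
    have "weak_lim (\<lambda>n. T (L1_quotient (cond_exp_cyl n f)) - L1_quotient (cyl_op n (k n) f))
        (T (L1_quotient f) - L1_quotient (V f))"
      by (intro weak_lim_diff weak_lim_blinfun V(2) weak_lim_tendsto cond_exp_cyl_tendsto)
    moreover have "norm (T (L1_quotient (cond_exp_cyl n f)) - L1_quotient (cyl_op n (k n) f)) \<le> c * norm f" for n
    proof -
      have eq: "T (L1_quotient (cond_exp_cyl n f)) - L1_quotient (cyl_op n (k n) f)
          = cyl_op n (\<lambda>w. T (z n w) - L1_quotient (k n w)) f"
        by (simp add: cond_exp_cyl_def blinfun_cyl_op cyl_op_diff z_def)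
      have "norm (cyl_op n (\<lambda>w. T (z n w) - L1_quotient (k n w))) \<le> c"
        by (rule norm_cyl_op_le) (use k c0 in auto)
      then show ?thesis
        unfolding eq
        by (meson mult_right_mono norm_blinfun norm_ge_zero order_trans)
    qed
    ultimately show "norm (T (L1_quotient f) - L1_quotient (V f)) \<le> (norm (residuum T) + e) * norm f"
      unfolding c_def by (rule weak_lim_norm_le)
  qed
qed

text \<open>The unit ball of \<open>X\<close> is contained in the image of twice the unit ball of \<open>L\<^sup>1(\<Delta>)\<close>.\<close>

lemma weakly_compact_descends:
  fixes W :: "L1_mod_R \<Rightarrow>\<^sub>L 'b::real_normed_vector"
  assumes U: "weakly_compact_op U" and W: "\<And>f. W (L1_quotient f) = U f"
  shows "weakly_compact_op W"
proof -
  obtain K where K: "blinfun_apply (2 *\<^sub>R U) ` cball 0 1 \<subseteq> K" "compact (evaluation ` K)"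
    using weakly_compact_op_scaleR[OF U, of 2] unfolding weakly_compact_op_iff by blast
  have "blinfun_apply W ` cball 0 1 \<subseteq> K"
  proof clarify
    fix x :: L1_mod_R assume x: "x \<in> cball 0 1"
    obtain f where f: "L1_quotient f = x" "norm f < norm x + 1"
      using L1_quotient_lift[of 1 x] by auto
    have "(2 *\<^sub>R U) ((1/2) *\<^sub>R f) \<in> K"
      by (rule subsetD[OF K(1)], rule imageI) (use f(2) x in simp)
    moreover have "(2 *\<^sub>R U) ((1/2) *\<^sub>R f) = W x"
      using W[of f] by (simp add: f(1) blinfun.scaleR_left blinfun.scaleR_right)
    ultimately show "W x \<in> K" by simp
  qed
  with K(2) show ?thesis unfolding weakly_compact_op_iff by blast
qed

lemma rademacher_L1_in_kernel: "L1_quotient (rademacher_L1 j) = 0"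
proof -
  have "rademacher_L1 j \<in> Rademacher_span"
    unfolding Rademacher_span_def by (intro subsetD[OF closure_subset] span_base rangeI)
  then show ?thesis by (simp add: L1_quotient_apply zero_L1_mod_R_def L1_mod_R.abs_eq_iff)
qed

text \<open>A Rademacher function is the difference of the indicator functions of two sets that depend on one
coordinate.\<close>

lemma cond_exp_cyl_rademacher:
  assumes j: "j < n"
  shows "cond_exp_cyl n (rademacher_L1 j) = rademacher_L1 j"
proof -
  define A where "A s = {x \<in> space Delta_prob. x j = s}" for s
  have [measurable, simp]: "A s \<in> sets Delta_prob" for s unfolding A_def by (rule sets_coordinate)
  have "rademacher_L1 j = abs_L1_Delta (\<lambda>x. indicator (A 1) x - indicator (A (-1)) x)"
    unfolding rademacher_L1_def
  proof (rule abs_L1_Delta_cong_AE[OF integrable_rademacher _ AE_I2])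
    fix x assume x: "x \<in> space Delta_prob"
    then have "x j = -1 \<or> x j = 1" by (auto simp: space_Delta_prob)
    with x show "rademacher j x = indicator (A 1) x - indicator (A (-1)) x"
      by (auto simp: A_def rademacher_def)
  qed measurable
  also have "\<dots> = ind_L1 (A 1) - ind_L1 (A (-1))"
    unfolding ind_L1_def by (rule diff_abs_L1_Delta[symmetric]) simp_all
  finally have r: "rademacher_L1 j = ind_L1 (A 1) - ind_L1 (A (-1))" .
  have "cond_exp_cyl n (ind_L1 (A s)) = ind_L1 (A s)" for s
    by (rule cond_exp_cyl_indicator) (use j in \<open>auto simp: A_def\<close>)
  then show ?thesis by (simp add: r blinfun.diff_right)
qed

lemma weak_norm_le_twice_norm_residuum:
  fixes T :: "L1_mod_R \<Rightarrow>\<^sub>L L1_mod_R"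
  shows "weak_norm T \<le> 2 * norm (residuum T)"
proof (rule field_le_epsilon)
  fix e' :: real assume "e' > 0"
  define e where "e = e' / 3"
  have e: "e > 0" using \<open>e' > 0\<close> by (simp add: e_def)
  define c where "c = norm (residuum T) + e"
  have c0: "0 \<le> c" unfolding c_def using e norm_ge_zero[of "residuum T"] by linarith
  obtain M V where V: "0 \<le> M" "Linf_valued M V"
    "\<And>f. norm (T (L1_quotient f) - L1_quotient (V f)) \<le> c * norm f"
  proof (rule Linf_valued_approximation[OF e, of T, folded c_def])
    fix M V assume "0 \<le> M" "Linf_valued M V"
      "\<And>f. norm (T (L1_quotient f) - L1_quotient (V f)) \<le> c * norm f"
    then show thesis by (rule that)
  qed
  obtain n D where D: "weakly_compact_op D" "norm D \<le> e"
    "\<And>j. D (rademacher_L1 j) = (if n \<le> j then V (rademacher_L1 j) else 0)"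
  proof (rule rademacher_extension_small[OF V(2,1) e])
    fix n and D :: "L1_Delta \<Rightarrow>\<^sub>L L1_Delta"
    assume "weakly_compact_op D" "norm D \<le> e"
      "\<And>j. D (rademacher_L1 j) = (if n \<le> j then V (rademacher_L1 j) else 0)"
    then show thesis by (rule that)
  qed
  define B where "B = (T o\<^sub>L L1_quotient) - (L1_quotient o\<^sub>L V)"
  have B: "B f = T (L1_quotient f) - L1_quotient (V f)" for f
    by (simp add: B_def blinfun.diff_left)
  define E where "E = cond_exp_cyl n"
  have E: "E (rademacher_L1 j) = (if j < n then rademacher_L1 j else 0)" for j
  proof (cases "j < n")
    case True
    then show ?thesis by (simp add: E_def cond_exp_cyl_rademacher)
  next
    case False
    then show ?thesis by (simp add: E_def cond_exp_cyl_def cyl_op_rademacher)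
  qed
  \<comment> \<open>\<open>q V + (T q - q V) E\<close> vanishes at the first \<open>n\<close> Rademacher functions because \<open>T q\<close> does;
    \<open>q D\<close> takes care of the others.\<close>
  define U where "U = (L1_quotient o\<^sub>L V) + (B o\<^sub>L E) - (L1_quotient o\<^sub>L D)"
  have U: "U f = L1_quotient (V f) + B (E f) - L1_quotient (D f)" for f
    by (simp add: U_def blinfun.add_left blinfun.diff_left)
  have "B o\<^sub>L E = cyl_op n (\<lambda>w. B (cyl_density n w))"
    by (rule blinfun_eqI) (simp add: E_def cond_exp_cyl_def blinfun_cyl_op)
  then have BE: "weakly_compact_op (B o\<^sub>L E)" by (simp add: weakly_compact_cyl_op)
  have QV: "weakly_compact_op (L1_quotient o\<^sub>L V)"
    by (rule weakly_compact_op_comp_left[OF Linf_valued_imp_weakly_compact[OF V(2,1)]])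
  have QD: "weakly_compact_op (L1_quotient o\<^sub>L D)"
    by (rule weakly_compact_op_comp_left[OF D(1)])
  have Uw: "weakly_compact_op U"
    using subspace_diff[OF subspace_weakly_compact_op, of "(L1_quotient o\<^sub>L V) + (B o\<^sub>L E)" "L1_quotient o\<^sub>L D"]
      weakly_compact_op_add[OF QV BE] QD by (simp add: U_def)
  have "U (rademacher_L1 j) = 0" for j
    by (cases "j < n") (simp_all add: U E B D(3) rademacher_L1_in_kernel blinfun.zero_right)
  then obtain W :: "L1_mod_R \<Rightarrow>\<^sub>L L1_mod_R" where W: "\<And>f. W (L1_quotient f) = U f"
    using descend_to_quotient[of U] by blast
  have Ww: "weakly_compact_op W" by (rule weakly_compact_descends[OF Uw W])
  have "norm (T - W) \<le> 2 * c + e"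
  proof (rule norm_le_norm_compose_L1_quotient)
    show "0 \<le> 2 * c + e" using c0 e by simp
    fix f
    have "(T - W) (L1_quotient f) = B (f - E f) + L1_quotient (D f)"
      by (simp add: blinfun.diff_left W U B blinfun.diff_right)
    also have "norm \<dots> \<le> norm (B (f - E f)) + norm (L1_quotient (D f))"
      by (rule norm_triangle_ineq)
    also have "norm (B (f - E f)) \<le> c * norm (f - E f)" unfolding B by (rule V(3))
    also have "\<dots> \<le> c * (2 * norm f)"
    proof (rule mult_left_mono[OF _ c0])
      have "norm (E f) \<le> 1 * norm f"
        using norm_blinfun[of E f] mult_right_mono[OF norm_cond_exp_cyl_le[of n] norm_ge_zero[of f]]
        unfolding E_def by linarith
      then show "norm (f - E f) \<le> 2 * norm f" using norm_triangle_ineq4[of f "E f"] by simp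
    qed
    also have "norm (L1_quotient (D f)) \<le> e * norm f"
      using norm_L1_quotient_le[of "D f"] norm_blinfun[of D f] mult_right_mono[OF D(2) norm_ge_zero[of f]]
      by linarith
    finally show "norm ((T - W) (L1_quotient f)) \<le> (2 * c + e) * norm f"
      by (simp add: algebra_simps)
  qed
  moreover have "weak_norm T \<le> norm (T - W)"
    unfolding weak_norm_eq_infdist using infdist_le[of W "{W. weakly_compact_op W}" T] Ww
    by (simp add: dist_norm)
  ultimately show "weak_norm T \<le> 2 * norm (residuum T) + e'"
    by (simp add: c_def e_def)
qed

theorem theorem2:
  shows "(\<forall>T :: L1_mod_R \<Rightarrow>\<^sub>L L1_mod_R.
            norm (residuum T) \<le> weak_norm T \<and> weak_norm T \<le> 2 * norm (residuum T)) \<and>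
         (\<exists>\<Phi> :: L1_mod_R weak_calkin \<Rightarrow> (L1_mod_R co \<Rightarrow>\<^sub>L L1_mod_R co).
            (\<forall>T. \<Phi> (abs_weak_calkin T) = residuum T) \<and>
            bounded_linear \<Phi> \<and>
            (\<forall>a b. \<Phi> (a * b) = \<Phi> a o\<^sub>L \<Phi> b) \<and>
            \<Phi> 1 = id_blinfun \<and>
            inj \<Phi> \<and>
            closed (range \<Phi>) \<and>
            (\<forall>S\<in>range \<Phi>. norm (inv \<Phi> S) \<le> 2 * norm S))"
proof (intro conjI allI exI[of _ residuum_calkin] ballI)
  have two: "(0::real) < 2" by simp
  note emb = residuum_calkin_embedding[OF two weak_norm_le_twice_norm_residuum]
  show "inj (residuum_calkin :: L1_mod_R weak_calkin \<Rightarrow> _)" by (rule emb)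
  show "closed (range (residuum_calkin :: L1_mod_R weak_calkin \<Rightarrow> _))" by (rule emb)
  show "norm (inv residuum_calkin S) \<le> 2 * norm S"
    if "S \<in> range (residuum_calkin :: L1_mod_R weak_calkin \<Rightarrow> _)" for S
    using that by (rule emb)
qed (rule norm_residuum_le_weak_norm weak_norm_le_twice_norm_residuum residuum_calkin.abs_eq
    bounded_linear_residuum_calkin residuum_calkin_mult residuum_calkin_1)+

end
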